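(* Let $G$ be a finite group, let $p$ be a prime divisor of $|G|$, and let $S$ be a Sylow $p$-subgroup of $G$. Suppose that there exists a subgroup $D$ of $S$ with $1<|D|<|S|$ such that one of the following holds: (1) $p$ is odd, and every subgroup of $S$ of order $|D|$ is a strong $p$-$CAP$-subgroup of $G$; (2) $p=2$, every subgroup of $S$ of order $|D|$ is a strong $2$-$CAP$-subgroup of $G$, the exponent of $S$ divides $2^2=4$, and, if $S$ is non-abelian and $|S|/2>|D|=p=2$, every cyclic subgroup of $S$ of order $4$ is a strong $2$-$CAP$-subgroup of $G$. Then the fusion system $\mathcal{F}_S(G)$ is supersolvable.
   Context: All groups are finite. For a subgroup $A$ of a group $G$ and a chief factor $H/K$ of $G$, $A$ covers $H/K$ if $HA=KA$, and avoids $H/K$ if $H\cap A=K\cap A$. For a prime $p$, $A$ is a $p$-$CAP$-subgroup of $G$ if $A$ covers or avoids every chief factor of $G$ whose order is divisible by $p$. $A$ is a strong $p$-$CAP$-subgroup of $G$ if $A$ is a $p$-$CAP$-subgroup of $H$ for every subgroup $H$ of $G$ with $A\leq H$. For a finite group $G$ and a Sylow $p$-subgroup $S$ of $G$, $\mathcal{F}_S(G)$ is the fusion system over $S$ whose objects are the subgroups of $S$ and whose morphisms $P\to Q$ are the homomorphisms induced by conjugation by elements $g\in G$ with $P^g\leq Q$. For a fusion system $\mathcal{F}$ over $S$, a subgroup $T\leq S$ is strongly $\mathcal{F}$-closed if $\varphi(R)\leq T$ for every $R\leq T$ and every $\mathcal{F}$-morphism $\varphi:R\to S$. $\mathcal{F}$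 is supersolvable if there is a series $1=S_0\leq S_1\leq\cdots\leq S_n=S$ of strongly $\mathcal{F}$-closed subgroups of $S$ such that $S_{i+1}/S_i$ is cyclic for all $0\leq i<n$. *)

theory Defs
  imports "HOL-Algebra.Algebra" "HOL-Computational_Algebra.Primes"
begin

text \<open>Subgroups are carrier sets; a subgroup \<open>A\<close> of \<open>G\<close> regarded as a group is
  \<open>G\<lparr>carrier := A\<rparr>\<close>, and \<open>subgroup B (G\<lparr>carrier := A\<rparr>)\<close> says that \<open>B\<close> is a subgroup of \<open>A\<close>.\<close>

definition sylow_subgroup :: "('a, 'b) monoid_scheme \<Rightarrow> nat \<Rightarrow> 'a set \<Rightarrow> bool" where
  "sylow_subgroup G p S \<longleftrightarrow> subgroup S G \<and> card S = p ^ multiplicity p (order G)"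

definition group_exponent :: "('a, 'b) monoid_scheme \<Rightarrow> nat" where
  "group_exponent G = Lcm (group.ord G ` carrier G)"

definition chief_factor :: "('a, 'b) monoid_scheme \<Rightarrow> 'a set \<Rightarrow> 'a set \<Rightarrow> bool" where
  "chief_factor G H K \<longleftrightarrow> H \<lhd> G \<and> K \<lhd> G \<and> K \<subset> H \<and> (\<nexists>N. N \<lhd> G \<and> K \<subset> N \<and> N \<subset> H)"

definition covers :: "('a, 'b) monoid_scheme \<Rightarrow> 'a set \<Rightarrow> 'a set \<Rightarrow> 'a set \<Rightarrow> bool" where
  "covers G A H K \<longleftrightarrow> H <#>\<^bsub>G\<^esub> A = K <#>\<^bsub>G\<^esub> A"

definition avoids :: "'a set \<Rightarrow> 'a set \<Rightarrow> 'a set \<Rightarrow> bool" where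
  "avoids A H K \<longleftrightarrow> H \<inter> A = K \<inter> A"

definition p_CAP_subgroup :: "('a, 'b) monoid_scheme \<Rightarrow> nat \<Rightarrow> 'a set \<Rightarrow> bool" where
  "p_CAP_subgroup G p A \<longleftrightarrow> subgroup A G \<and>
     (\<forall>H K. chief_factor G H K \<and> p dvd order (G\<lparr>carrier := H\<rparr> Mod K)
        \<longrightarrow> covers G A H K \<or> avoids A H K)"

definition strong_p_CAP_subgroup :: "('a, 'b) monoid_scheme \<Rightarrow> nat \<Rightarrow> 'a set \<Rightarrow> bool" where
  "strong_p_CAP_subgroup G p A \<longleftrightarrow> subgroup A G \<and>
     (\<forall>H. subgroup H G \<and> A \<subseteq> H \<longrightarrow> p_CAP_subgroup (G\<lparr>carrier := H\<rparr>) p A)"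

text \<open>A fusion system over a group \<open>S\<close> is given by its sets of morphisms \<open>F P Q\<close>
  for subgroups \<open>P\<close>, \<open>Q\<close> of \<open>S\<close>. A morphism \<open>P \<rightarrow> Q\<close> is a function that is \<open>undefined\<close>
  outside \<open>P\<close>, so that two elements of the ambient group inducing the same homomorphism
  on \<open>P\<close> give the same morphism. Conjugation is \<open>x\<^sup>g = g\<^sup>-\<^sup>1 x g\<close>.\<close>

type_synonym 'a homs = "'a set \<Rightarrow> 'a set \<Rightarrow> ('a \<Rightarrow> 'a) set"

definition conj_by :: "('a, 'b) monoid_scheme \<Rightarrow> 'a \<Rightarrow> 'a \<Rightarrow> 'a" where
  "conj_by G g x = inv\<^bsub>G\<^esub> g \<otimes>\<^bsub>G\<^esub> x \<otimes>\<^bsub>G\<^esub> g"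

definition group_fusion_system :: "('a, 'b) monoid_scheme \<Rightarrow> 'a set \<Rightarrow> 'a homs" where
  "group_fusion_system G S P Q =
     {restrict (conj_by G g) P | g.
        subgroup P (G\<lparr>carrier := S\<rparr>) \<and> subgroup Q (G\<lparr>carrier := S\<rparr>) \<and>
        g \<in> carrier G \<and> conj_by G g ` P \<subseteq> Q}"

definition strongly_closed :: "('a, 'b) monoid_scheme \<Rightarrow> 'a homs \<Rightarrow> 'a set \<Rightarrow> bool" where
  "strongly_closed S F T \<longleftrightarrow> subgroup T S \<and>
     (\<forall>R \<phi>. subgroup R (S\<lparr>carrier := T\<rparr>) \<and> \<phi> \<in> F R (carrier S) \<longrightarrow> \<phi> ` R \<subseteq> T)"

text \<open>The normality of each term in the next one, without which the quotient would not be a group,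
  is not an extra restriction: conjugations by elements of \<open>S\<close> are morphisms, so strongly closed
  subgroups are normal in \<open>S\<close> (proved below for \<open>group_fusion_system\<close>).\<close>

definition supersolvable_fusion :: "('a, 'b) monoid_scheme \<Rightarrow> 'a homs \<Rightarrow> bool" where
  "supersolvable_fusion S F \<longleftrightarrow>
     (\<exists>(n::nat) T. T 0 = {\<one>\<^bsub>S\<^esub>} \<and> T n = carrier S \<and>
        (\<forall>i\<le>n. strongly_closed S F (T i)) \<and>
        (\<forall>i<n. T i \<lhd> S\<lparr>carrier := T (Suc i)\<rparr> \<and>
           cyclic_group (S\<lparr>carrier := T (Suc i)\<rparr> Mod T i)))"

lemma strongly_closed_imp_normal:
  assumes G: "group G" and S: "subgroup S G"
    and T: "strongly_closed (G\<lparr>carrier := S\<rparr>) (group_fusion_system G S) T"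
  shows "T \<lhd> G\<lparr>carrier := S\<rparr>"
proof -
  interpret G: group G by fact
  interpret S: group "G\<lparr>carrier := S\<rparr>"
    using G.subgroup_imp_group S by blast
  have TS: "subgroup T (G\<lparr>carrier := S\<rparr>)"
    using T by (simp add: strongly_closed_def)
  then have sub: "T \<subseteq> S" using subgroup.subset by fastforce
  have SG: "S \<subseteq> carrier G" using S subgroup.subset by blast
  have TG: "subgroup T G" using G.incl_subgroup S TS by blast
  have TT: "subgroup T (G\<lparr>carrier := T\<rparr>)"
    using TG G.subgroup_incl by blast
  have SS: "subgroup S (G\<lparr>carrier := S\<rparr>)"
    using S G.subgroup_incl by blast
  have c: "conj_by G g x \<in> T" if g: "g \<in> S" and x: "x \<in> T" for g x
  proof -
    have "conj_by G g ` T \<subseteq> S"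
      using g sub S unfolding conj_by_def
      by (auto intro!: subgroup.m_closed[OF S] subgroup.m_inv_closed[OF S])
    then have "restrict (conj_by G g) T \<in> group_fusion_system G S T S"
      using g SG TS SS unfolding group_fusion_system_def by blast
    moreover have "\<phi> ` T \<subseteq> T" if "\<phi> \<in> group_fusion_system G S T S" for \<phi>
      using T TT that unfolding strongly_closed_def by simp
    ultimately have "restrict (conj_by G g) T ` T \<subseteq> T" by blast
    then show ?thesis using x by auto
  qed
  show ?thesis
    unfolding S.normal_inv_iff
  proof (intro conjI ballI TS)
    fix g x assume g: "g \<in> carrier (G\<lparr>carrier := S\<rparr>)" and x: "x \<in> T"
    then have "conj_by G (inv\<^bsub>G\<^esub> g) x \<in> T"
      using c subgroup.m_inv_closed[OF S] by auto
    then show "g \<otimes>\<^bsub>G\<lparr>carrier := S\<rparr>\<^esub> x \<otimes>\<^bsub>G\<lparr>carrier := S\<rparr>\<^esub> inv\<^bsub>G\<lparr>carrier := S\<rparr>\<^esub> g \<in> T"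
      using g SG by (auto simp: conj_by_def G.m_inv_consistent[OF S] subset_iff)
  qed
qed

end

theory Submission
  imports Defs "HOL-Number_Theory.Number_Theory"
begin

text \<open>For a subgroup \<open>H\<close> let \<open>R(H)\<close> be the smallest normal subgroup with \<open>H/R(H)\<close> abelian of exponent
  dividing \<open>p - 1\<close>; it acts trivially on every chief factor of order \<open>p\<close>. If \<open>R(N\<^sub>G(Q))\<close> induces a
  \<open>p\<close>-group on \<open>Q\<close> for all \<open>p\<close>-subgroups \<open>Q\<close>, then every \<open>Aut\<^sub>G(Q)\<close> has a normal Sylow \<open>p\<close>-subgroup, so
  \<open>N\<^sub>G(S)\<close> controls fusion in \<open>S\<close>; its chief factors below \<open>S\<close> are modules for an abelian group of exponent
  dividing \<open>p - 1\<close>, hence of order \<open>p\<close>, and a chief series below \<open>S\<close> consists of strongly closed subgroups.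

  The condition on \<open>R(N\<^sub>G(Q))\<close> is proved by induction on \<open>|G|\<close>, where \<open>|D| = p\<^sup>d\<close>. The key step: let \<open>P\<close> be
  a normal \<open>p\<close>-subgroup of \<open>G\<close> contained in a \<open>p\<close>-subgroup \<open>S\<close>, \<open>Y\<close> a \<open>q\<close>-subgroup of \<open>R(G)\<close>, and \<open>W\<close> a maximal
  subgroup of \<open>S\<close> containing \<open>C\<^sub>P(Y)\<close> but not \<open>P\<close>. Let \<open>V\<close> be the largest normal subgroup of \<open>G\<close> in \<open>W \<inter> P\<close> and
  \<open>U/V\<close> a chief factor below \<open>P\<close>. By coprime action \<open>Y\<close> is nontrivial on \<open>U/V\<close>, so \<open>|U/V| > p\<close>, and if
  \<open>|V| < p\<^sup>d\<close>, then a subgroup \<open>A\<close> of order \<open>p\<^sup>d\<close> with \<open>V < A \<le> W\<close> and \<open>A \<inter> U \<noteq> V\<close> neither covers nor avoids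
  \<open>U/V\<close>. Hence \<open>|V| \<ge> p\<^sup>d\<close>. If \<open>|P| > p\<^sup>d\<close>, take \<open>S = P\<close>; inductively \<open>Y\<close> centralizes \<open>V\<close>, which yields
  elements of order \<open>p\<close> in \<open>U\<close> outside \<open>V\<close> and again a subgroup \<open>A\<close> violating the hypothesis; so \<open>R(G)\<close> induces
  a \<open>p\<close>-group on \<open>P\<close>.

  In general choose \<open>J\<close> maximal among the normal subgroups of \<open>G\<close> that act by inner automorphisms on a Sylow
  \<open>p\<close>-subgroup \<open>P\<close> of \<open>J\<close> normal in \<open>G\<close>, and \<open>L/J\<close> as the largest normal \<open>p'\<close>-subgroup of \<open>G/J\<close>; we may assume
  \<open>|P| \<le> p\<^sup>d\<close>. If some \<open>q\<close>-element of \<open>L \<inter> R(G)\<close> is nontrivial on \<open>P\<close>, the Frattini argument for a Sylow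
  \<open>q\<close>-subgroup of \<open>L\<close> gives the situation of the key step with \<open>S = P T\<close> and \<open>W \<ge> C\<^sub>P(Y) T\<close>, contradicting
  \<open>|V| < |P|\<close>. Otherwise \<open>L/J\<close> is central in \<open>G/J\<close>. A chief factor \<open>M/L\<close> avoided by all subgroups of order
  \<open>p\<^sup>d\<close> forces \<open>P\<close> to be cyclic of order \<open>p\<^sup>d\<close>. If it is covered by one of them, a Sylow \<open>p\<close>-subgroup \<open>T\<close> of
  \<open>M\<close> satisfies \<open>J T \<lhd> G\<close>, hence \<open>G = J N\<^sub>G(T)\<close>, and induction applies to \<open>N\<^sub>G(T)\<close>.\<close>

section \<open>Groups as types\<close>

hide_const (open) Divisibility.prime

text \<open>The arguments take place inside groups that are types, where membership conditions on single elements
  disappear; a finite group embeds into such a type by its regular representation.\<close>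

class mult_group = monoid_mult +
  fixes iv :: "'a \<Rightarrow> 'a"
  assumes iv_left [simp]: "iv a * a = 1"
begin

lemma iv_cancel_left [simp]: "iv a * (a * b) = b"
  by (simp flip: mult.assoc)

lemma mult_left_cancel_iff [simp]: "a * b = a * c \<longleftrightarrow> b = c"
  by (metis iv_cancel_left)

lemma iv_right [simp]: "a * iv a = 1"
  by (metis iv_cancel_left iv_left mult_1_right)

lemma iv_cancel_right [simp]: "a * (iv a * b) = b"
  by (simp flip: mult.assoc)

lemma mult_right_cancel_iff [simp]: "b * a = c * a \<longleftrightarrow> b = c"
  by (metis iv_right mult.assoc mult_1_right)

lemma iv_unique: "a * b = 1 \<Longrightarrow> iv a = b"
  by (metis iv_cancel_left mult_1_right)

lemma iv_iv [simp]: "iv (iv a) = a"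
  by (rule iv_unique) simp

lemma iv_one [simp]: "iv 1 = 1"
  by (rule iv_unique) simp

lemma iv_mult [simp]: "iv (a * b) = iv b * iv a"
  by (rule iv_unique) (simp add: mult.assoc)

text \<open>The inverse of the convention used for \<open>conj_by\<close>.\<close>

definition cj :: "'a \<Rightarrow> 'a \<Rightarrow> 'a" where "cj g x = g * x * iv g"

lemma cj_mult: "cj g (x * y) = cj g x * cj g y"
  by (simp add: cj_def mult.assoc)

lemma cj_cj: "cj g (cj h x) = cj (g * h) x"
  by (simp add: cj_def mult.assoc)

lemma cj_one [simp]: "cj g 1 = 1" "cj 1 x = x"
  by (simp_all add: cj_def mult.assoc)

lemma cj_iv: "cj g (iv x) = iv (cj g x)"
  by (simp add: cj_def mult.assoc)

lemma cj_iv_cj [simp]: "cj (iv g) (cj g x) = x" "cj g (cj (iv g) x) = x"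
  by (simp_all add: cj_cj)

lemma cj_inject [simp]: "cj g x = cj g y \<longleftrightarrow> x = y"
  by (metis cj_iv_cj(1))

lemma cj_power: "cj g (x ^ n) = cj g x ^ n"
  by (induction n) (simp_all add: cj_mult)

lemma cj_eq_iff: "cj g x = x \<longleftrightarrow> g * x = x * g"
  unfolding cj_def by (metis iv_left iv_right mult.assoc mult_1_right)

lemma inj_cj: "inj_on (cj g) A"
  by (simp add: inj_on_def)

lemma card_cj [simp]: "card (cj g ` A) = card A"
  by (simp add: card_image inj_cj)

lemma cj_image_cj: "cj g ` cj h ` A = cj (g * h) ` A"
  by (simp add: image_image cj_cj)

lemma cj_image_iv: "cj (iv g) ` cj g ` A = A" "cj g ` cj (iv g) ` A = A"
  by (simp_all add: image_image)

section \<open>Finite subgroups, normal subgroups and products of subsets\<close>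

text \<open>Finiteness is part of the notion because the ambient type may be infinite: the regular
  representation takes values in the bijections of a whole type.\<close>

definition sg :: "'a set \<Rightarrow> bool" where
  "sg H \<longleftrightarrow> finite H \<and> 1 \<in> H \<and> (\<forall>a\<in>H. \<forall>b\<in>H. a * b \<in> H) \<and> (\<forall>a\<in>H. iv a \<in> H)"

lemma sgD:
  assumes "sg H"
  shows sg_finite: "finite H" and sg_one: "1 \<in> H"
    and sg_mult: "a \<in> H \<Longrightarrow> b \<in> H \<Longrightarrow> a * b \<in> H"
    and sg_iv: "a \<in> H \<Longrightarrow> iv a \<in> H"
  using assms by (auto simp: sg_def)

lemma sg_power: "sg H \<Longrightarrow> a \<in> H \<Longrightarrow> a ^ n \<in> H"
  by (induction n) (auto simp: sg_def)

lemma sg_cj: "sg H \<Longrightarrow> a \<in> H \<Longrightarrow> b \<in> H \<Longrightarrow> cj a b \<in> H"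
  by (simp add: cj_def sg_mult sg_iv)

lemma sg_Int: "sg A \<Longrightarrow> sg B \<Longrightarrow> sg (A \<inter> B)"
  by (auto simp: sg_def)

lemma sg_triv: "sg {1}"
  by (simp add: sg_def)

lemma sg_card_pos: "sg H \<Longrightarrow> 0 < card H"
  by (auto simp: sg_def card_gt_0_iff)

lemma sg_cj_image: "sg H \<Longrightarrow> sg (cj g ` H)"
  unfolding sg_def
  by (auto simp flip: cj_mult cj_iv) (metis cj_one(1) image_eqI)

lemma sg_mult_left_iff: "sg H \<Longrightarrow> a \<in> H \<Longrightarrow> a * b \<in> H \<longleftrightarrow> b \<in> H"
  by (metis iv_cancel_left sg_iv sg_mult)

lemma sg_mult_right_iff: "sg H \<Longrightarrow> b \<in> H \<Longrightarrow> a * b \<in> H \<longleftrightarrow> a \<in> H"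
  by (metis iv_right mult.assoc mult_1_right sg_iv sg_mult)

text \<open>Left multiplication by an element of a finite set closed under products is injective,
  hence onto, so it reaches \<open>1\<close>.\<close>

lemma sg_finite_closed:
  assumes "finite H" "1 \<in> H" and m: "\<And>a b. a \<in> H \<Longrightarrow> b \<in> H \<Longrightarrow> a * b \<in> H"
  shows "sg H"
proof -
  have "iv a \<in> H" if a: "a \<in> H" for a
  proof -
    have "(*) a ` H \<subseteq> H" using a m by auto
    moreover have "inj_on ((*) a) H" by (simp add: inj_on_def)
    ultimately have "(*) a ` H = H" using assms(1) by (simp add: endo_inj_surj)
    then obtain b where b: "b \<in> H" "a * b = 1" using assms(2) by (metis imageE)
    then show ?thesis using iv_unique by metis
  qed
  then show ?thesis using assms by (auto simp: sg_def)
qed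

lemma cj_subset_eq:
  assumes "finite A" "cj g ` A \<subseteq> A" shows "cj g ` A = A"
  using assms inj_cj by (simp add: endo_inj_surj)

definition nm :: "'a set \<Rightarrow> 'a set \<Rightarrow> bool" where
  "nm N H \<longleftrightarrow> sg N \<and> sg H \<and> N \<subseteq> H \<and> (\<forall>h\<in>H. \<forall>n\<in>N. cj h n \<in> N)"

lemma nmD:
  assumes "nm N H"
  shows nm_sg1: "sg N" and nm_sg2: "sg H" and nm_sub: "N \<subseteq> H"
    and nm_cj: "h \<in> H \<Longrightarrow> n \<in> N \<Longrightarrow> cj h n \<in> N"
  using assms by (auto simp: nm_def)

lemma nm_refl: "sg H \<Longrightarrow> nm H H"
  by (simp add: nm_def sg_cj)

lemma nm_triv: "sg H \<Longrightarrow> nm {1} H"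
  by (simp add: nm_def sg_triv sg_one)

lemma nm_subgroup: "nm N H \<Longrightarrow> sg K \<Longrightarrow> N \<subseteq> K \<Longrightarrow> K \<subseteq> H \<Longrightarrow> nm N K"
  by (auto simp: nm_def)

lemma nm_Int_subgroup: "nm N H \<Longrightarrow> sg K \<Longrightarrow> K \<subseteq> H \<Longrightarrow> nm (N \<inter> K) K"
  by (auto simp: nm_def sg_Int sg_cj)

lemma nm_cj_eq: "nm N H \<Longrightarrow> h \<in> H \<Longrightarrow> cj h ` N = N"
  by (rule cj_subset_eq) (auto simp: nm_def sg_finite)

lemma nm_comm: "nm N H \<Longrightarrow> h \<in> H \<Longrightarrow> n \<in> N \<Longrightarrow> iv n * cj h n \<in> N"
  by (simp add: nm_def sg_iv sg_mult)

definition sp :: "'a set \<Rightarrow> 'a set \<Rightarrow> 'a set" where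
  "sp A B = {a * b | a b. a \<in> A \<and> b \<in> B}"

lemma sp_finite: "finite A \<Longrightarrow> finite B \<Longrightarrow> finite (sp A B)"
proof -
  have "sp A B = (\<lambda>(a, b). a * b) ` (A \<times> B)" by (auto simp: sp_def)
  then show "finite A \<Longrightarrow> finite B \<Longrightarrow> finite (sp A B)" by simp
qed

lemma spI: "a \<in> A \<Longrightarrow> b \<in> B \<Longrightarrow> a * b \<in> sp A B"
  by (auto simp: sp_def)

lemma spE: "x \<in> sp A B \<Longrightarrow> (\<And>a b. a \<in> A \<Longrightarrow> b \<in> B \<Longrightarrow> x = a * b \<Longrightarrow> P) \<Longrightarrow> P"
  by (auto simp: sp_def)

lemma sp_sub1: "1 \<in> B \<Longrightarrow> A \<subseteq> sp A B"
  by (force simp: sp_def)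

lemma sp_sub2: "1 \<in> A \<Longrightarrow> B \<subseteq> sp A B"
  by (force simp: sp_def)

lemma sp_least: "sg C \<Longrightarrow> A \<subseteq> C \<Longrightarrow> B \<subseteq> C \<Longrightarrow> sp A B \<subseteq> C"
  by (auto simp: sp_def intro: sg_mult)

lemma sp_sg:
  assumes A: "sg A" and B: "sg B" and n: "\<And>a b. a \<in> A \<Longrightarrow> b \<in> B \<Longrightarrow> cj b a \<in> A"
  shows "sg (sp A B)"
proof (rule sg_finite_closed)
  show "finite (sp A B)" using A B by (simp add: sp_finite sg_finite)
  show "1 \<in> sp A B" using spI[of 1 A 1 B] A B by (simp add: sg_one)
  fix x y assume "x \<in> sp A B" "y \<in> sp A B"
  then obtain a b c d where *: "a \<in> A" "b \<in> B" "c \<in> A" "d \<in> B" "x = a * b" "y = c * d"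
    by (auto elim!: spE)
  have "x * y = (a * cj b c) * (b * d)" by (simp add: * cj_def mult.assoc)
  then show "x * y \<in> sp A B" using * n A B by (auto intro!: spI sg_mult)
qed

lemma sp_nm_sg: "nm N H \<Longrightarrow> sg B \<Longrightarrow> B \<subseteq> H \<Longrightarrow> sg (sp N B)"
  by (rule sp_sg) (auto simp: nm_def)

lemma sp_nm: "nm N H \<Longrightarrow> nm M H \<Longrightarrow> nm (sp N M) H"
  unfolding nm_def[of "sp N M"]
proof (intro conjI ballI)
  assume N: "nm N H" and M: "nm M H"
  show "sg (sp N M)" using N M by (metis nmD sp_nm_sg)
  show "sg H" using N nm_def by auto
  show "sp N M \<subseteq> H" using N M sp_least nmD by metis
  fix h x assume "h \<in> H" "x \<in> sp N M"
  then show "cj h x \<in> sp N M"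
    by (elim spE) (simp add: cj_mult spI nm_cj[OF N] nm_cj[OF M])
qed

end

section \<open>Cosets, orbits and fixed points\<close>

text \<open>The fibres of \<open>f\<close> are the left cosets of \<open>K\<close>. For a coset map
  this is Lagrange's theorem, for an orbit map the orbit-stabilizer theorem.\<close>

lemma coset_count:
  fixes P K :: "'a::mult_group set"
  assumes P: "sg P" and K: "sg K" "K \<subseteq> P"
    and f: "\<And>g h. g \<in> P \<Longrightarrow> h \<in> P \<Longrightarrow> f g = f h \<longleftrightarrow> iv g * h \<in> K"
  shows "card (f ` P) * card K = card P"
proof -
  have *: "card {x \<in> P. f x = y} = card K" if y: "y \<in> f ` P" for y
  proof -
    obtain g where g: "g \<in> P" "y = f g" using y by auto
    have "{x \<in> P. f x = y} = (*) g ` K"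
    proof (intro equalityI subsetI)
      fix x assume "x \<in> {x \<in> P. f x = y}"
      then have "iv g * x \<in> K" using f[of g x] g by simp
      then show "x \<in> (*) g ` K" by (intro image_eqI[of _ _ "iv g * x"]) simp_all
    next
      fix x assume "x \<in> (*) g ` K"
      then obtain k where "k \<in> K" "x = g * k" by auto
      then show "x \<in> {x \<in> P. f x = y}"
        using f[of g x] g K P sg_mult[OF P] by auto
    qed
    then show ?thesis by (simp add: card_image inj_on_def)
  qed
  have "card P = (\<Sum>y\<in>f ` P. card {x \<in> P. f x = y})"
    using sum.image_gen[OF sg_finite[OF P], of "\<lambda>_. 1::nat" f] by simp
  also have "\<dots> = card (f ` P) * card K" using * by simp
  finally show ?thesis by simp
qed

lemma lcoset_eq_iff:
  fixes K :: "'a::mult_group set"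
  assumes K: "sg K" shows "(*) g ` K = (*) h ` K \<longleftrightarrow> iv g * h \<in> K"
proof
  assume "(*) g ` K = (*) h ` K"
  then have "h \<in> (*) g ` K" using sg_one[OF K] by (metis image_eqI mult_1_right)
  then show "iv g * h \<in> K" by auto
next
  assume *: "iv g * h \<in> K"
  have "h * k \<in> (*) g ` K" "g * k \<in> (*) h ` K" if "k \<in> K" for k
  proof -
    have "h * k = g * ((iv g * h) * k)" "g * k = h * (iv (iv g * h) * k)"
      by (simp_all add: mult.assoc)
    then show "h * k \<in> (*) g ` K" "g * k \<in> (*) h ` K"
      using * that K by (metis image_eqI sg_iv sg_mult)+
  qed
  then show "(*) g ` K = (*) h ` K" by auto
qed

lemma card_lcosets:
  fixes K :: "'a::mult_group set"
  assumes "sg P" "sg K" "K \<subseteq> P"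
  shows "card ((\<lambda>g. (*) g ` K) ` P) * card K = card P"
  using coset_count[OF assms, of "\<lambda>g. (*) g ` K"] lcoset_eq_iff[OF assms(2)] by blast

lemma sg_dvd: "sg P \<Longrightarrow> sg K \<Longrightarrow> K \<subseteq> P \<Longrightarrow> card K dvd card (P :: 'a::mult_group set)"
  using card_lcosets dvd_triv_right by metis

text \<open>The product, which need not be a subgroup, is a disjoint union of cosets of
  \<open>B\<close>; two elements of \<open>A\<close> give the same coset iff they agree modulo
  \<open>A \<inter> B\<close>.\<close>

lemma card_sp:
  fixes A B :: "'a::mult_group set"
  assumes A: "sg A" and B: "sg B"
  shows "card (sp A B) * card (A \<inter> B) = card A * card B"
proof -
  let ?C = "(\<lambda>g. (*) g ` B) ` A"
  have fin: "finite ?C" using sg_finite[OF A] by simp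
  have un: "sp A B = \<Union>?C" by (auto simp: sp_def)
  have cc: "card (f ` A) * card (A \<inter> B) = card A"
    if "f = (\<lambda>g. (*) g ` B)" for f
    by (rule coset_count) (use that A B in \<open>auto simp: sg_Int lcoset_eq_iff sg_mult sg_iv\<close>)
  have "card (\<Union>?C) = sum card ?C"
  proof (rule card_Union_disjoint)
    show "pairwise disjnt ?C"
    proof (clarsimp simp: pairwise_def disjnt_def, rule ccontr)
      fix g h assume ne: "(*) g ` B \<noteq> (*) h ` B" and "(*) g ` B \<inter> (*) h ` B \<noteq> {}"
      then obtain b c where "b \<in> B" "c \<in> B" "g * b = h * c" by auto
      then have "iv g * h = b * iv c" by (metis iv_cancel_left iv_right mult.assoc mult_1_right)
      then have "iv g * h \<in> B" using B \<open>b \<in> B\<close> \<open>c \<in> B\<close> by (simp add: sg_iv sg_mult)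
      then show False using ne B lcoset_eq_iff by blast
    qed
  qed (use sg_finite[OF B] in auto)
  also have "\<dots> = card ?C * card B"
    by (subst sum.cong[OF refl, where h = "\<lambda>_. card B"]) (auto simp: card_image inj_on_def)
  finally have "card (sp A B) = card ?C * card B" using un by simp
  then show ?thesis using cc[OF refl] by (metis mult.assoc mult.commute)
qed

text \<open>Outside the fixed points every orbit is nontrivial and has size dividing
  \<open>p ^ k\<close>. Sylow conjugacy, growth of normalizers in p-groups and fixed cosets under
  coprime action are all instances of this count.\<close>

lemma fixed_points_mod:
  fixes P :: "'a::mult_group set" and act :: "'a \<Rightarrow> 'e \<Rightarrow> 'e"
  assumes p: "prime p" and P: "sg P" "card P = p ^ k" and E: "finite E"
    and cl: "\<And>g e. g \<in> P \<Longrightarrow> e \<in> E \<Longrightarrow> act g e \<in> E"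
    and one: "\<And>e. e \<in> E \<Longrightarrow> act 1 e = e"
    and comp: "\<And>g h e. g \<in> P \<Longrightarrow> h \<in> P \<Longrightarrow> e \<in> E \<Longrightarrow> act (g * h) e = act g (act h e)"
  shows "p dvd card (E - {e \<in> E. \<forall>g\<in>P. act g e = e})"
proof -
  let ?N = "E - {e \<in> E. \<forall>g\<in>P. act g e = e}"
  define orb where "orb e = (\<lambda>g. act g e) ` P" for e
  have inv: "act (iv g) (act g e) = e" if "g \<in> P" "e \<in> E" for g e
    using comp[of "iv g" g e] that P one by (simp add: sg_iv)
  have self: "e \<in> orb e" if "e \<in> E" for e
    unfolding orb_def using one[OF that] sg_one[OF P(1)] by (metis image_eqI)
  have eq: "orb x = orb e" if e: "e \<in> E" and x: "x \<in> orb e" for e x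
  proof -
    obtain g where g: "g \<in> P" "x = act g e" using x by (auto simp: orb_def)
    have 1: "act h x \<in> orb e" if "h \<in> P" for h
    proof -
      have "act h x = act (h * g) e" using comp that g e by simp
      then show ?thesis using that g P by (simp add: orb_def sg_mult)
    qed
    have 2: "act h e \<in> orb x" if "h \<in> P" for h
    proof -
      have "act (h * iv g) x = act h (act (iv g) x)"
        using comp[of h "iv g" x] that g e P cl by (simp add: sg_iv)
      also have "\<dots> = act h e" using inv g e by simp
      finally show ?thesis using that g P unfolding orb_def by (metis image_eqI sg_iv sg_mult)
    qed
    show ?thesis using 1 2 unfolding orb_def by blast
  qed
  have fixo: "orb e \<subseteq> ?N" if e: "e \<in> ?N" for e
  proof
    fix x assume x: "x \<in> orb e"
    then obtain g where g: "g \<in> P" "x = act g e" by (auto simp: orb_def)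
    have "x \<in> E" using g e cl by auto
    moreover have "\<not> (\<forall>g\<in>P. act g x = x)"
    proof
      assume "\<forall>g\<in>P. act g x = x"
      then have "orb x \<subseteq> {x}" by (auto simp: orb_def)
      then have "orb e \<subseteq> {x}" using eq x e by blast
      then have "orb e \<subseteq> {e}" using self e by blast
      then have "act g e = e" if "g \<in> P" for g using that by (auto simp: orb_def)
      then show False using e by simp
    qed
    ultimately show "x \<in> ?N" by simp
  qed
  have un: "\<Union>(orb ` ?N) = ?N"
  proof
    show "\<Union>(orb ` ?N) \<subseteq> ?N" using fixo by (rule UN_least)
    show "?N \<subseteq> \<Union>(orb ` ?N)" using self by force
  qed
  have dv: "p dvd card (orb e)" if e: "e \<in> ?N" for e
  proof -
    let ?K = "{g \<in> P. act g e = e}"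
    have eE: "e \<in> E" using e by simp
    have K: "sg ?K"
    proof (rule sg_finite_closed)
      show "finite ?K" using sg_finite[OF P(1)] by simp
      show "1 \<in> ?K" using one eE sg_one[OF P(1)] by simp
      fix a b assume "a \<in> ?K" "b \<in> ?K"
      then show "a * b \<in> ?K" using comp eE P(1) by (simp add: sg_mult)
    qed
    have c: "card ((\<lambda>g. act g e) ` P) * card ?K = card P"
    proof (rule coset_count[OF P(1) K])
      fix g h assume g: "g \<in> P" and h: "h \<in> P"
      have "act (iv g * h) e = act (iv g) (act h e)" using comp g h eE P by (simp add: sg_iv)
      moreover have "act g e = act h e" if "act (iv g) (act h e) = e"
        using inv[of "iv g" "act h e"] that g h eE cl P by (simp add: sg_iv)
      ultimately have "act (iv g * h) e = e \<longleftrightarrow> act g e = act h e"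
        using inv[OF g eE] by auto
      then show "act g e = act h e \<longleftrightarrow> iv g * h \<in> ?K" using g h P by (simp add: sg_iv sg_mult)
    qed auto
    then have "card (orb e) dvd p ^ k" unfolding orb_def P(2) by (metis dvd_triv_left)
    then obtain i where i: "card (orb e) = p ^ i" using divides_primepow_nat[OF p] by blast
    have "card (orb e) \<noteq> 1"
    proof
      assume "card (orb e) = 1"
      then obtain x where "orb e = {x}" by (auto simp: card_1_singleton_iff)
      then have "orb e \<subseteq> {e}" using self[OF eE] by auto
      then show False using e by (auto simp: orb_def)
    qed
    then show ?thesis using i by (cases i) auto
  qed
  have "p dvd card (\<Union>(orb ` ?N))"
  proof (rule dvd_partition)
    show "finite (\<Union>(orb ` ?N))" unfolding un using E by simp
    show "\<forall>c\<in>orb ` ?N. p dvd card c" using dv by auto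
    show "\<forall>c1\<in>orb ` ?N. \<forall>c2\<in>orb ` ?N. c1 \<noteq> c2 \<longrightarrow> c1 \<inter> c2 = {}"
    proof (intro ballI impI, rule ccontr)
      fix c1 c2 assume c: "c1 \<in> orb ` ?N" "c2 \<in> orb ` ?N" "c1 \<noteq> c2" and "c1 \<inter> c2 \<noteq> {}"
      then obtain x where x: "x \<in> c1" "x \<in> c2" by auto
      have "orb x = c1" "orb x = c2" using c x eq by auto
      then show False using c(3) by simp
    qed
  qed
  then show ?thesis unfolding un .
qed

section \<open>Subgroups of p-groups\<close>

text \<open>A bridge to the record-based groups of \<open>HOL-Algebra\<close>, from which the
  existence of Sylow subgroups, element orders and Lagrange's theorem for factor groups are
  imported.\<close>

definition as_group :: "'a::mult_group set \<Rightarrow> 'a monoid" where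
  "as_group H = \<lparr>carrier = H, monoid.mult = (*), one = 1\<rparr>"

lemma as_group_simps [simp]: "carrier (as_group H) = H" "monoid.mult (as_group H) = (*)" "one (as_group H) = 1"
  by (simp_all add: as_group_def)

lemma group_gr: "sg H \<Longrightarrow> group (as_group H)"
  by (rule groupI) (auto simp: sg_def mult.assoc intro: iv_left)

lemma as_group_pow: "a [^]\<^bsub>as_group H\<^esub> (n::nat) = a ^ n"
  by (induction n) (simp_all add: power_commutes)

lemma subgroup_gr_iff: "sg H \<Longrightarrow> subgroup K (as_group H) \<longleftrightarrow> sg K \<and> K \<subseteq> H"
proof
  assume H: "sg H" and K: "subgroup K (as_group H)"
  have "K \<subseteq> H" using subgroup.subset[OF K] by simp
  moreover have "finite K" using calculation sg_finite[OF H] finite_subset by blast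
  then have "sg K"
    by (rule sg_finite_closed)
      (use subgroup.one_closed[OF K] subgroup.m_closed[OF K] in auto)
  ultimately show "sg K \<and> K \<subseteq> H" by simp
next
  assume H: "sg H" and K: "sg K \<and> K \<subseteq> H"
  interpret group "as_group H" by (rule group_gr[OF H])
  show "subgroup K (as_group H)"
  proof (rule subgroupI)
    fix a assume a: "a \<in> K"
    have "inv\<^bsub>as_group H\<^esub> a = iv a"
      by (rule inv_equality) (use a K H sg_iv in auto)
    then show "inv\<^bsub>as_group H\<^esub> a \<in> K" using a K sg_iv by auto
  qed (use K sg_one sg_mult in auto)
qed

lemma sg_pow_card: "sg H \<Longrightarrow> a \<in> H \<Longrightarrow> a ^ card H = 1"
  using group.pow_order_eq_1[OF group_gr, of H a] by (simp add: as_group_pow order_def)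

lemma sylow_exists:
  assumes "prime p" "sg H" "p ^ a dvd card H"
  shows "\<exists>Q. sg Q \<and> Q \<subseteq> H \<and> card Q = p ^ a"
proof -
  obtain m where "card H = p ^ a * m" using assms(3) by auto
  then have "\<exists>Q. subgroup Q (as_group H) \<and> card Q = p ^ a"
    by (intro sylow_thm[OF assms(1) group_gr[OF assms(2)]])
      (auto simp: order_def sg_finite[OF assms(2)])
  then show ?thesis using subgroup_gr_iff[OF assms(2)] by blast
qed

text \<open>Natural exponents suffice: for an element of a finite subgroup this is the cyclic
  subgroup that it generates.\<close>

definition cyc :: "'a::mult_group \<Rightarrow> 'a set" where
  "cyc a = range (\<lambda>n::nat. a ^ n)"

lemma cyc_self: "a \<in> cyc a"
  unfolding cyc_def by (metis power_one_right rangeI)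

lemma cyc_sub: "sg H \<Longrightarrow> a \<in> H \<Longrightarrow> cyc a \<subseteq> H"
  unfolding cyc_def using sg_power by auto

lemma cyc_sg: "sg H \<Longrightarrow> a \<in> H \<Longrightarrow> sg (cyc a)"
proof (rule sg_finite_closed)
  assume "sg H" "a \<in> H"
  then show "finite (cyc a)" using cyc_sub sg_finite finite_subset by metis
  show "1 \<in> cyc a" unfolding cyc_def by (metis power_0 rangeI)
  fix x y assume "x \<in> cyc a" "y \<in> cyc a"
  then show "x * y \<in> cyc a" unfolding cyc_def by (auto simp flip: power_add)
qed

lemma cyc_card:
  assumes c: "sg (cyc a)"
  shows "a ^ n = 1 \<longleftrightarrow> card (cyc a) dvd n"
proof -
  interpret group "as_group (cyc a)" by (rule group_gr[OF c])
  have fin: "finite (carrier (as_group (cyc a)))" using sg_finite[OF c] by simp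
  have a: "a \<in> carrier (as_group (cyc a))" by (simp add: cyc_self)
  have "generate (as_group (cyc a)) {a} = cyc a"
    using generate_pow_on_finite_carrier[OF fin a] by (auto simp: as_group_pow cyc_def)
  then have "ord a = card (cyc a)" using generate_pow_card[OF a] by simp
  then show ?thesis using pow_eq_id[OF a, of n] by (simp add: as_group_pow)
qed

text \<open>Bezout gives \<open>m * x = n * y + 1\<close>, so \<open>z\<close> is a quotient of two
  elements of \<open>A\<close>. This is the recurring device for separating p-parts from
  p'-parts.\<close>

lemma pow_coprime_mem:
  fixes z :: "'a::mult_group"
  assumes A: "sg A" and m: "z ^ m \<in> A" and n: "z ^ n \<in> A" and c: "coprime m n"
  shows "z \<in> A"
proof (cases "m = 0")
  case True
  then show ?thesis using c n by simp
next
  case False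
  obtain x y where "m * x = n * y + 1" using bezout_nat[OF False, of n] c by auto
  then have "(z ^ m) ^ x = (z ^ n) ^ y * z"
    by (metis power_add power_mult power_one_right)
  moreover have "(z ^ m) ^ x \<in> A" "(z ^ n) ^ y \<in> A" using m n A sg_power by auto
  ultimately show ?thesis using A sg_mult_left_iff by metis
qed

lemma pow_coprime_one:
  fixes z :: "'a::mult_group"
  assumes "z ^ m = 1" "z ^ n = 1" "coprime m n" shows "z = 1"
  using pow_coprime_mem[OF sg_triv, of z m n] assms by simp

definition psg :: "nat \<Rightarrow> 'a::mult_group set \<Rightarrow> bool" where
  "psg p Q \<longleftrightarrow> sg Q \<and> (\<exists>k. card Q = p ^ k)"

lemma psg_sg: "psg p Q \<Longrightarrow> sg Q"
  by (simp add: psg_def)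

lemma psg_triv: "psg p {1}"
  unfolding psg_def using sg_triv by (metis card.empty card_insert_disjoint empty_iff finite.emptyI power_0 One_nat_def)

lemma psg_cj: "psg p Q \<Longrightarrow> psg p (cj g ` Q)"
  by (simp add: psg_def sg_cj_image)

lemma psg_sub:
  assumes "prime p" "psg p Q" "sg A" "A \<subseteq> Q" shows "psg p A"
  using sg_dvd[OF psg_sg[OF assms(2)] assms(3,4)] assms(2,3) divides_primepow_nat[OF assms(1)]
  unfolding psg_def by auto

lemma psg_sp:
  assumes p: "prime p" and A: "psg p A" and B: "psg p B" and s: "sg (sp A B)"
  shows "psg p (sp A B)"
proof -
  obtain i j where "card A = p ^ i" "card B = p ^ j" using A B by (auto simp: psg_def)
  then have "card (sp A B) dvd p ^ (i + j)"
    using card_sp[OF psg_sg[OF A] psg_sg[OF B]] by (metis dvd_triv_left power_add)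
  then show ?thesis using s divides_primepow_nat[OF p] unfolding psg_def by auto
qed

lemma psg_pow:
  assumes "psg p Q" obtains k where "card Q = p ^ k" "\<And>x. x \<in> Q \<Longrightarrow> x ^ (p ^ k) = 1"
  using assms sg_pow_card unfolding psg_def by metis

lemma psg_less_dvd:
  assumes p: "prime p" and "psg p A" "psg p B" "card A < card B"
  shows "p * card A dvd card B"
proof -
  obtain i j where ij: "card A = p ^ i" "card B = p ^ j" using assms by (auto simp: psg_def)
  then have "i < j" using assms(4) p prime_gt_1_nat power_less_imp_less_exp by metis
  then have "p ^ Suc i dvd p ^ j" by (intro le_imp_power_dvd) simp
  then show ?thesis using ij by simp
qed

text \<open>The cosets of \<open>A\<close> in the product with \<open>cyc z\<close> are represented
  by \<open>z ^ i\<close> with \<open>i < p\<close>; they are distinct, since otherwise a power of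
  \<open>z\<close> prime to \<open>p\<close> would lie in \<open>A\<close> along with
  \<open>z ^ p\<close>.\<close>

lemma adjoin:
  fixes A :: "'a::mult_group set"
  assumes p: "prime p" and n: "nm A N" and z: "z \<in> N" "z \<notin> A" "z ^ p \<in> A"
  obtains A' where "sg A'" "nm A A'" "A' \<subseteq> N" "z \<in> A'" "card A' = p * card A"
proof -
  let ?A = "sp A (cyc z)"
  have N: "sg N" and A: "sg A" and AN: "A \<subseteq> N" using n by (auto simp: nm_def)
  have c: "sg (cyc z)" "cyc z \<subseteq> N" using cyc_sg[OF N z(1)] cyc_sub[OF N z(1)] .
  have A': "sg ?A" using sp_nm_sg[OF n c] .
  have sub: "A \<subseteq> ?A" "z \<in> ?A" "?A \<subseteq> N"
  proof -
    show "A \<subseteq> ?A" using sp_sub1[OF sg_one[OF c(1)]] .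
    show "z \<in> ?A" using sp_sub2[OF sg_one[OF A], of "cyc z"] cyc_self[of z] by blast
    show "?A \<subseteq> N" using sp_least[OF N AN c(2)] .
  qed
  have nA: "nm A ?A" using nm_subgroup[OF n A' sub(1,3)] .
  have img: "(\<lambda>g. (*) g ` A) ` ?A = (\<lambda>i. (*) (z ^ i) ` A) ` {..<p}"
  proof (intro equalityI subsetI)
    fix C assume "C \<in> (\<lambda>g. (*) g ` A) ` ?A"
    then obtain a m where am: "a \<in> A" "C = (*) (a * z ^ m) ` A" by (auto simp: cyc_def elim!: spE)
    have "z ^ m = z ^ (m mod p) * (z ^ p) ^ (m div p)"
      by (metis mod_mult_div_eq power_add power_mult)
    then have zz: "iv (z ^ (m mod p)) * z ^ m \<in> A" using z A sg_power by simp
    have "iv (z ^ (m mod p)) * (a * z ^ m)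
        = cj (iv (z ^ (m mod p))) a * (iv (z ^ (m mod p)) * z ^ m)"
      by (simp add: cj_def mult.assoc)
    also have "\<dots> \<in> A" using zz nm_cj[OF n] am z N A by (simp add: sg_mult sg_iv sg_power)
    finally have "C = (*) (z ^ (m mod p)) ` A" using am lcoset_eq_iff[OF A] by metis
    then show "C \<in> (\<lambda>i. (*) (z ^ i) ` A) ` {..<p}" using prime_gt_0_nat[OF p] by auto
  next
    fix C assume "C \<in> (\<lambda>i. (*) (z ^ i) ` A) ` {..<p}"
    then show "C \<in> (\<lambda>g. (*) g ` A) ` ?A" using sg_power[OF A' sub(2)] by auto
  qed
  have ne: "(*) (z ^ i) ` A \<noteq> (*) (z ^ j) ` A" if "i < j" "j < p" for i j
  proof
    assume "(*) (z ^ i) ` A = (*) (z ^ j) ` A"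
    then have "iv (z ^ i) * z ^ j \<in> A" using lcoset_eq_iff[OF A] by blast
    moreover have "z ^ j = z ^ i * z ^ (j - i)" using that by (simp flip: power_add)
    ultimately have "z ^ (j - i) \<in> A" by simp
    moreover have "coprime (j - i) p"
      using that p by (metis coprime_commute diff_le_self le_less_trans less_imp_diff_less nat_dvd_not_less
          prime_imp_coprime zero_less_diff)
    ultimately show False using pow_coprime_mem[OF A _ z(3)] z(2) by blast
  qed
  have "inj_on (\<lambda>i. (*) (z ^ i) ` A) {..<p}"
  proof (rule inj_onI)
    fix i j assume "i \<in> {..<p}" "j \<in> {..<p}" "(*) (z ^ i) ` A = (*) (z ^ j) ` A"
    then show "i = j" using ne[of i j] ne[of j i] by (cases i j rule: linorder_cases) auto
  qed
  then have "card ((\<lambda>g. (*) g ` A) ` ?A) = p" unfolding img by (simp add: card_image)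
  then have "card ?A = p * card A" using card_lcosets[OF A' A sub(1)] by simp
  then show ?thesis using that A' nA sub by blast
qed

lemma sg_normalizer: "sg B \<Longrightarrow> sg {b \<in> B. cj b ` A = A}"
proof (rule sg_finite_closed)
  assume B: "sg B"
  show "finite {b \<in> B. cj b ` A = A}" "1 \<in> {b \<in> B. cj b ` A = A}"
    using B by (simp_all add: sg_finite sg_one)
  fix a b assume "a \<in> {b \<in> B. cj b ` A = A}" "b \<in> {b \<in> B. cj b ` A = A}"
  then show "a * b \<in> {b \<in> B. cj b ` A = A}"
    using B by (simp add: sg_mult flip: cj_image_cj)
qed

lemma nm_normalizer:
  assumes A: "sg A" and B: "sg B" "A \<subseteq> B" shows "nm A {b \<in> B. cj b ` A = A}"
  unfolding nm_def
proof (intro conjI A sg_normalizer B)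
  show "A \<subseteq> {b \<in> B. cj b ` A = A}"
    using B nm_cj_eq[OF nm_refl[OF A]] by auto
qed auto

text \<open>Normalizers grow in p-groups: \<open>A\<close> acts by left multiplication on its cosets
  in \<open>B\<close>, whose number is divisible by \<open>p\<close>. It fixes the coset
  \<open>A\<close>, hence a second one, whose representative normalizes \<open>A\<close>; a p-power
  of it is adjoined to \<open>A\<close>.\<close>

lemma pgroup_step:
  fixes A :: "'a::mult_group set"
  assumes p: "prime p" and B: "psg p B" and A: "sg A" "A \<subset> B"
  obtains A' where "sg A'" "nm A A'" "A \<subset> A'" "A' \<subseteq> B" "card A' = p * card A"
proof -
  let ?E = "(\<lambda>g. (*) g ` A) ` B"
  let ?act = "\<lambda>g C. (*) g ` C"
  let ?F = "{C \<in> ?E. \<forall>g\<in>A. ?act g C = C}"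
  have sB: "sg B" using B psg_sg by blast
  have AB: "A \<subseteq> B" using A by blast
  obtain k where k: "card A = p ^ k" using psg_sub[OF p B A(1) AB] by (auto simp: psg_def)
  have fE: "finite ?E" using sg_finite[OF sB] by simp
  have "card ?E * card A = card B" using card_lcosets[OF sB A(1) AB] .
  moreover have "card A < card B" using A sg_finite[OF sB] by (simp add: psubset_card_mono)
  then have "p * card A dvd card B" using psg_less_dvd[OF p psg_sub[OF p B A(1) AB] B] by simp
  ultimately have pE: "p dvd card ?E"
    using sg_card_pos[OF A(1)] by (metis dvd_times_right_cancel_iff less_numeral_extra(3))
  have "p dvd card (?E - ?F)"
  proof (rule fixed_points_mod[OF p A(1) k fE])
    fix g e assume "g \<in> A" "e \<in> ?E"
    then show "?act g e \<in> ?E" using AB sg_mult[OF sB]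
      by (auto simp: image_image simp flip: mult.assoc)
  qed (auto simp: image_image mult.assoc)
  then have pF: "p dvd card ?F" using pE fE
    by (metis (no_types, lifting) card_Diff_subset card_mono dvd_diffD1 finite_subset mem_Collect_eq subsetI)
  have AF: "A \<in> ?F"
  proof -
    have "?act g A = A" if "g \<in> A" for g
      using lcoset_eq_iff[OF A(1), of g 1] that A(1) by (simp add: sg_iv)
    moreover have "A \<in> ?E" using sg_one[OF sB] by (intro image_eqI[of _ _ 1]) auto
    ultimately show ?thesis by simp
  qed
  have "\<not> ?F \<subseteq> {A}"
  proof
    assume "?F \<subseteq> {A}"
    then have "?F = {A}" using AF by blast
    then have "card ?F = 1" by simp
    then show False using pF p not_prime_unit by metis
  qed
  then obtain b where b: "b \<in> B" "(*) b ` A \<noteq> A" "\<forall>g\<in>A. ?act g ((*) b ` A) = (*) b ` A" by auto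
  let ?N = "{b \<in> B. cj b ` A = A}"
  have nA: "b \<notin> A" using b(2) lcoset_eq_iff[OF A(1), of b 1] A(1) by (auto simp: sg_iv)
  have "cj (iv b) ` A \<subseteq> A"
  proof
    fix x assume "x \<in> cj (iv b) ` A"
    then obtain g where g: "g \<in> A" "x = iv b * (g * b)" by (auto simp: cj_def mult.assoc)
    have "(*) b ` A = (*) (g * b) ` A" using b(3) g by (simp add: image_image mult.assoc)
    then show "x \<in> A" using lcoset_eq_iff[OF A(1)] g by blast
  qed
  then have "cj (iv b) ` A = A" using cj_subset_eq sg_finite A by blast
  then have bN: "b \<in> ?N" using b(1) cj_image_iv(2)[of b A] by simp
  have nN: "nm A ?N" using nm_normalizer[OF A(1) sB AB] .
  obtain k' where "b ^ (p ^ k') = 1" using B b(1) by (metis psg_pow)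
  then have ex: "\<exists>i. b ^ (p ^ i) \<in> A" using sg_one[OF A(1)] by metis
  \<comment> \<open>The least such \<open>i\<close> is positive, so the preceding power of
    \<open>b\<close> lies outside \<open>A\<close> while its p-th power lies inside.\<close>
  define i where "i = (LEAST i. b ^ (p ^ i) \<in> A)"
  have i: "b ^ (p ^ i) \<in> A" unfolding i_def using ex by (rule LeastI_ex)
  have "i \<noteq> 0" using i nA by (cases i) auto
  then obtain j where j: "i = Suc j" by (cases i) auto
  have z1: "b ^ (p ^ j) \<notin> A" using j not_less_Least[of j "\<lambda>i. b ^ (p ^ i) \<in> A"] i_def by simp
  have z2: "(b ^ (p ^ j)) ^ p \<in> A" using i j by (simp add: mult.commute flip: power_mult)
  have z3: "b ^ (p ^ j) \<in> ?N" using sg_power[OF nm_sg2[OF nN] bN] .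
  obtain A' where "sg A'" "nm A A'" "A' \<subseteq> ?N" "b ^ (p ^ j) \<in> A'" "card A' = p * card A"
    using adjoin[OF p nN z3 z1 z2] by metis
  then show ?thesis using that[of A'] z1 nm_sub by blast
qed

lemma pgroup_between:
  fixes A :: "'a::mult_group set"
  assumes p: "prime p" and B: "psg p B" and A: "sg A" "A \<subseteq> B"
    and k: "card A \<le> p ^ k" "p ^ k \<le> card B"
  obtains C where "sg C" "A \<subseteq> C" "C \<subseteq> B" "card C = p ^ k"
proof -
  have "\<exists>C. sg C \<and> A \<subseteq> C \<and> C \<subseteq> B \<and> card C = p ^ k"
    using A k(1)
  proof (induction "p ^ k - card A" arbitrary: A rule: less_induct)
    case less
    show ?case
    proof (cases "card A = p ^ k")
      case True
      then show ?thesis using less.prems by blast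
    next
      case False
      then have lt: "card A < p ^ k" using less.prems by simp
      then have "A \<subset> B" using less.prems k(2) by auto
      then obtain A' where A': "sg A'" "A \<subset> A'" "A' \<subseteq> B" "card A' = p * card A"
        using pgroup_step[OF p B less.prems(1)] by metis
      obtain i where i: "card A = p ^ i"
        using psg_sub[OF p B less.prems(1,2)] by (auto simp: psg_def)
      have "i < k" using lt i p prime_gt_1_nat power_less_imp_less_exp by metis
      then have "p ^ Suc i \<le> p ^ k" using prime_gt_1_nat[OF p] by (intro power_increasing) auto
      then have le: "card A' \<le> p ^ k" using A' i by simp
      have "card A < card A'" using psubset_card_mono[OF sg_finite[OF A'(1)] A'(2)] .
      then have "p ^ k - card A' < p ^ k - card A" using lt by simp
      then show ?thesis using less.hyps[OF _ A'(1,3) le] A'(2) by blast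
    qed
  qed
  then show ?thesis using that by blast
qed

lemma pgroup_index_p_normal:
  assumes p: "prime p" and B: "psg p B" and W: "sg W" "W \<subseteq> B" "card B = p * card W"
  shows "nm W (B :: 'a::mult_group set)"
proof -
  have "W \<noteq> B" using W(3) sg_card_pos[OF W(1)] prime_gt_1_nat[OF p] by auto
  then obtain A' where A': "sg A'" "nm W A'" "A' \<subseteq> B" "card A' = p * card W"
    using pgroup_step[OF p B W(1)] W by (metis psubsetI)
  then have "A' = B" using W sg_finite[OF psg_sg[OF B]] by (metis card_subset_eq)
  then show ?thesis using A' by simp
qed

lemma pgroup_maximal:
  fixes A :: "'a::mult_group set"
  assumes p: "prime p" and B: "psg p B" and A: "sg A" "A \<subset> B"
  obtains W where "nm W B" "A \<subseteq> W" "card B = p * card W"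
proof -
  obtain k where k: "card B = p ^ k" using B by (auto simp: psg_def)
  have lt: "card A < card B" using A sg_finite[OF psg_sg[OF B]] by (simp add: psubset_card_mono)
  then have "k \<noteq> 0" using k sg_card_pos[OF A(1)] by (cases k) auto
  then obtain j where j: "k = Suc j" by (cases k) auto
  have "p * card A dvd p * p ^ j"
    using psg_less_dvd[OF p psg_sub[OF p B A(1)] B lt] A(2) k j by auto
  then have "card A dvd p ^ j" using prime_gt_0_nat[OF p] by simp
  then have "card A \<le> p ^ j" using prime_gt_0_nat[OF p] by (simp add: dvd_imp_le)
  moreover have "p ^ j \<le> card B" using k j prime_gt_0_nat[OF p] by simp
  ultimately obtain W where W: "sg W" "A \<subseteq> W" "W \<subseteq> B" "card W = p ^ j"
    using pgroup_between[OF p B A(1)] A(2) by (metis psubsetE)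
  have c: "card B = p * card W" using W k j by simp
  then show ?thesis using that pgroup_index_p_normal[OF p B W(1,3) c] W by blast
qed

section \<open>Normal sections and the residual\<close>

context mult_group
begin

text \<open>Equality of the left cosets of \<open>a\<close> and \<open>b\<close>; computations in
  factor groups are carried out as congruences between representatives.\<close>

definition cg :: "'a set \<Rightarrow> 'a \<Rightarrow> 'a \<Rightarrow> bool" where
  "cg N a b \<longleftrightarrow> iv a * b \<in> N"

lemma cg_refl: "sg N \<Longrightarrow> cg N a a"
  by (simp add: cg_def sg_one)

lemma cg_sym: "sg N \<Longrightarrow> cg N a b \<Longrightarrow> cg N b a"
  unfolding cg_def by (drule (1) sg_iv) simp

lemma cg_trans: "sg N \<Longrightarrow> cg N a b \<Longrightarrow> cg N b c \<Longrightarrow> cg N a c"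
  unfolding cg_def by (drule (2) sg_mult) (simp add: mult.assoc)

lemma cg_mem: "sg N \<Longrightarrow> cg N a b \<Longrightarrow> a \<in> N \<longleftrightarrow> b \<in> N"
  unfolding cg_def by (metis iv_cancel_right sg_mult_left_iff sg_mult_right_iff)

lemma cg_mult:
  assumes N: "nm N H" and H: "a \<in> H" "b \<in> H" "c \<in> H" "d \<in> H" and "cg N a b" "cg N c d"
  shows "cg N (a * c) (b * d)"
proof -
  have "iv (a * c) * (b * d) = cj (iv c) (iv a * b) * (iv c * d)"
    by (simp add: cj_def mult.assoc)
  also have "\<dots> \<in> N" using assms nm_cj[OF N] nm_sg1[OF N] nm_sg2[OF N]
    by (simp add: cg_def sg_mult sg_iv)
  finally show ?thesis by (simp add: cg_def)
qed

lemma cg_power: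
  assumes N: "nm N H" and H: "a \<in> H" "b \<in> H" and "cg N a b"
  shows "cg N (a ^ n) (b ^ n)"
proof (induction n)
  case 0
  then show ?case using nm_sg1[OF N] by (simp add: cg_refl)
next
  case (Suc n)
  then show ?case using cg_mult[OF N] assms sg_power[OF nm_sg2[OF N]] by simp
qed

lemma cg_cj:
  assumes N: "nm N H" and H: "h \<in> H" and "cg N a b"
  shows "cg N (cj h a) (cj h b)"
  using nm_cj[OF N H, of "iv a * b"] assms(3) by (simp add: cg_def cj_mult cj_iv)

text \<open>The centralizer in the whole type, possibly infinite; its intersection with a subgroup
  is a subgroup (\<open>sg_cen\<close>).\<close>

definition cen :: "'a set \<Rightarrow> 'a set" where "cen Q = {g. \<forall>x\<in>Q. cj g x = x}"

lemma cenI: "(\<And>x. x \<in> Q \<Longrightarrow> cj g x = x) \<Longrightarrow> g \<in> cen Q"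
  by (simp add: cen_def)

lemma cenD: "g \<in> cen Q \<Longrightarrow> x \<in> Q \<Longrightarrow> cj g x = x"
  by (simp add: cen_def)

lemma cen_comm: "g \<in> cen Q \<Longrightarrow> x \<in> Q \<Longrightarrow> g * x = x * g"
  by (simp add: cen_def cj_eq_iff)

lemma sg_cen: "sg H \<Longrightarrow> sg (H \<inter> cen Q)"
proof (rule sg_finite_closed)
  assume H: "sg H"
  show "finite (H \<inter> cen Q)" "1 \<in> H \<inter> cen Q" using H by (auto simp: sg_finite sg_one cen_def)
  fix a b assume "a \<in> H \<inter> cen Q" "b \<in> H \<inter> cen Q"
  then show "a * b \<in> H \<inter> cen Q" using H by (simp add: cen_def sg_mult flip: cj_cj)
qed

lemma cen_iv: "a \<in> cen Q \<Longrightarrow> iv a \<in> cen Q"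
  unfolding cen_def by (auto, metis cj_iv_cj(1))

lemma cen_mult: "a \<in> cen Q \<Longrightarrow> b \<in> cen Q \<Longrightarrow> a * b \<in> cen Q"
  by (simp add: cen_def flip: cj_cj)

lemma cen_anti: "Q \<subseteq> Q' \<Longrightarrow> cen Q' \<subseteq> cen Q"
  by (auto simp: cen_def)

lemma cen_cj:
  assumes "cj h ` Q = Q" "a \<in> cen Q" shows "cj h a \<in> cen Q"
proof (rule cenI)
  fix x assume "x \<in> Q"
  then obtain y where y: "y \<in> Q" "x = cj h y" using assms(1) by auto
  have "cj (cj h a) (cj h y) = cj h (cj a y)" by (simp add: cj_def mult.assoc)
  then show "cj (cj h a) x = x" using y cenD[OF assms(2)] by simp
qed

lemma nm_cen: "nm Q H \<Longrightarrow> nm K H \<Longrightarrow> nm (K \<inter> cen Q) H"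
  unfolding nm_def[of "K \<inter> cen Q"]
proof (intro conjI ballI)
  assume Q: "nm Q H" and K: "nm K H"
  show "sg (K \<inter> cen Q)" "sg H" using nm_sg1[OF K] nm_sg2[OF K] sg_cen by auto
  show "K \<inter> cen Q \<subseteq> H" using nm_sub[OF K] by auto
  fix h n assume "h \<in> H" "n \<in> K \<inter> cen Q"
  then show "cj h n \<in> K \<inter> cen Q" using nm_cj[OF K] cen_cj nm_cj_eq[OF Q] by auto
qed

definition chief :: "'a set \<Rightarrow> 'a set \<Rightarrow> 'a set \<Rightarrow> bool" where
  "chief H U V \<longleftrightarrow> nm U H \<and> nm V H \<and> V \<subset> U \<and>
    (\<forall>N. nm N H \<and> V \<subseteq> N \<and> N \<subseteq> U \<longrightarrow> N = V \<or> N = U)"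

lemma chiefD:
  assumes "chief H U V"
  shows chief_nm1: "nm U H" and chief_nm2: "nm V H" and chief_sub: "V \<subseteq> U" and chief_ne: "V \<noteq> U"
    and chief_between: "nm N H \<Longrightarrow> V \<subseteq> N \<Longrightarrow> N \<subseteq> U \<Longrightarrow> N = V \<or> N = U"
  using assms by (auto simp: chief_def)

lemma chief_top:
  assumes c: "chief H U V" and N: "nm N H" "V \<subseteq> N" "N \<subseteq> U" "x \<in> N" "x \<notin> V"
  shows "N = U"
  using chief_between[OF c N(1-3)] N(4,5) by auto

lemma nm_maximal:
  assumes H: "finite H" and P: "P N" "\<And>N. P N \<Longrightarrow> N \<subseteq> H"
  obtains M where "P M" "N \<subseteq> M" "\<And>K. P K \<Longrightarrow> M \<subseteq> K \<Longrightarrow> K = M"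
proof -
  have "finite (Collect P)" by (rule finite_subset[of _ "Pow H"]) (use P H in auto)
  then obtain M where "M \<in> Collect P" "N \<subseteq> M" "\<forall>b\<in>Collect P. M \<subseteq> b \<longrightarrow> M = b"
    using finite_has_maximal2[of "Collect P" N] P(1) by auto
  then show ?thesis by (intro that) (auto dest: spec)
qed

lemma chief_above:
  assumes V: "nm V H" and W: "nm W H" and VW: "V \<subset> W"
  obtains U where "chief H U V" "U \<subseteq> W"
proof -
  let ?A = "{N. nm N H \<and> V \<subset> N}"
  have "finite ?A" by (rule finite_subset[of _ "Pow H"])
      (auto dest: nm_sub simp: sg_finite[OF nm_sg2[OF V]])
  then obtain U where U: "U \<in> ?A" "U \<subseteq> W" "\<forall>b\<in>?A. b \<subseteq> U \<longrightarrow> U = b"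
    using finite_has_minimal2[of ?A W] W VW by auto
  then have "chief H U V" using V by (auto simp: chief_def)
  then show ?thesis using that U by blast
qed

text \<open>The residual of the class of abelian groups of exponent dividing \<open>p - 1\<close>, to which the
  automorphism group of a group of order \<open>p\<close> belongs.\<close>

definition residual :: "nat \<Rightarrow> 'a set \<Rightarrow> 'a set" where
  "residual p H = \<Inter>{N. nm N H \<and> (\<forall>a\<in>H. \<forall>b\<in>H. a * b * iv a * iv b \<in> N) \<and> (\<forall>a\<in>H. a ^ (p - 1) \<in> N)}"

lemma residual_least:
  assumes "nm N H" "\<And>a b. a \<in> H \<Longrightarrow> b \<in> H \<Longrightarrow> a * b * iv a * iv b \<in> N"
    "\<And>a. a \<in> H \<Longrightarrow> a ^ (p - 1) \<in> N"
  shows "residual p H \<subseteq> N"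
  unfolding residual_def using assms by (intro Inter_lower) auto

lemma residual_sub: "sg H \<Longrightarrow> residual p H \<subseteq> H"
  by (rule residual_least) (auto simp: nm_refl sg_mult sg_iv sg_power)

lemma residual_comm: "a \<in> H \<Longrightarrow> b \<in> H \<Longrightarrow> a * b * iv a * iv b \<in> residual p H"
  by (auto simp: residual_def)

lemma residual_pow: "a \<in> H \<Longrightarrow> a ^ (p - 1) \<in> residual p H"
  by (auto simp: residual_def)

lemma residual_nm: assumes H: "sg H" shows "nm (residual p H) H"
  unfolding nm_def
proof (intro conjI ballI H residual_sub)
  have "1 \<in> residual p H" "finite (residual p H)" using residual_comm[OF sg_one sg_one, OF H H] residual_sub[OF H] sg_finite[OF H]
    by (auto intro: finite_subset)
  moreover have "a * b \<in> residual p H" if "a \<in> residual p H" "b \<in> residual p H" for a b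
    using that by (auto simp: residual_def nm_def sg_mult)
  ultimately show "sg (residual p H)" using sg_finite_closed by metis
  fix h n assume "h \<in> H" "n \<in> residual p H"
  then show "cj h n \<in> residual p H" by (auto simp: residual_def nm_def)
qed

lemma residual_mono: assumes H: "sg H" "sg K" "K \<subseteq> H" shows "residual p K \<subseteq> residual p H"
proof -
  have "residual p K \<subseteq> residual p H \<inter> K"
    by (rule residual_least[OF nm_Int_subgroup[OF residual_nm[OF H(1)] H(2,3)]])
      (use H residual_comm[of _ H] residual_pow[of _ H] in \<open>auto simp: sg_mult sg_iv sg_power subset_iff\<close>)
  then show ?thesis by blast
qed

lemma cg_sp:
  assumes "nm N H" "c \<in> H" "d \<in> B" "B \<subseteq> H" "cg N c d" shows "c \<in> sp N B"
proof -
  have "c * iv d = cj c (iv (iv c * d))" by (simp add: cj_def mult.assoc)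
  also have "\<dots> \<in> N" using assms nm_cj nm_sg1 by (metis cg_def sg_iv)
  finally show ?thesis using spI[of "c * iv d" N d B] assms by (simp add: mult.assoc)
qed

lemma sp_cg:
  assumes "nm N H" "B \<subseteq> H" "c \<in> sp N B" obtains d where "d \<in> B" "cg N c d"
proof -
  obtain n d where nd: "n \<in> N" "d \<in> B" "c = n * d" using assms(3) by (auto elim: spE)
  have "iv c * d = cj (iv d) (iv n)" by (simp add: nd cj_def mult.assoc)
  also have "\<dots> \<in> N" using assms nd nm_cj nm_sg1 nm_sg2 by (metis subsetD sg_iv)
  finally show ?thesis using that nd by (simp add: cg_def)
qed

text \<open>Modulo \<open>N\<close> every element of \<open>H\<close> is congruent to one of
  \<open>B\<close>, so commutators and (p-1)-th powers in \<open>H\<close> are congruent to such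
  elements of \<open>B\<close>, and \<open>sp N (residual p B)\<close> is normal in
  \<open>H\<close>.\<close>

lemma residual_sp:
  assumes N: "nm N H" and B: "sg B" "B \<subseteq> H" and eq: "H \<subseteq> sp N B"
  shows "residual p H \<subseteq> sp N (residual p B)"
proof (rule residual_least)
  have H: "sg H" using N nm_sg2 by auto
  have R: "nm (residual p B) B" "residual p B \<subseteq> B" using residual_nm[OF B(1)] residual_sub[OF B(1)] .
  have RH: "residual p B \<subseteq> H" using R B by auto
  have ivH: "iv a \<in> H" if "a \<in> H" for a using that H sg_iv by auto
  have mH: "a * b \<in> H" if "a \<in> H" "b \<in> H" for a b using that H sg_mult by auto
  have civ: "cg N (iv a) (iv b)" if "a \<in> H" "b \<in> H" "cg N a b" for a b
  proof -
    have "iv (iv a) * iv b = cj b (iv b * a)" by (simp add: cj_def mult.assoc)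
    then show ?thesis using that nm_cj[OF N] cg_sym[OF nm_sg1[OF N]] by (simp add: cg_def)
  qed
  show "nm (sp N (residual p B)) H"
    unfolding nm_def
  proof (intro conjI ballI H)
    show "sg (sp N (residual p B))" using sp_nm_sg[OF N nm_sg1[OF R(1)] RH] .
    show "sp N (residual p B) \<subseteq> H" using sp_least[OF H nm_sub[OF N] RH] .
    fix h n assume h: "h \<in> H" and n: "n \<in> sp N (residual p B)"
    obtain x where x: "x \<in> B" "cg N h x" using sp_cg[OF N B(2)] h eq by blast
    obtain r where r: "r \<in> residual p B" "cg N n r" using sp_cg[OF N RH n] by blast
    have nH: "n \<in> H" using n sp_least[OF H nm_sub[OF N] RH] by auto
    have xH: "x \<in> H" "r \<in> H" using x r B RH by auto
    have "cg N (cj h n) (cj x r)"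
      unfolding cj_def using x r xH nH h N by (intro cg_mult[OF N] civ mH ivH) auto
    moreover have "cj x r \<in> residual p B" using nm_cj[OF R(1)] x r by auto
    ultimately show "cj h n \<in> sp N (residual p B)"
      using cg_sp[OF N _ _ RH] sg_cj[OF H h nH] by blast
  qed
  fix a assume a: "a \<in> H"
  obtain x where x: "x \<in> B" "cg N a x" using sp_cg[OF N B(2)] a eq by blast
  have xH: "x \<in> H" using x B by auto
  show "a ^ (p - 1) \<in> sp N (residual p B)"
    using cg_sp[OF N _ residual_pow[OF x(1)] RH cg_power[OF N a xH x(2)]] sg_power[OF H a] by blast
  fix b assume b: "b \<in> H"
  obtain y where y: "y \<in> B" "cg N b y" using sp_cg[OF N B(2)] b eq by blast
  have yH: "y \<in> H" using y B by auto
  have c: "cg N (a * b * iv a * iv b) (x * y * iv x * iv y)"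
    using a b x y xH yH by (intro cg_mult[OF N] civ mH ivH)
  have "a * b * iv a * iv b \<in> H" using a b by (intro mH ivH)
  then show "a * b * iv a * iv b \<in> sp N (residual p B)"
    by (rule cg_sp[OF N _ residual_comm[OF x(1) y(1)] RH c])
qed

text \<open>For \<open>g\<close> normalizing \<open>Q\<close>: the automorphism that
  \<open>g\<close> induces on \<open>Q\<close> has p-power order.\<close>

definition acts_as_p :: "nat \<Rightarrow> 'a set \<Rightarrow> 'a \<Rightarrow> bool" where
  "acts_as_p p Q g \<longleftrightarrow> (\<exists>k. g ^ (p ^ k) \<in> cen Q)"

text \<open>For \<open>Q\<close> normal in \<open>H\<close>: the residual of \<open>H\<close>
  induces a p-group of automorphisms on \<open>Q\<close>, expressed element by element.\<close>

definition res_acts_as_p :: "nat \<Rightarrow> 'a set \<Rightarrow> 'a set \<Rightarrow> bool" where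
  "res_acts_as_p p H Q \<longleftrightarrow> (\<forall>r\<in>residual p H. acts_as_p p Q r)"

lemma res_acts_as_p_mono: "res_acts_as_p p H Q \<Longrightarrow> sg H \<Longrightarrow> sg K \<Longrightarrow> K \<subseteq> H \<Longrightarrow> Q' \<subseteq> Q \<Longrightarrow> res_acts_as_p p K Q'"
  unfolding res_acts_as_p_def acts_as_p_def using residual_mono[of H K p] cen_anti[of Q' Q] by (meson subsetD)

lemma cj_power_fixed:
  assumes "cj x u = u * z" "cj x z = z" shows "cj (x ^ n) u = u * z ^ n"
proof (induction n)
  case (Suc n)
  have "cj (x ^ Suc n) u = cj x (cj (x ^ n) u)" by (simp add: cj_cj)
  also have "\<dots> = u * z * z ^ n" using Suc assms by (simp add: cj_mult cj_power)
  finally show ?case by (simp add: mult.assoc)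
qed simp

end

section \<open>Stability of series, coprime action and fixed cosets\<close>

text \<open>An element trivial on \<open>V\<close> and modulo \<open>V\<close> sends
  \<open>u\<close> to \<open>u * z\<close> with \<open>z\<close> fixed, so its \<open>n\<close>-th
  power sends \<open>u\<close> to \<open>u * z ^ n\<close>. Hence \<open>z ^ n = 1\<close>, and
  \<open>z ^ card V = 1\<close> with a coprime exponent.\<close>

lemma triv_ext:
  fixes U V :: "'a::mult_group set"
  assumes V: "sg V" and x: "x ^ n = 1" "coprime n (card V)"
    and UV: "\<And>u. u \<in> U \<Longrightarrow> cg V u (cj x u)" and fV: "x \<in> cen V"
  shows "x \<in> cen U"
proof (rule cenI)
  fix u assume u: "u \<in> U"
  define z where "z = iv u * cj x u"
  have z: "z \<in> V" "cj x u = u * z" using UV[OF u] by (simp_all add: z_def cg_def)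
  have "u = u * z ^ n" using cj_power_fixed[OF z(2) cenD[OF fV z(1)], of n] x by simp
  then have "z ^ n = 1" by (metis iv_cancel_left iv_left)
  then have "z = 1" using pow_coprime_one[OF _ sg_pow_card[OF V z(1)] x(2)] by blast
  then show "cj x u = u" using z by simp
qed

text \<open>The same computation without coprimality: the displacement satisfies
  \<open>z ^ card V = 1\<close>, and \<open>card V\<close> is a power of \<open>p\<close>.\<close>

lemma acts_as_p_ext:
  fixes U V :: "'a::mult_group set"
  assumes V: "psg p V" and UV: "\<And>u. u \<in> U \<Longrightarrow> cg V u (cj x u)" and fV: "x \<in> cen V"
  shows "x ^ card V \<in> cen U"
proof (rule cenI)
  fix u assume u: "u \<in> U"
  define z where "z = iv u * cj x u"
  have z: "z \<in> V" "cj x u = u * z" using UV[OF u] by (simp_all add: z_def cg_def)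
  then show "cj (x ^ card V) u = u"
    using cj_power_fixed[OF z(2) cenD[OF fV z(1)], of "card V"] sg_pow_card[OF psg_sg[OF V] z(1)] by simp
qed

text \<open>Lagrange's theorem in the factor group; mostly combined with
  \<open>pow_coprime_mem\<close> when the index is prime to \<open>p\<close>.\<close>

lemma nm_index_pow:
  fixes N H :: "'a::mult_group set"
  assumes N: "nm N H" and h: "h \<in> H" shows "h ^ (card H div card N) \<in> N"
proof -
  have H: "sg H" using nm_sg2[OF N] .
  interpret group "as_group H" by (rule group_gr[OF H])
  have sub: "subgroup N (as_group H)" using subgroup_gr_iff[OF H] nm_sg1[OF N] nm_sub[OF N] by simp
  have "N \<lhd> as_group H"
  proof (rule normal_invI[OF sub])
    fix x n assume x: "x \<in> carrier (as_group H)" and n: "n \<in> N"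
    have "inv\<^bsub>as_group H\<^esub> x = iv x" by (rule inv_equality) (use x H sg_iv in auto)
    then show "x \<otimes>\<^bsub>as_group H\<^esub> n \<otimes>\<^bsub>as_group H\<^esub> inv\<^bsub>as_group H\<^esub> x \<in> N"
      using nm_cj[OF N, of x n] x n by (simp add: cj_def)
  qed
  then interpret nn: normal N "as_group H" .
  interpret q: group "as_group H Mod N" by (rule nn.factorgroup_is_group)
  have "card (rcosets\<^bsub>as_group H\<^esub> N) * card N = card H" using lagrange[OF sub] by (simp add: order_def)
  then have o: "order (as_group H Mod N) = card H div card N"
    using sg_card_pos[OF nm_sg1[OF N]] by (metis FactGroup_def nonzero_mult_div_cancel_right order_def partial_object.select_convs(1) less_numeral_extra(3))
  have "N #>\<^bsub>as_group H\<^esub> h \<in> carrier (as_group H Mod N)" using h by (simp add: carrier_FactGroup)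
  then have "N #>\<^bsub>as_group H\<^esub> (h [^]\<^bsub>as_group H\<^esub> (card H div card N)) = N"
    using q.pow_order_eq_1[of "N #>\<^bsub>as_group H\<^esub> h"] nn.FactGroup_pow[of h "card H div card N"] h o by simp
  then show ?thesis
    using coset_join1[OF _ _ sub] h sg_power[OF H h] by (simp add: as_group_pow)
qed

text \<open>The coset of \<open>u\<close> is invariant under \<open>Y\<close> and has p-power size,
  prime to \<open>q\<close>, so the q-group \<open>Y\<close> fixes a point in it. Fixed points of a
  coprime action thus lift from a factor group.\<close>

lemma coset_fixed_point:
  fixes Y V :: "'a::mult_group set"
  assumes p: "prime p" and q: "prime q" "q \<noteq> p"
    and Y: "psg q Y" and V: "psg p V"
    and nV: "\<And>y v. y \<in> Y \<Longrightarrow> v \<in> V \<Longrightarrow> cj y v \<in> V"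
    and u: "\<And>y. y \<in> Y \<Longrightarrow> cg V u (cj y u)"
  obtains v where "v \<in> V" "\<And>y. y \<in> Y \<Longrightarrow> cj y (u * v) = u * v"
proof -
  have sV: "sg V" using psg_sg[OF V] .
  obtain k where k: "card V = p ^ k" using V by (auto simp: psg_def)
  obtain j where j: "card Y = q ^ j" using Y by (auto simp: psg_def)
  let ?E = "(*) u ` V"
  let ?F = "{e \<in> ?E. \<forall>g\<in>Y. cj g e = e}"
  have cE: "card ?E = p ^ k" using k by (simp add: card_image inj_on_def)
  have "q dvd card (?E - ?F)"
  proof (rule fixed_points_mod[OF q(1) psg_sg[OF Y] j])
    show "finite ?E" using sg_finite[OF sV] by simp
    fix g e assume g: "g \<in> Y" and "e \<in> ?E"
    then obtain v where v: "v \<in> V" "e = u * v" by auto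
    have "cj g e = u * ((iv u * cj g u) * cj g v)" by (simp add: v cj_mult mult.assoc)
    moreover have "(iv u * cj g u) * cj g v \<in> V" using u[OF g] nV[OF g v(1)] sV
      by (simp add: cg_def sg_mult)
    ultimately show "cj g e \<in> ?E" by blast
  qed (simp_all add: cj_cj)
  moreover have "\<not> q dvd p ^ k" using q p by (metis prime_dvd_power primes_dvd_imp_eq)
  ultimately have "?F \<noteq> {}" using cE by (metis (no_types, lifting) Diff_empty)
  then obtain v where "v \<in> V" "\<forall>g\<in>Y. cj g (u * v) = u * v" by auto
  then show ?thesis using that by blast
qed

text \<open>\<open>S\<close> permutes the cosets of \<open>V\<close> in \<open>U\<close>; their
  number is divisible by \<open>p\<close> and \<open>V\<close> itself is fixed, so a further coset
  is fixed.\<close>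

lemma pgroup_central:
  fixes S :: "'a::mult_group set"
  assumes p: "prime p" and S: "psg p S" and U: "nm U S" and V: "nm V S" and VU: "V \<subset> U"
  obtains u where "u \<in> U" "u \<notin> V" "\<And>s. s \<in> S \<Longrightarrow> cg V u (cj s u)"
proof -
  have sS: "sg S" "sg U" "sg V" using psg_sg[OF S] nm_sg1[OF U] nm_sg1[OF V] .
  obtain j where j: "card S = p ^ j" using S by (auto simp: psg_def)
  have pU: "psg p U" "psg p V" using psg_sub[OF p S] sS nm_sub[OF U] nm_sub[OF V] by auto
  let ?E = "(\<lambda>g. (*) g ` V) ` U"
  let ?act = "\<lambda>g C. cj g ` C"
  let ?F = "{e \<in> ?E. \<forall>g\<in>S. ?act g e = e}"
  have act: "cj g ` ((*) u ` V) = (*) (cj g u) ` V" if g: "g \<in> S" for g u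
  proof -
    have "cj g ` ((*) u ` V) = (*) (cj g u) ` (cj g ` V)" by (simp add: image_image cj_mult)
    then show ?thesis using nm_cj_eq[OF V g] by simp
  qed
  have dvd: "p dvd card (?E - ?F)"
  proof (rule fixed_points_mod[OF p sS(1) j])
    show "finite ?E" using sg_finite[OF sS(2)] by simp
    fix g e assume g: "g \<in> S" and "e \<in> ?E"
    then show "?act g e \<in> ?E" using act nm_cj[OF U g] by auto
  qed (simp_all add: cj_image_cj)
  have "card ?E * card V = card U" using card_lcosets[OF sS(2,3)] VU by auto
  moreover have "card V < card U" using VU sg_finite[OF sS(2)] by (simp add: psubset_card_mono)
  then have "p * card V dvd card U" using psg_less_dvd[OF p pU(2,1)] by simp
  ultimately have pE: "p dvd card ?E"
    using sg_card_pos[OF sS(3)] by (metis dvd_times_right_cancel_iff less_numeral_extra(3))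
  have fE: "finite ?E" using sg_finite[OF sS(2)] by simp
  have pF: "p dvd card ?F" using pE fE dvd
    by (metis (no_types, lifting) card_Diff_subset card_mono dvd_diffD1 finite_subset mem_Collect_eq subsetI)
  have VF: "V \<in> ?F"
  proof -
    have "V \<in> ?E" using sg_one[OF sS(2)] by (intro image_eqI[of _ _ 1]) auto
    then show ?thesis using nm_cj_eq[OF V] by simp
  qed
  have "\<not> ?F \<subseteq> {V}"
  proof
    assume "?F \<subseteq> {V}"
    then have "?F = {V}" using VF by blast
    then have "card ?F = 1" by simp
    then show False using pF p not_prime_unit by metis
  qed
  then obtain u where u: "u \<in> U" "(*) u ` V \<noteq> V" "\<forall>g\<in>S. ?act g ((*) u ` V) = (*) u ` V" by auto
  have 1: "u \<notin> V" using u(2) lcoset_eq_iff[OF sS(3), of u 1] sS(3) by (auto simp: sg_iv)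
  have 2: "cg V u (cj s u)" if s: "s \<in> S" for s
  proof -
    have "(*) u ` V = (*) (cj s u) ` V" using u(3) act[OF s, of u] s by simp
    then show ?thesis using lcoset_eq_iff[OF sS(3)] by (simp add: cg_def)
  qed
  show ?thesis using that[OF u(1) 1] 2 by blast
qed

section \<open>Chief factors inside normal p-subgroups\<close>

lemma last_power:
  fixes z :: "'a::mult_group"
  assumes "z \<notin> V" "z ^ (p ^ k) \<in> V"
  obtains j where "z ^ (p ^ j) \<notin> V" "(z ^ (p ^ j)) ^ p \<in> V"
proof -
  define i where "i = (LEAST i. z ^ (p ^ i) \<in> V)"
  have i: "z ^ (p ^ i) \<in> V" unfolding i_def using assms(2) by (rule LeastI)
  have "i \<noteq> 0" using i assms(1) by (cases i) auto
  then obtain j where j: "i = Suc j" by (cases i) auto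
  have "z ^ (p ^ j) \<notin> V" using j not_less_Least[of j "\<lambda>i. z ^ (p ^ i) \<in> V"] i_def by simp
  moreover have "(z ^ (p ^ j)) ^ p \<in> V" using i j by (simp add: mult.commute flip: power_mult)
  ultimately show ?thesis using that by blast
qed

context mult_group
begin

text \<open>The set is the preimage in \<open>U\<close> of the centralizer of \<open>P\<close> in
  \<open>U\<close> modulo \<open>V\<close>; it is invariant under \<open>H\<close> because
  \<open>P\<close> is normal.\<close>

lemma nm_fix:
  assumes U: "nm U H" and V: "nm V H" "V \<subseteq> U" and P: "nm P H"
  shows "nm {u \<in> U. \<forall>s\<in>P. cg V u (cj s u)} H" "V \<subseteq> {u \<in> U. \<forall>s\<in>P. cg V u (cj s u)}"
proof -
  let ?N = "{u \<in> U. \<forall>s\<in>P. cg V u (cj s u)}"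
  have sgs: "sg U" "sg V" "sg P" "sg H" using U V P nmD by blast+
  have UH: "U \<subseteq> H" "P \<subseteq> H" using U P nm_sub by auto
  show "V \<subseteq> ?N" using V nm_comm[OF V(1)] UH by (auto simp: cg_def)
  show "nm ?N H"
    unfolding nm_def
  proof (intro conjI ballI sgs sg_finite_closed)
    show "finite ?N" using sg_finite[OF sgs(1)] by simp
    show "1 \<in> ?N" using sgs by (simp add: sg_one cg_refl)
    show "?N \<subseteq> H" using UH by auto
    fix a b assume ab: "a \<in> ?N" "b \<in> ?N"
    then show "a * b \<in> ?N"
      using UH sgs by (auto simp: sg_mult cj_mult sg_cj subset_iff intro!: cg_mult[OF V(1)])
  next
    fix h u assume h: "h \<in> H" and u: "u \<in> ?N"
    have "cg V (cj h u) (cj s (cj h u))" if s: "s \<in> P" for s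
    proof -
      have "cj s (cj h u) = cj h (cj (cj (iv h) s) u)" by (simp add: cj_def mult.assoc)
      moreover have "cj (iv h) s \<in> P" using nm_cj[OF P sg_iv[OF sgs(4) h] s] .
      ultimately show ?thesis using u cg_cj[OF V(1) h] by auto
    qed
    then show "cj h u \<in> ?N" using u nm_cj[OF U h] by auto
  qed
qed

text \<open>The set is the kernel of the conjugation action of \<open>H\<close> on \<open>U\<close>
  modulo \<open>V\<close>.\<close>

lemma nm_kernel:
  assumes U: "nm U H" and V: "nm V H"
  shows "nm {r \<in> H. \<forall>u\<in>U. cg V u (cj r u)} H"
proof -
  let ?N = "{r \<in> H. \<forall>u\<in>U. cg V u (cj r u)}"
  have sgs: "sg U" "sg V" "sg H" using U V nmD by blast+
  show "nm ?N H"
    unfolding nm_def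
  proof (intro conjI ballI sgs sg_finite_closed)
    show "finite ?N" using sg_finite[OF sgs(3)] by simp
    show "1 \<in> ?N" using sgs by (simp add: sg_one cg_refl)
    show "?N \<subseteq> H" by auto
    fix a b assume ab: "a \<in> ?N" "b \<in> ?N"
    have "cg V u (cj (a * b) u)" if u: "u \<in> U" for u
    proof -
      have "cg V u (cj b u)" "cg V (cj b u) (cj a (cj b u))" using ab u nm_cj[OF U _ u, of b] by auto
      then show ?thesis using cg_trans[OF sgs(2)] by (metis cj_cj)
    qed
    then show "a * b \<in> ?N" using ab sg_mult[OF sgs(3)] by auto
  next
    fix h r assume h: "h \<in> H" and r: "r \<in> ?N"
    have "cg V u (cj (cj h r) u)" if u: "u \<in> U" for u
    proof -
      have "cj (iv h) u \<in> U" using nm_cj[OF U sg_iv[OF sgs(3) h] u] .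
      then have "cg V (cj (iv h) u) (cj r (cj (iv h) u))" using r by blast
      from cg_cj[OF V h this] have "cg V u (cj h (cj r (cj (iv h) u)))" by simp
      moreover have "cj h (cj r (cj (iv h) u)) = cj (cj h r) u" by (simp add: cj_def mult.assoc)
      ultimately show ?thesis by simp
    qed
    then show "cj h r \<in> ?N" using r h sg_cj[OF sgs(3)] by auto
  qed
qed

lemma cg_power_mult:
  assumes V: "nm V U" and c: "\<And>a b. a \<in> U \<Longrightarrow> b \<in> U \<Longrightarrow> cg V (a * b) (b * a)" and ab: "a \<in> U" "b \<in> U"
  shows "cg V ((a * b) ^ n) (a ^ n * b ^ n)"
proof (induction n)
  case 0
  then show ?case using nm_sg1[OF V] by (simp add: cg_refl)
next
  case (Suc n)
  have sgs: "sg U" "sg V" using V nmD by blast+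
  note cl = sg_mult[OF sgs(1)] sg_power[OF sgs(1)]
  have "cg V ((a * b) * (a * b) ^ n) ((a * b) * (a ^ n * b ^ n))"
    using Suc ab by (intro cg_mult[OF V] cl cg_refl sgs)
  moreover have "cg V (a * (b * a ^ n) * b ^ n) (a * (a ^ n * b) * b ^ n)"
    using ab by (intro cg_mult[OF V] cl cg_refl sgs c)
  ultimately have "cg V ((a * b) ^ Suc n) (a * (a ^ n * b) * b ^ n)"
    using cg_trans[OF sgs(2)] by (simp add: mult.assoc)
  then show ?case by (simp add: mult.assoc)
qed

end

text \<open>By \<open>pgroup_central\<close>, \<open>P\<close> has a nontrivial fixed point on the
  factor; the fixed points form a normal subgroup of \<open>H\<close>, so they are
  everything.\<close>

lemma chief_central:
  fixes U V :: "'a::mult_group set"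
  assumes p: "prime p" and P: "psg p P" "nm P H" and c: "chief H U V" and UP: "U \<subseteq> P"
    and u: "u \<in> U" and s: "s \<in> P"
  shows "cg V u (cj s u)"
proof -
  let ?N = "{u \<in> U. \<forall>s\<in>P. cg V u (cj s u)}"
  note U = chief_nm1[OF c] and V = chief_nm2[OF c] and VU = chief_sub[OF c]
  have UP': "nm U P" "nm V P"
    using nm_subgroup[OF U psg_sg[OF P(1)] UP nm_sub[OF P(2)]]
      nm_subgroup[OF V psg_sg[OF P(1)] _ nm_sub[OF P(2)]] VU UP by auto
  have "V \<subset> U" using VU chief_ne[OF c] by blast
  then obtain w where w: "w \<in> U" "w \<notin> V" "\<And>s. s \<in> P \<Longrightarrow> cg V w (cj s w)"
    using pgroup_central[OF p P(1) UP'] by metis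
  have "?N = U" by (rule chief_top[OF c nm_fix(1)[OF U V VU P(2)] nm_fix(2)[OF U V VU P(2)], of w]) (use w in auto)
  then show ?thesis using u s by blast
qed

text \<open>Elements of \<open>U\<close> belong to \<open>P\<close> and therefore act trivially on
  the factor.\<close>

lemma chief_abelian:
  fixes U V :: "'a::mult_group set"
  assumes "prime p" "psg p P" "nm P H" "chief H U V" "U \<subseteq> P" "a \<in> U" "b \<in> U"
  shows "cg V (a * b) (b * a)"
proof -
  have b: "b \<in> H" using assms(3,5,7) nm_sub by blast
  have "iv a * cj b a \<in> V"
    using chief_central[OF assms(1-6), of b] assms(5,7) by (auto simp: cg_def)
  then have "cj (iv b) (iv a * cj b a) \<in> V"
    using nm_cj[OF chief_nm2[OF assms(4)] sg_iv[OF nm_sg2[OF assms(3)] b]] by blast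
  moreover have "cj (iv b) (iv a * cj b a) = iv (a * b) * (b * a)" by (simp add: cj_def mult.assoc)
  ultimately show ?thesis by (simp add: cg_def)
qed

text \<open>Since the factor is abelian, the elements with p-th power in \<open>V\<close> form a
  normal subgroup; it contains an element outside \<open>V\<close>, hence is
  \<open>U\<close>.\<close>

lemma chief_exponent:
  fixes U V :: "'a::mult_group set"
  assumes p: "prime p" and P: "psg p P" "nm P H" and c: "chief H U V" and UP: "U \<subseteq> P"
    and u: "u \<in> U"
  shows "u ^ p \<in> V"
proof -
  let ?N = "{u \<in> U. u ^ p \<in> V}"
  note U = chief_nm1[OF c] and V = chief_nm2[OF c] and VU = chief_sub[OF c]
  have sgs: "sg U" "sg V" "sg H" using U V nmD by blast+
  have VU': "nm V U" using nm_subgroup[OF V sgs(1) VU nm_sub[OF U]] .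
  have N: "nm ?N H"
    unfolding nm_def
  proof (intro conjI ballI sgs sg_finite_closed)
    show "finite ?N" using sg_finite[OF sgs(1)] by simp
    show "1 \<in> ?N" using sgs by (simp add: sg_one)
    show "?N \<subseteq> H" using nm_sub[OF U] by auto
    fix a b assume ab: "a \<in> ?N" "b \<in> ?N"
    have "cg V ((a * b) ^ p) (a ^ p * b ^ p)"
      using cg_power_mult[OF VU' chief_abelian[OF p P c UP]] ab by blast
    then show "a * b \<in> ?N" using ab cg_mem[OF sgs(2)] sgs by (auto simp: sg_mult)
  next
    fix h a assume "h \<in> H" "a \<in> ?N"
    then show "cj h a \<in> ?N" using nm_cj[OF U] nm_cj[OF V] by (auto simp flip: cj_power)
  qed
  have VN: "V \<subseteq> ?N" using VU sg_power[OF sgs(2)] by auto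
  obtain w where w: "w \<in> U" "w \<notin> V" using VU chief_ne[OF c] by blast
  obtain k where "w ^ (p ^ k) = 1" using psg_pow[OF P(1)] w UP by (metis subsetD)
  then obtain j where j: "w ^ (p ^ j) \<notin> V" "(w ^ (p ^ j)) ^ p \<in> V"
    using last_power[OF w(2), of p k] sg_one[OF sgs(2)] by metis
  have "?N = U"
    by (rule chief_top[OF c N VN, of "w ^ (p ^ j)"]) (use w j sg_power[OF sgs(1)] in auto)
  then show ?thesis using u by blast
qed


text \<open>A factor of order \<open>p\<close> is cyclic and each element of \<open>H\<close> acts
  on it as a power map. Power maps commute and, by Fermat, have trivial (p-1)-th powers, so the
  kernel of the action contains the residual.\<close>

lemma residual_trivial:
  fixes U V :: "'a::mult_group set"
  assumes p: "prime p" and U: "nm U H" and V: "nm V H" and VU: "V \<subseteq> U"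
    and card: "card U = p * card V" and r: "r \<in> residual p H" and u: "u \<in> U"
  shows "cg V u (cj r u)"
proof -
  have sgs: "sg U" "sg V" "sg H" using U V nmD by blast+
  have VU': "nm V U" using nm_subgroup[OF V sgs(1) VU nm_sub[OF U]] .
  have up: "u ^ p \<in> V" if "u \<in> U" for u
    using nm_index_pow[OF VU' that] card sg_card_pos[OF sgs(2)] by simp
  have "V \<noteq> U" using card sg_card_pos[OF sgs(2)] prime_gt_1_nat[OF p] by auto
  then obtain w where w: "w \<in> U" "w \<notin> V" using VU by blast
  have cw: "sg (cyc w)" "cyc w \<subseteq> U" using cyc_sg[OF sgs(1) w(1)] cyc_sub[OF sgs(1) w(1)] .
  have sp: "sg (sp V (cyc w))" using sp_nm_sg[OF VU' cw] .
  have spU: "sp V (cyc w) \<subseteq> U" using sp_least[OF sgs(1) VU cw(2)] .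
  have Vsp: "V \<subseteq> sp V (cyc w)" using sp_sub1[OF sg_one[OF cw(1)]] .
  have wsp: "w \<in> sp V (cyc w)" using sp_sub2[OF sg_one[OF sgs(2)], of "cyc w"] cyc_self[of w] by blast
  \<comment> \<open>The index \<open>m\<close> divides \<open>p\<close> and is not 1, so
    \<open>w\<close> generates \<open>U\<close> modulo \<open>V\<close>.\<close>
  obtain m where m: "card (sp V (cyc w)) = card V * m" using sg_dvd[OF sp sgs(2) Vsp] by auto
  have "card V * m dvd card V * p" using sg_dvd[OF sgs(1) sp spU] m card by (simp add: mult.commute)
  then have "m dvd p" using sg_card_pos[OF sgs(2)] by simp
  then have "m = 1 \<or> m = p" using p by (simp add: prime_nat_iff)
  moreover have "m \<noteq> 1"
  proof
    assume "m = 1"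
    then have "V = sp V (cyc w)" using m card_subset_eq[OF sg_finite[OF sp] Vsp] by simp
    then show False using w wsp by blast
  qed
  ultimately have "sp V (cyc w) = U" using m card card_subset_eq[OF sg_finite[OF sgs(1)] spU]
    by (simp add: mult.commute)
  then have gen: "\<exists>i. cg V u (w ^ i)" if "u \<in> U" for u
    using sp_cg[OF VU' cw(2), of u] that by (metis cyc_def imageE)
  have ex: "\<exists>c. cg V (cj a w) (w ^ c)" if a: "a \<in> H" for a using gen nm_cj[OF U a w(1)] by blast
  \<comment> \<open>An exponent describing the action on the generator \<open>w\<close> describes it
    on all of \<open>U\<close>.\<close>
  have T: "cg V (cj a u) (u ^ c)" if a: "a \<in> H" and c: "cg V (cj a w) (w ^ c)" and u: "u \<in> U" for a c u
  proof -
    obtain i where i: "cg V u (w ^ i)" using gen u by blast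
    note cl = sg_power[OF sgs(1) w(1)] nm_cj[OF U a w(1)] sg_power[OF sgs(1) u]
    have "cg V (cj a u) (cj a w ^ i)" using cg_cj[OF V a i] by (simp add: cj_power)
    moreover have "cg V (cj a w ^ i) ((w ^ c) ^ i)" using cg_power[OF VU' cl(2,1) c] .
    moreover have "cg V ((w ^ i) ^ c) (u ^ c)"
      using cg_power[OF VU' cl(1) u] cg_sym[OF sgs(2) i] by blast
    moreover have "(w ^ c) ^ i = (w ^ i) ^ c" by (simp add: mult.commute flip: power_mult)
    ultimately show ?thesis using cg_trans[OF sgs(2)] by metis
  qed
  have comp: "cg V (cj (a * b) u) (u ^ (c * d))"
    if "a \<in> H" "b \<in> H" "\<And>u. u \<in> U \<Longrightarrow> cg V (cj a u) (u ^ c)" "\<And>u. u \<in> U \<Longrightarrow> cg V (cj b u) (u ^ d)" "u \<in> U"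
    for a b c d u
  proof -
    have "cg V (cj a (cj b u)) (cj a (u ^ d))" using cg_cj[OF V] that by blast
    moreover have "cg V (cj a (u ^ d)) ((u ^ d) ^ c)" using that sg_power[OF sgs(1)] by blast
    moreover have "(u ^ d) ^ c = u ^ (c * d)" by (simp add: mult.commute flip: power_mult)
    ultimately show ?thesis using cg_trans[OF sgs(2)] by (metis cj_cj)
  qed
  let ?Z = "{r \<in> H. \<forall>u\<in>U. cg V u (cj r u)}"
  have "residual p H \<subseteq> ?Z"
  proof (rule residual_least[OF nm_kernel[OF U V]])
    fix a b assume a: "a \<in> H" and b: "b \<in> H"
    obtain c d where c: "cg V (cj a w) (w ^ c)" and d: "cg V (cj b w) (w ^ d)" using ex a b by blast
    have "cg V u (cj (a * b * iv a * iv b) u)" if u: "u \<in> U" for u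
    proof -
      \<comment> \<open>Both products of \<open>a\<close> and \<open>b\<close> raise
        \<open>v\<close> to the same power modulo \<open>V\<close>; one of the results is
        \<open>u\<close>, the other its image under the commutator.\<close>
      define v where "v = cj (iv (b * a)) u"
      have v: "v \<in> U" unfolding v_def using nm_cj[OF U _ u] a b sgs by (simp add: sg_mult sg_iv)
      have "cg V (cj (b * a) v) (v ^ (d * c))" "cg V (cj (a * b) v) (v ^ (c * d))"
        using comp[OF b a T[OF b d] T[OF a c] v] comp[OF a b T[OF a c] T[OF b d] v] by simp_all
      then have "cg V (cj (b * a) v) (cj (a * b) v)"
        using cg_trans[OF sgs(2)] cg_sym[OF sgs(2)] by (metis mult.commute)
      moreover have "cj (b * a) v = u" "cj (a * b) v = cj (a * b * iv a * iv b) u"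
        by (simp_all add: v_def cj_def mult.assoc)
      ultimately show ?thesis by simp
    qed
    then show "a * b * iv a * iv b \<in> ?Z" using a b sgs by (simp add: sg_mult sg_iv)
  next
    fix a assume a: "a \<in> H"
    obtain c where c: "cg V (cj a w) (w ^ c)" using ex a by blast
    have "\<not> p dvd c"
    proof
      assume "p dvd c"
      then obtain t where "c = p * t" by auto
      then have "w ^ c \<in> V" using sg_power[OF sgs(2) up[OF w(1)]] by (simp add: power_mult)
      then have "cj a w \<in> V" using cg_mem[OF sgs(2) c] by simp
      then have "cj (iv a) (cj a w) \<in> V" using nm_cj[OF V sg_iv[OF sgs(3) a]] by blast
      then show False using w by simp
    qed
    then have "[c ^ (p - 1) = 1] (mod p)" using fermat_theorem[OF p] by blast
    moreover have "1 \<le> c ^ (p - 1)" using \<open>\<not> p dvd c\<close> by (cases "c = 0") auto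
    ultimately have "p dvd c ^ (p - 1) - 1" using cong_altdef_nat by blast
    then obtain t where "c ^ (p - 1) - 1 = p * t" by auto
    then have t: "c ^ (p - 1) = 1 + p * t" using \<open>1 \<le> c ^ (p - 1)\<close> by simp
    have pw: "\<forall>u\<in>U. cg V (cj (a ^ n) u) (u ^ (c ^ n))" for n
    proof (induction n)
      case 0
      then show ?case using sgs by (simp add: cg_refl)
    next
      case (Suc n)
      then show ?case
        using comp[OF a sg_power[OF sgs(3) a, of n] T[OF a c], of "c ^ n"] by simp
    qed
    have "cg V u (cj (a ^ (p - 1)) u)" if u: "u \<in> U" for u
    proof -
      have "iv u * u ^ (c ^ (p - 1)) = (u ^ p) ^ t" unfolding t by (simp add: power_mult)
      then have "cg V u (u ^ (c ^ (p - 1)))" using sg_power[OF sgs(2) up[OF u]] by (simp add: cg_def)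
      then show ?thesis using cg_trans[OF sgs(2)] cg_sym[OF sgs(2)] pw u by blast
    qed
    then show "a ^ (p - 1) \<in> ?Z" using a sg_power[OF sgs(3)] by simp
  qed
  then show ?thesis using r u by blast
qed

text \<open>Let \<open>n\<close> be the least positive exponent for which \<open>r ^ n\<close>
  centralizes \<open>Q\<close>. It is not a power of \<open>p\<close>, so some prime
  \<open>q \<noteq> p\<close> divides it, and a power of \<open>r\<close> acts with order
  \<open>q\<close>.\<close>

lemma not_pact_q_element:
  fixes r :: "'a::mult_group"
  assumes p: "prime p" and H: "sg H" and r: "r \<in> H" "\<not> acts_as_p p Q r"
  obtains q j m where "prime q" "q \<noteq> p" "(r ^ j) ^ (q ^ m) = 1" "r ^ j \<notin> cen Q"
proof -
  let ?K = "H \<inter> cen Q"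
  have K: "sg ?K" using sg_cen[OF H] .
  let ?A = "\<lambda>n. 0 < n \<and> r ^ n \<in> ?K"
  have "?A (card H)" using sg_pow_card[OF H r(1)] sg_one[OF K] sg_card_pos[OF H] by simp
  define n where "n = (LEAST n. ?A n)"
  have n: "?A n" unfolding n_def using \<open>?A (card H)\<close> by (rule LeastI)
  have min: "r ^ i \<notin> ?K" if "0 < i" "i < n" for i
    using not_less_Least[of i ?A] that n_def by blast
  have "\<exists>q. prime q \<and> q \<noteq> p \<and> q dvd n"
  proof (rule ccontr)
    assume *: "\<not> ?thesis"
    obtain y where y: "n = p ^ multiplicity p n * y" "\<not> p dvd y"
      using multiplicity_decompose'[of n p] n p by (metis less_not_refl not_prime_unit)
    have "y = 1"
    proof (rule ccontr)
      assume "y \<noteq> 1"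
      then obtain q where q: "prime q" "q dvd y" using prime_factor_nat by blast
      then have "q dvd n" using y(1) by (metis dvd_mult)
      then show False using * q y(2) by blast
    qed
    then have "r ^ (p ^ multiplicity p n) \<in> cen Q" using y n by simp
    then show False using r(2) unfolding acts_as_p_def by blast
  qed
  then obtain q where q: "prime q" "q \<noteq> p" "q dvd n" by blast
  then obtain i where i: "n = q * i" by auto
  have i0: "0 < i" "i < n" using i n prime_gt_1_nat[OF q(1)] by (auto intro: Nat.gr0I)
  define y where "y = r ^ i"
  have yH: "y \<in> H" using r H sg_power y_def by metis
  have yK: "y \<notin> ?K" "y ^ q \<in> ?K" using min[OF i0] n i by (auto simp: y_def mult.commute simp flip: power_mult)
  have cy: "sg (cyc y)" using cyc_sg[OF H yH] .
  \<comment> \<open>\<open>s\<close> is the q'-part of the order of \<open>y\<close>: raising to it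
    makes \<open>y\<close> a q-element, and since \<open>s\<close> is prime to \<open>q\<close> the
    result stays outside \<open>?K\<close>.\<close>
  obtain s where s: "card (cyc y) = q ^ multiplicity q (card (cyc y)) * s" "\<not> q dvd s"
    using multiplicity_decompose'[of "card (cyc y)" q] sg_card_pos[OF cy] q(1) by (metis less_not_refl not_prime_unit)
  have 1: "(y ^ s) ^ (q ^ multiplicity q (card (cyc y))) = 1"
    using sg_pow_card[OF cy cyc_self] s(1) by (simp add: mult.commute flip: power_mult)
  have "coprime s q" using s(2) q(1) by (simp add: prime_imp_coprime coprime_commute)
  then have 2: "y ^ s \<notin> ?K" using pow_coprime_mem[OF K _ yK(2)] yK(1) by blast
  then have 3: "y ^ s \<notin> cen Q" using sg_power[OF H yH] by blast
  have 4: "y ^ s = r ^ (i * s)" by (simp add: y_def power_mult)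
  show ?thesis using that[OF q(1,2)] 1 3 unfolding 4 by blast
qed

section \<open>Sylow subgroups and the cover-avoidance hypothesis\<close>

definition is_sylow :: "nat \<Rightarrow> 'a::mult_group set \<Rightarrow> 'a set \<Rightarrow> bool" where
  "is_sylow p P H \<longleftrightarrow> psg p P \<and> sg H \<and> P \<subseteq> H \<and> \<not> p dvd (card H div card P)"

lemma is_sylow_exists:
  assumes p: "prime p" and H: "sg H"
  obtains P where "is_sylow p P H"
proof -
  have "card H \<noteq> 0" "\<not> is_unit p" using sg_card_pos[OF H] p not_prime_unit by auto
  then obtain y where y: "card H = p ^ multiplicity p (card H) * y" "\<not> p dvd y"
    using multiplicity_decompose'[of "card H" p] by metis
  then obtain P where P: "sg P" "P \<subseteq> H" "card P = p ^ multiplicity p (card H)"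
    using sylow_exists[OF p H, of "multiplicity p (card H)"] by (metis dvd_triv_left)
  have "card H div card P = y" using y P prime_gt_0_nat[OF p] by (metis nonzero_mult_div_cancel_left sg_card_pos less_numeral_extra(3))
  then have "is_sylow p P H" using P y H by (auto simp: is_sylow_def psg_def)
  then show ?thesis using that by blast
qed

text \<open>\<open>Q\<close> acts by left multiplication on the cosets of \<open>P\<close> in
  \<open>H\<close>, whose number is prime to \<open>p\<close>; the inverse of a representative of a
  fixed coset conjugates \<open>Q\<close> into \<open>P\<close>.\<close>

lemma sylow_conj:
  fixes P :: "'a::mult_group set"
  assumes p: "prime p" and P: "is_sylow p P H" and Q: "psg p Q" "Q \<subseteq> H"
  obtains h where "h \<in> H" "cj h ` Q \<subseteq> P"
proof -
  have H: "sg H" and sP: "sg P" and PH: "P \<subseteq> H" using P by (auto simp: is_sylow_def psg_def)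
  obtain k where k: "card Q = p ^ k" using Q by (auto simp: psg_def)
  let ?E = "(\<lambda>g. (*) g ` P) ` H"
  let ?F = "{C \<in> ?E. \<forall>g\<in>Q. (*) g ` C = C}"
  have "card ?E * card P = card H" using card_lcosets[OF H sP PH] .
  then have "card ?E = card H div card P" using sg_card_pos[OF sP]
    by (metis nonzero_mult_div_cancel_right less_numeral_extra(3))
  then have n: "\<not> p dvd card ?E" using P by (simp add: is_sylow_def)
  have "p dvd card (?E - ?F)"
  proof (rule fixed_points_mod[OF p psg_sg[OF Q(1)] k])
    show "finite ?E" using sg_finite[OF H] by simp
    fix g e assume "g \<in> Q" "e \<in> ?E"
    then show "(*) g ` e \<in> ?E" using Q(2) sg_mult[OF H]
      by (auto simp: image_image simp flip: mult.assoc)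
  qed (auto simp: image_image mult.assoc)
  then have "?F \<noteq> {}" using n by (metis (no_types, lifting) Diff_empty)
  then obtain h where h: "h \<in> H" "\<forall>g\<in>Q. (*) g ` (*) h ` P = (*) h ` P" by auto
  have "cj (iv h) ` Q \<subseteq> P"
  proof
    fix x assume "x \<in> cj (iv h) ` Q"
    then obtain g where g: "g \<in> Q" "x = iv h * (g * h)" by (auto simp: cj_def mult.assoc)
    have "(*) h ` P = (*) (g * h) ` P" using h(2) g by (simp add: image_image mult.assoc)
    then show "x \<in> P" using lcoset_eq_iff[OF sP] g by blast
  qed
  then show ?thesis using that[of "iv h"] sg_iv[OF H h(1)] by blast
qed

lemma is_sylowD:
  assumes "is_sylow p P H"
  shows is_sylow_psg: "psg p P" and is_sylow_sg: "sg H" and is_sylow_subset: "P \<subseteq> H"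
  using assms by (auto simp: is_sylow_def)

lemma is_sylow_cj:
  fixes P :: "'a::mult_group set"
  assumes P: "is_sylow p P H" and h: "h \<in> H" shows "is_sylow p (cj h ` P) H"
  using P psg_cj[of p P h] sg_cj[OF is_sylow_sg[OF P] h] by (auto simp: is_sylow_def)

lemma is_sylow_contains:
  fixes Q :: "'a::mult_group set"
  assumes p: "prime p" and H: "sg H" and Q: "psg p Q" "Q \<subseteq> H"
  obtains P where "is_sylow p P H" "Q \<subseteq> P"
proof -
  obtain P where P: "is_sylow p P H" using is_sylow_exists[OF p H] .
  obtain h where h: "h \<in> H" "cj h ` Q \<subseteq> P" using sylow_conj[OF p P Q] .
  have "cj (iv h) ` cj h ` Q \<subseteq> cj (iv h) ` P" using h(2) by (rule image_mono)
  then have "Q \<subseteq> cj (iv h) ` P" by (simp add: cj_image_iv)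
  then show ?thesis using that is_sylow_cj[OF P sg_iv[OF H h(1)]] by blast
qed

lemma is_sylow_card_le:
  fixes Q :: "'a::mult_group set"
  assumes p: "prime p" and P: "is_sylow p P H" and Q: "psg p Q" "Q \<subseteq> H"
  shows "card Q \<le> card P"
proof -
  obtain h where "h \<in> H" "cj h ` Q \<subseteq> P" using sylow_conj[OF p P Q] .
  then have "card (cj h ` Q) \<le> card P" using card_mono[OF sg_finite[OF psg_sg[OF is_sylow_psg[OF P]]]] by blast
  then show ?thesis by simp
qed

lemma is_sylow_normal:
  fixes Q :: "'a::mult_group set"
  assumes p: "prime p" and P: "is_sylow p P H" "nm P H" and Q: "psg p Q" "Q \<subseteq> H"
  shows "Q \<subseteq> P"
proof -
  obtain h where h: "h \<in> H" "cj h ` Q \<subseteq> P" using sylow_conj[OF p P(1) Q] .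
  show ?thesis
  proof
    fix x assume "x \<in> Q"
    then have "cj (iv h) (cj h x) \<in> P" using h nm_cj[OF P(2) sg_iv[OF is_sylow_sg[OF P(1)] h(1)]] by blast
    then show "x \<in> P" by simp
  qed
qed

lemma is_sylow_max:
  fixes P :: "'a::mult_group set"
  assumes p: "prime p" and P: "is_sylow p P H" and Q: "psg p Q" "Q \<subseteq> H" "card P \<le> card Q"
  shows "is_sylow p Q H"
proof -
  have "card Q = card P" using is_sylow_card_le[OF p P Q(1,2)] Q(3) by simp
  then show ?thesis using P Q by (auto simp: is_sylow_def)
qed

lemma is_sylow_sub:
  fixes P :: "'a::mult_group set"
  assumes P: "is_sylow p P H" and K: "sg K" "P \<subseteq> K" "K \<subseteq> H" shows "is_sylow p P K"
proof -
  have d: "card P dvd card K" "card K dvd card H"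
    using sg_dvd K P by (auto simp: is_sylow_def psg_def)
  then have "card K div card P dvd card H div card P"
    using div_dvd_div[OF d(1) dvd_trans[OF d]] by simp
  then show ?thesis using P K by (auto simp: is_sylow_def intro: dvd_trans)
qed

text \<open>The index of \<open>P \<inter> N\<close> in \<open>N\<close> equals that of
  \<open>P\<close> in \<open>sp N P\<close> by \<open>card_sp\<close>, so it divides the index of
  \<open>P\<close> in \<open>H\<close>.\<close>

lemma is_sylow_Int:
  fixes N :: "'a::mult_group set"
  assumes p: "prime p" and P: "is_sylow p P H" and N: "nm N H"
  shows "is_sylow p (P \<inter> N) N" and "psg p (P \<inter> N)"
proof -
  have sP: "sg P" "sg N" "sg H" "P \<subseteq> H" using P N nmD by (auto simp: is_sylow_def psg_def)
  have s: "sg (sp N P)" "sp N P \<subseteq> H" "P \<subseteq> sp N P"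
    using sp_nm_sg[OF N sP(1,4)] sp_least[OF sP(3) nm_sub[OF N] sP(4)] sp_sub2[OF sg_one[OF sP(2)]] by auto
  have e: "card (sp N P) * card (N \<inter> P) = card N * card P" using card_sp[OF sP(2,1)] .
  have i: "sg (P \<inter> N)" using sg_Int sP by blast
  obtain a where a: "card N = card (P \<inter> N) * a" using sg_dvd[OF sP(2) i] by auto
  obtain b where b: "card (sp N P) = card P * b" using sg_dvd[OF s(1) sP(1) s(3)] by auto
  obtain c where c: "card H = card (sp N P) * c" using sg_dvd[OF sP(3) s(1,2)] by auto
  have "b = a" using e a b sg_card_pos[OF i] sg_card_pos[OF sP(1)] by (simp add: Int_commute mult.commute mult.left_commute)
  moreover have "card H div card P = b * c" using b c sg_card_pos[OF sP(1)] by simp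
  ultimately have "\<not> p dvd a" using P by (auto simp: is_sylow_def)
  moreover have "card N div card (P \<inter> N) = a" using a sg_card_pos[OF i] by simp
  moreover show "psg p (P \<inter> N)" using psg_sub[OF p is_sylow_psg[OF P] i] by simp
  ultimately show "is_sylow p (P \<inter> N) N" using sP by (simp add: is_sylow_def)
qed

section \<open>The cover-avoidance hypothesis and the key step\<close>

text \<open>Since \<open>V \<subseteq> U\<close>, covering and avoiding each reduce to a single
  inclusion.\<close>

definition cap_in :: "nat \<Rightarrow> 'a::mult_group set \<Rightarrow> 'a set \<Rightarrow> bool" where
  "cap_in p H A \<longleftrightarrow> (\<forall>U V. chief H U V \<and> p dvd (card U div card V) \<longrightarrow> U \<subseteq> sp V A \<or> U \<inter> A \<subseteq> V)"

definition strong_cap :: "nat \<Rightarrow> 'a::mult_group set \<Rightarrow> 'a set \<Rightarrow> bool" where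
  "strong_cap p G A \<longleftrightarrow> (\<forall>H. sg H \<and> A \<subseteq> H \<and> H \<subseteq> G \<longrightarrow> cap_in p H A)"

text \<open>The last conjunct of \<open>cap_hyp\<close> covers the case distinction of the theorem for \<open>p = 2\<close>: the third
  alternative follows from exponent 4 if \<open>d \<ge> 2\<close>, and from the condition on cyclic subgroups of order 4 if \<open>d = 1\<close>.\<close>

definition cap_hyp :: "nat \<Rightarrow> nat \<Rightarrow> 'a::mult_group set \<Rightarrow> bool" where
  "cap_hyp p d G \<longleftrightarrow> 0 < d \<and> (\<forall>A. psg p A \<and> A \<subseteq> G \<and> card A = p ^ d \<longrightarrow> strong_cap p G A) \<and>
    (odd p \<or> (\<forall>Q. psg p Q \<and> Q \<subseteq> G \<longrightarrow> (\<forall>a\<in>Q. \<forall>b\<in>Q. a * b = b * a)) \<or>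
     (\<forall>y\<in>G. \<forall>k. y ^ (p ^ k) = 1 \<longrightarrow> y ^ (p ^ d) = 1 \<or> strong_cap p G (cyc y)))"

lemma strong_cap_sub: "strong_cap p G A \<Longrightarrow> H \<subseteq> G \<Longrightarrow> strong_cap p H A"
  unfolding strong_cap_def by blast

lemma scapD: "strong_cap p H A \<Longrightarrow> sg H \<Longrightarrow> A \<subseteq> H \<Longrightarrow> cap_in p H A"
  unfolding strong_cap_def by blast

lemma cap_hyp_sub: "cap_hyp p d G \<Longrightarrow> H \<subseteq> G \<Longrightarrow> cap_hyp p d H"
  unfolding cap_hyp_def using strong_cap_sub by (meson subset_trans subsetD)

text \<open>The source of most contradictions: \<open>A\<close> meets \<open>U\<close> outside
  \<open>V\<close>, so it does not avoid the factor, nor does it cover it. A nontrivial factor of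
  p-groups automatically has order divisible by \<open>p\<close>.\<close>

lemma cap_contra:
  fixes A :: "'a::mult_group set"
  assumes p: "prime p" and c: "chief H U V" and U: "psg p U" and A: "cap_in p H A"
    and a: "a \<in> A" "a \<in> U" "a \<notin> V" and n: "\<not> U \<subseteq> sp V A"
  shows False
proof -
  have V: "sg V" "V \<subset> U" using chief_nm2[OF c] nm_sg1 chief_sub[OF c] a by auto
  then have "card V < card U" using psubset_card_mono sg_finite[OF psg_sg[OF U]] by blast
  then have "p * card V dvd card U"
    using psg_less_dvd[OF p psg_sub[OF p U V(1)] U] V(2) by auto
  then have "p dvd card U div card V" using sg_card_pos[OF V(1)] by auto
  then show False using A c n a unfolding cap_in_def by blast
qed

lemma sp_pgroup_index:
  fixes U :: "'a::mult_group set"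
  assumes W: "nm W S" "card S = p * card W" and U: "sg U" "U \<subseteq> S"
  shows "card U \<le> p * card (W \<inter> U)"
proof -
  have s: "sg W" "sg S" using W nmD by blast+
  have "card (sp W U) \<le> card S"
    using card_mono[OF sg_finite[OF s(2)] sp_least[OF s(2) nm_sub[OF W(1)] U(2)]] .
  then have "card W * card U \<le> card W * (p * card (W \<inter> U))"
    using card_sp[OF s(1) U(1)] W(2) by (metis mult.assoc mult.commute mult_le_mono1)
  then show ?thesis using sg_card_pos[OF s(1)] by simp
qed

text \<open>The key step of the overview. It is used with \<open>S = P\<close> when \<open>P\<close>
  is large, and with a larger \<open>S\<close> when \<open>card P \<le> p ^ d\<close>, where the
  conclusion \<open>p ^ d \<le> card V\<close> is contradictory.\<close>

lemma critical_chief_factor: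
  fixes P :: "'a::mult_group set"
  assumes p: "prime p" and H: "sg H"
    and cap: "\<And>A. psg p A \<Longrightarrow> A \<subseteq> H \<Longrightarrow> card A = p ^ d \<Longrightarrow> cap_in p H A"
    and P: "psg p P" "nm P H" and S: "psg p S" "P \<subseteq> S" "S \<subseteq> H" "p ^ d < card S"
    and W: "nm W S" "card S = p * card W" "\<not> P \<subseteq> W"
    and q: "prime q" "q \<noteq> p" and Y: "psg q Y" "Y \<subseteq> residual p H" "P \<inter> cen Y \<subseteq> W"
  obtains U V where "chief H U V" "U \<subseteq> P" "V \<subset> P" "p ^ d \<le> card V" "card U \<noteq> p * card V"
    "\<exists>y\<in>Y. \<exists>u\<in>U. \<not> cg V u (cj y u)"
proof -
  let ?B = "\<lambda>N. nm N H \<and> N \<subseteq> W \<inter> P"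
  have sW: "sg W" "W \<subseteq> S" using W nmD by blast+
  have sP: "sg P" "P \<subseteq> H" using P nmD by blast+
  have b1: "?B {1}" using nm_triv[OF H] sg_one[OF sW(1)] sg_one[OF sP(1)] by simp
  \<comment> \<open>Maximality of \<open>V\<close> among the normal subgroups of \<open>H\<close>
    inside \<open>W \<inter> P\<close> keeps every chief factor above it and below \<open>P\<close>
    from lying in \<open>W\<close>.\<close>
  have "\<exists>V. ?B V \<and> (\<forall>K. ?B K \<longrightarrow> V \<subseteq> K \<longrightarrow> K = V)"
    by (rule nm_maximal[of H ?B "{1}", OF sg_finite[OF H] b1]) (blast dest: nm_sub, blast)
  then obtain V where "?B V" and Vm: "\<And>K. ?B K \<Longrightarrow> V \<subseteq> K \<Longrightarrow> K = V" by blast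
  then have V: "nm V H" "V \<subseteq> W" "V \<subseteq> P" by auto
  have VP: "V \<subset> P" using V W(3) by blast
  obtain U where c: "chief H U V" and UP: "U \<subseteq> P" using chief_above[OF V(1) P(2) VP] .
  note U = chief_nm1[OF c] and VU = chief_sub[OF c]
  have sU: "sg U" "sg V" using U V nmD by blast+
  have pU: "psg p U" "psg p V" using psg_sub[OF p P(1)] sU UP V by auto
  have UW: "\<not> U \<subseteq> W"
  proof
    assume "U \<subseteq> W"
    then have "U = V" using Vm[of U] U UP VU by blast
    then show False using chief_ne[OF c] by simp
  qed
  \<comment> \<open>If \<open>Y\<close> were trivial on the factor, each coset of \<open>V\<close>
    in \<open>U\<close> would contain a point centralized by \<open>Y\<close>; such points lie in
    \<open>W\<close>, so \<open>U\<close> would lie in \<open>W\<close>.\<close>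
  have act: "\<exists>y\<in>Y. \<exists>u\<in>U. \<not> cg V u (cj y u)"
  proof (rule ccontr)
    assume "\<not> ?thesis"
    then have tr: "cg V u (cj y u)" if "u \<in> U" "y \<in> Y" for u y using that by blast
    obtain u where u: "u \<in> U" "u \<notin> W" using UW by blast
    have "cj y v \<in> V" if "y \<in> Y" "v \<in> V" for y v
      using nm_cj[OF V(1)] that Y(2) residual_sub[OF H] by blast
    then obtain v where v: "v \<in> V" "\<And>y. y \<in> Y \<Longrightarrow> cj y (u * v) = u * v"
      using coset_fixed_point[OF p q Y(1) pU(2), of u] tr[OF u(1)] by metis
    have "u * v \<in> cen Y" using v(2) by (intro cenI) (metis cj_eq_iff)
    moreover have "u * v \<in> P" using u v UP V sg_mult[OF sP(1)] by blast
    ultimately have "u * v \<in> W" using Y(3) by blast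
    then show False using u(2) v(1) V(2) sg_mult_right_iff[OF sW(1)] by blast
  qed
  have ne: "card U \<noteq> p * card V"
    using act residual_trivial[OF p U V(1) VU] Y(2) by blast
  have "p ^ d \<le> card V"
  proof (rule ccontr)
    assume "\<not> p ^ d \<le> card V"
    then have lt: "card V < p ^ d" by simp
    have sWU: "sg (W \<inter> U)" using sg_Int sW sU by blast
    \<comment> \<open>The index of \<open>W \<inter> U\<close> in \<open>U\<close> is at most
      \<open>p\<close>, so equality would give a factor of order \<open>p\<close>, on which the
      residual is trivial.\<close>
    have "V \<noteq> W \<inter> U"
    proof
      assume "V = W \<inter> U"
      then have "card U \<le> p * card V" using sp_pgroup_index[OF W(1,2) sU(1)] UP S(2) by auto
      moreover have "card V < card U"
        using psubset_card_mono[OF sg_finite[OF sU(1)]] VU chief_ne[OF c] by blast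
      then have "p * card V dvd card U" using psg_less_dvd[OF p pU(2,1)] by simp
      ultimately show False using ne sg_card_pos[OF sU(1)] by (simp add: dvd_imp_le le_antisym)
    qed
    then have "V \<subset> W \<inter> U" using V(2) VU by blast
    moreover have "psg p (W \<inter> U)" using psg_sub[OF p pU(1) sWU] by blast
    ultimately obtain V' where V': "sg V'" "V \<subset> V'" "V' \<subseteq> W \<inter> U" "card V' = p * card V"
      using pgroup_step[OF p _ sU(2)] by metis
    obtain i where i: "card V = p ^ i" using pU by (auto simp: psg_def)
    have id: "i < d" using lt i prime_gt_1_nat[OF p] power_less_imp_less_exp by metis
    have "card V' \<le> p ^ d"
    proof -
      have "p ^ Suc i \<le> p ^ d" using id prime_gt_1_nat[OF p] by (intro power_increasing) auto
      then show ?thesis using V'(4) i by simp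
    qed
    moreover have pW: "psg p W" using psg_sub[OF p S(1) sW] .
    have "p ^ d \<le> card W"
    proof -
      obtain w where w: "card W = p ^ w" using pW by (auto simp: psg_def)
      have "p ^ d < p ^ Suc w" using S(4) W(2) w by simp
      then have "d < Suc w" using prime_gt_1_nat[OF p] power_less_imp_less_exp by metis
      then show ?thesis using w prime_gt_1_nat[OF p] by (simp add: power_increasing)
    qed
    ultimately obtain A where A: "sg A" "V' \<subseteq> A" "A \<subseteq> W" "card A = p ^ d"
      using pgroup_between[OF p pW V'(1)] V'(3) by blast
    have pA: "psg p A" using psg_sub[OF p pW A(1,3)] .
    have capA: "cap_in p H A" using cap[OF pA _ A(4)] A(3) sW(2) S(3) by blast
    obtain a where a: "a \<in> V'" "a \<notin> V" using V'(2) by blast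
    have "\<not> U \<subseteq> sp V A" using sp_least[OF sW(1) V(2) A(3)] UW by blast
    then show False using cap_contra[OF p c pU(1) capA, of a] a A(2) V'(3) by blast
  qed
  then show ?thesis using that c UP VP ne act by blast
qed

section \<open>Normal p-subgroups of order greater than \<open>p ^ d\<close>\<close>

text \<open>Collection in nilpotency class 2: \<open>c\<close> is a commutator of \<open>u\<close>
  and \<open>z\<close> commuting with both, and its exponent in the second formula is the binomial
  coefficient of \<open>n\<close> over 2.\<close>

lemma power_mult_class2:
  fixes u z c :: "'a::mult_group"
  assumes zu: "z * u = u * z * c" and cu: "c * u = u * c" and cz: "c * z = z * c"
  shows "z ^ n * u = u * z ^ n * c ^ n" and "(u * z) ^ n = u ^ n * z ^ n * c ^ (n * (n - 1) div 2)"
proof -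
  have cnu: "c ^ i * u = u * c ^ i" and cnz: "c ^ i * z = z * c ^ i" for i
    using cu cz by (induction i) (simp_all add: mult.assoc, simp_all flip: mult.assoc)
  show 1: "z ^ n * u = u * z ^ n * c ^ n" for n
  proof (induction n)
    case (Suc n)
    have "z ^ Suc n * u = z * (z ^ n * u)" by (simp add: mult.assoc)
    also have "\<dots> = (z * u) * z ^ n * c ^ n" by (simp add: Suc mult.assoc)
    also have "\<dots> = u * z * (c * z ^ n) * c ^ n" by (simp add: zu mult.assoc)
    also have "c * z ^ n = z ^ n * c"
      by (rule power_commuting_commutes[OF cz[symmetric], symmetric])
    finally show ?case by (simp add: mult.assoc)
  qed simp
  show "(u * z) ^ n = u ^ n * z ^ n * c ^ (n * (n - 1) div 2)"
  proof (induction n)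
    case (Suc n)
    let ?t = "n * (n - 1) div 2"
    have "(u * z) ^ Suc n = u ^ n * z ^ n * (c ^ ?t * u * z)"
      by (simp only: power_Suc2 Suc mult.assoc)
    also have "c ^ ?t * u * z = u * z * c ^ ?t" by (simp add: cnu mult.assoc cnz)
    also have "u ^ n * z ^ n * (u * z * c ^ ?t) = u ^ n * (z ^ n * u) * z * c ^ ?t" by (simp add: mult.assoc)
    also have "\<dots> = u ^ n * (u * z ^ n * c ^ n) * z * c ^ ?t" by (simp only: 1)
    also have "\<dots> = (u ^ n * u) * (z ^ n * (c ^ n * z)) * c ^ ?t" by (simp add: mult.assoc)
    also have "\<dots> = u ^ Suc n * z ^ Suc n * (c ^ n * c ^ ?t)"
      by (simp only: cnz power_Suc2 mult.assoc)
    also have "c ^ n * c ^ ?t = c ^ (Suc n * (Suc n - 1) div 2)"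
    proof -
      have "Suc n * (Suc n - 1) = n * (n - 1) + n * 2" by (cases n) (simp_all add: algebra_simps)
      then have "Suc n * (Suc n - 1) div 2 = ?t + n" by (simp add: div_mult_self1)
      then show ?thesis by (simp add: add.commute flip: power_add)
    qed
    finally show ?case .
  qed simp
qed

lemma acts_as_p_coprime:
  fixes x :: "'a::mult_group"
  assumes p: "prime p" and q: "prime q" "q \<noteq> p" and H: "sg H" "x \<in> H"
    and x: "x ^ (q ^ m) = 1" "acts_as_p p V x"
  shows "x \<in> cen V"
proof -
  obtain k where k: "x ^ (p ^ k) \<in> cen V" using x by (auto simp: acts_as_p_def)
  have "x ^ (p ^ k) \<in> H \<inter> cen V" using k sg_power[OF H] by blast
  moreover have "x ^ (q ^ m) \<in> H \<inter> cen V" using x sg_one[OF sg_cen[OF H(1)], of V] by simp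
  moreover have "coprime (p ^ k) (q ^ m)" using primes_coprime[OF p q(1)] q(2) by simp
  ultimately have "x \<in> H \<inter> cen V" using pow_coprime_mem[OF sg_cen[OF H(1)]] by blast
  then show ?thesis by blast
qed

lemma cyc_psg:
  fixes x :: "'a::mult_group"
  assumes q: "prime q" and H: "sg H" "x \<in> H" and x: "x ^ (q ^ m) = 1"
  shows "psg q (cyc x)"
proof -
  have c: "sg (cyc x)" using cyc_sg[OF H] .
  have "card (cyc x) dvd q ^ m" using cyc_card[OF c] x by blast
  then show ?thesis using c divides_primepow_nat[OF q] unfolding psg_def by blast
qed

lemma cyc_power_prime:
  fixes y :: "'a::mult_group"
  assumes p: "prime p" and c: "sg (cyc y)" "card (cyc y) = p ^ Suc d"
  shows "sg (cyc (y ^ p))" "cyc (y ^ p) \<subseteq> cyc y" "card (cyc (y ^ p)) = p ^ d"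
proof -
  have yp: "y ^ p \<in> cyc y" by (simp add: cyc_def)
  show cp: "sg (cyc (y ^ p))" "cyc (y ^ p) \<subseteq> cyc y" using cyc_sg[OF c(1) yp] cyc_sub[OF c(1) yp] .
  have "card (cyc (y ^ p)) dvd n \<longleftrightarrow> p ^ d dvd n" for n
  proof -
    have "card (cyc (y ^ p)) dvd n \<longleftrightarrow> y ^ (p * n) = 1" using cyc_card[OF cp(1), of n] by (simp add: power_mult)
    also have "\<dots> \<longleftrightarrow> p ^ Suc d dvd p * n" using cyc_card[OF c(1), of "p * n"] c(2) by simp
    also have "\<dots> \<longleftrightarrow> p ^ d dvd n" using prime_gt_0_nat[OF p] by simp
    finally show ?thesis .
  qed
  then show "card (cyc (y ^ p)) = p ^ d" by (metis dvd_antisym dvd_refl)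
qed

text \<open>Induction along the chain \<open>cyc w\<close>, \<open>cyc (w ^ p)\<close>, and so on:
  each term is normal in \<open>H\<close> with index \<open>p\<close> in the one before, so the
  residual is trivial on the factors, and its q-elements are trivial on \<open>U\<close> by coprime
  action.\<close>

lemma res_acts_as_p_cyclic:
  fixes U :: "'a::mult_group set"
  assumes p: "prime p" and U: "nm U H" "U = cyc w" "card U = p ^ k"
  shows "res_acts_as_p p H U"
  using U
proof (induction k arbitrary: U w)
  case 0
  then have "U = {1}" using card_1_singletonE sg_one[OF nm_sg1] by (metis power_0 singletonD)
  then have "r ^ (p ^ 0) \<in> cen U" for r by (auto intro: cenI)
  then show ?case unfolding res_acts_as_p_def acts_as_p_def by blast
next
  case (Suc d)
  note U = Suc.prems
  have H: "sg H" "sg U" using nm_sg1[OF U(1)] nm_sg2[OF U(1)] by auto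
  let ?V = "cyc (w ^ p)"
  have V: "sg ?V" "?V \<subseteq> U" "card ?V = p ^ d"
    using cyc_power_prime[OF p, of w d] H(2) U(2,3) by auto
  have nV: "nm ?V H"
    unfolding nm_def
  proof (intro conjI ballI V(1) H(1))
    show "?V \<subseteq> H" using V(2) nm_sub[OF U(1)] by blast
    fix h v assume h: "h \<in> H" and v: "v \<in> ?V"
    have "cj h w \<in> cyc w" using nm_cj[OF U(1) h, of w] U(2) cyc_self by blast
    then obtain c where c: "cj h w = w ^ c" by (auto simp: cyc_def)
    obtain i where "v = (w ^ p) ^ i" using v by (auto simp: cyc_def)
    then have "cj h v = (w ^ p) ^ (c * i)"
      by (simp add: cj_power c mult.commute mult.left_commute flip: power_mult)
    then show "cj h v \<in> ?V" by (simp add: cyc_def)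
  qed
  show ?case
  proof (rule ccontr)
    assume "\<not> res_acts_as_p p H U"
    then obtain r where r: "r \<in> residual p H" "\<not> acts_as_p p U r" unfolding res_acts_as_p_def by blast
    have rH: "r \<in> H" using r(1) residual_sub[OF H(1)] by blast
    obtain q j m where q: "prime q" "q \<noteq> p" and x: "(r ^ j) ^ (q ^ m) = 1" "r ^ j \<notin> cen U"
      using not_pact_q_element[OF p H(1) rH r(2)] .
    have xR: "r ^ j \<in> residual p H" using sg_power[OF nm_sg1[OF residual_nm[OF H(1)]] r(1)] .
    have "acts_as_p p ?V (r ^ j)" using Suc.IH[OF nV refl V(3)] xR by (simp add: res_acts_as_p_def)
    then have xV: "r ^ j \<in> cen ?V"
      using acts_as_p_coprime[OF p q H(1) sg_power[OF H(1) rH] x(1)] by blast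
    have "coprime (q ^ m) (card ?V)" using primes_coprime[OF q(1) p q(2)] V(3) by simp
    moreover have "card U = p * card ?V" using U(3) V(3) by simp
    ultimately have "r ^ j \<in> cen U"
      using triv_ext[OF V(1) x(1) _ residual_trivial[OF p U(1) nV V(2) _ xR] xV] by blast
    then show False using x(2) by blast
  qed
qed

text \<open>An element \<open>y\<close> outside the only subgroup \<open>V\<close> of index
  \<open>p\<close> lies in no maximal subgroup, so it generates \<open>B\<close>; then
  \<open>y ^ p\<close> generates \<open>V\<close>.\<close>

lemma unique_maximal_cyclic:
  fixes B :: "'a::mult_group set"
  assumes p: "prime p" and B: "psg p B" "card B = p ^ Suc d"
    and V: "sg V" "V \<subseteq> B" and uniq: "\<And>A. sg A \<Longrightarrow> A \<subseteq> B \<Longrightarrow> card A = p ^ d \<Longrightarrow> A = V" and cV: "card V = p ^ d"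
  shows "\<exists>v. V = cyc v"
proof -
  have sB: "sg B" using psg_sg[OF B(1)] .
  have "V \<noteq> B" using B(2) cV prime_gt_1_nat[OF p] by auto
  then obtain y where y: "y \<in> B" "y \<notin> V" using V by blast
  have c: "sg (cyc y)" "cyc y \<subseteq> B" using cyc_sg[OF sB y(1)] cyc_sub[OF sB y(1)] .
  have cB: "cyc y = B"
  proof (rule ccontr)
    assume "cyc y \<noteq> B"
    then have "cyc y \<subset> B" using c by blast
    then obtain W where W: "nm W B" "cyc y \<subseteq> W" "card B = p * card W"
      using pgroup_maximal[OF p B(1) c(1)] by metis
    have "card W = p ^ d" using W(3) B(2) prime_gt_0_nat[OF p] by simp
    then have "W = V" using uniq[OF nm_sg1[OF W(1)] nm_sub[OF W(1)]] by blast
    then show False using W(2) cyc_self[of y] y(2) by blast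
  qed
  have cp: "sg (cyc (y ^ p))" "cyc (y ^ p) \<subseteq> B" "card (cyc (y ^ p)) = p ^ d"
    using cyc_power_prime[OF p c(1), of d] cB B(2) by auto
  then have "cyc (y ^ p) = V" using uniq[OF cp] by blast
  then show ?thesis by blast
qed

text \<open>After the key step with \<open>S = P\<close>, the aim is a subgroup with the
  cover-avoidance property that meets \<open>U\<close> outside \<open>V\<close> but lies in some
  \<open>V'\<close> with \<open>card V' = p * card V\<close>; it can neither avoid nor cover the
  factor, whose order is not \<open>p\<close>.\<close>

theorem res_acts_as_p_of_large_normal:
  fixes P :: "'a::mult_group set"
  assumes p: "prime p" and h: "cap_hyp p d H" and H: "sg H"
    and P: "psg p P" "nm P H" "p ^ d < card P"
  shows "res_acts_as_p p H P"
  using P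
proof (induction "card P" arbitrary: P rule: less_induct)
  case less
  note P = less.prems
  have sP: "sg P" "P \<subseteq> H" using P nmD by blast+
  have cap: "cap_in p H A" if "psg p A" "A \<subseteq> H" "card A = p ^ d" for A
    using h that scapD[OF _ H] unfolding cap_hyp_def by blast
  show ?case
  proof (rule ccontr)
    assume "\<not> res_acts_as_p p H P"
    then obtain r where r: "r \<in> residual p H" "\<not> acts_as_p p P r" unfolding res_acts_as_p_def by blast
    have rH: "r \<in> H" using r(1) residual_sub[OF H] by blast
    obtain q j m where q: "prime q" "q \<noteq> p" and "(r ^ j) ^ (q ^ m) = 1" "r ^ j \<notin> cen P"
      using not_pact_q_element[OF p H rH r(2)] .
    then obtain x where x: "x = r ^ j" "x ^ (q ^ m) = 1" "x \<notin> cen P" by blast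
    have xR: "x \<in> residual p H" using x(1) sg_power[OF nm_sg1[OF residual_nm[OF H]] r(1)] by simp
    have xH: "x \<in> H" using xR residual_sub[OF H] by blast
    have xc: "x \<in> cen V" if "res_acts_as_p p H V" for V
      using acts_as_p_coprime[OF p q H xH x(2)] that xR unfolding res_acts_as_p_def by blast
    have Y: "psg q (cyc x)" "cyc x \<subseteq> residual p H" "cyc x \<subseteq> H"
      using cyc_psg[OF q(1) H xH x(2)] cyc_sub[OF nm_sg1[OF residual_nm[OF H]] xR] cyc_sub[OF H xH] by blast+
    have sc: "sg (P \<inter> cen (cyc x))" using sg_cen[OF sP(1)] .
    have "P \<inter> cen (cyc x) \<subset> P"
    proof -
      have "\<not> P \<subseteq> cen (cyc x)"
      proof
        assume "P \<subseteq> cen (cyc x)"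
        then have "x \<in> cen P" using cyc_self[of x] unfolding cen_def by (auto simp: cj_eq_iff)
        then show False using x(3) by simp
      qed
      then show ?thesis by blast
    qed
    then obtain W where W: "nm W P" "P \<inter> cen (cyc x) \<subseteq> W" "card P = p * card W"
      using pgroup_maximal[OF p P(1) sc] by metis
    have PW: "\<not> P \<subseteq> W"
    proof
      assume "P \<subseteq> W"
      then have "card P \<le> card W" using card_mono[OF sg_finite[OF nm_sg1[OF W(1)]]] by blast
      then show False using W(3) sg_card_pos[OF nm_sg1[OF W(1)]] prime_gt_1_nat[OF p] by simp
    qed
    have "\<exists>U V. chief H U V \<and> U \<subseteq> P \<and> V \<subset> P \<and> p ^ d \<le> card V \<and> card U \<noteq> p * card V \<and>
        (\<exists>y\<in>cyc x. \<exists>u\<in>U. \<not> cg V u (cj y u))"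
      by (rule critical_chief_factor[OF p H cap P(1,2) P(1) subset_refl sP(2) P(3) W(1,3) PW q Y(1,2) W(2)])
        (assumption | blast)+
    then obtain U V where c: "chief H U V" and UP: "U \<subseteq> P" and VP: "V \<subset> P" and dV: "p ^ d \<le> card V"
      and ne: "card U \<noteq> p * card V" and act: "\<exists>y\<in>cyc x. \<exists>u\<in>U. \<not> cg V u (cj y u)"
      by blast
    note U = chief_nm1[OF c] and V = chief_nm2[OF c] and VU = chief_sub[OF c]
    have sU: "sg U" "sg V" using U V nmD by blast+
    have UH: "U \<subseteq> H" using U nm_sub by blast
    have pU: "psg p U" "psg p V" using psg_sub[OF p P(1)] sU UP VP by auto
    have ncov: "\<not> U \<subseteq> sp V A" if "sg A" "A \<subseteq> V'" "sg V'" "V \<subseteq> V'" "V' \<subseteq> U" "card V' = p * card V" for A V'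
    proof
      assume "U \<subseteq> sp V A"
      then have "U = V'" using sp_least[OF that(3,4,2)] that(5) by blast
      then show False using ne that(6) by simp
    qed
    \<comment> \<open>Above \<open>p ^ d\<close> the induction hypothesis applies to
      \<open>V\<close>. If \<open>card V = p ^ d\<close>, then \<open>V\<close> is the only subgroup
      of its order in some \<open>V'\<close> above it, hence cyclic, and
      \<open>res_acts_as_p_cyclic\<close> applies.\<close>
    have xV: "x \<in> cen V"
    proof (cases "card V = p ^ d")
      case False
      then have "p ^ d < card V" using dV by simp
      moreover have "card V < card P" using psubset_card_mono[OF sg_finite[OF sP(1)] VP] .
      ultimately show ?thesis using less.hyps[OF _ pU(2) V] xc by blast
    next
      case True
      have "V \<subset> U" using VU chief_ne[OF c] by blast
      then obtain V' where V': "sg V'" "nm V V'" "V \<subset> V'" "V' \<subseteq> U" "card V' = p * card V"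
        using pgroup_step[OF p pU(1) sU(2)] by metis
      have pV': "psg p V'" using psg_sub[OF p pU(1) V'(1,4)] .
      have uniq: "A = V" if A: "sg A" "A \<subseteq> V'" "card A = p ^ d" for A
      proof (rule ccontr)
        assume "A \<noteq> V"
        then have "\<not> A \<subseteq> V" using card_subset_eq[OF sg_finite[OF sU(2)]] A(3) True by metis
        then obtain a where a: "a \<in> A" "a \<notin> V" by blast
        have pA: "psg p A" using psg_sub[OF p pV' A(1,2)] .
        have "cap_in p H A" using cap[OF pA _ A(3)] A(2) V'(4) UH by blast
        then show False
          using cap_contra[OF p c pU(1) _ a(1) _ a(2)] ncov[OF A(1,2) V'(1) _ V'(4,5)] a(1) A(2) V'(3,4) by blast
      qed
      have "card V' = p ^ Suc d" "V \<subseteq> V'" using V'(3,5) True by auto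
      then obtain v where "V = cyc v"
        using unique_maximal_cyclic[OF p pV' _ sU(2) _ uniq True] by blast
      then have "res_acts_as_p p H V" using res_acts_as_p_cyclic[OF p V] True by blast
      then show ?thesis using xc by blast
    qed
    have ex1: "\<exists>u\<in>U. \<not> cg V u (cj x u)"
    proof (rule ccontr)
      assume "\<not> ?thesis"
      then have "x \<in> {r \<in> H. \<forall>u\<in>U. cg V u (cj r u)}" using xH by blast
      then have "cyc x \<subseteq> {r \<in> H. \<forall>u\<in>U. cg V u (cj r u)}"
        by (rule cyc_sub[OF nm_sg1[OF nm_kernel[OF U V]]])
      then show False using act by blast
    qed
    then obtain u1 where u1: "u1 \<in> U" "\<not> cg V u1 (cj x u1)" by blast
    let ?U2 = "U \<inter> cen V"
    have U2: "nm ?U2 H" using nm_cen[OF V U] .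
    have xu1: "cj x u1 \<in> U" using nm_cj[OF U xH u1(1)] .
    \<comment> \<open>The commutator \<open>t\<close> of \<open>x\<close> and \<open>u1\<close>
      centralizes \<open>V\<close> because \<open>x\<close> does and \<open>u1\<close> normalizes
      \<open>V\<close>. As \<open>t\<close> lies outside \<open>V\<close>, the centralizer of
      \<open>V\<close> in \<open>U\<close> supplements \<open>V\<close> in \<open>U\<close>.\<close>
    define t where "t = cj x u1 * iv u1"
    have tU: "t \<in> U" using xu1 u1 sU by (simp add: t_def sg_mult sg_iv)
    have tV: "t \<notin> V"
    proof
      assume "t \<in> V"
      then have "cj (iv u1) t \<in> V" using nm_cj[OF V] u1(1) UH sg_iv[OF H] by blast
      then show False using u1(2) by (simp add: t_def cg_def cj_def mult.assoc)
    qed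
    have tc: "t \<in> cen V"
    proof (rule cenI)
      fix v assume v: "v \<in> V"
      have w: "cj (iv u1) v \<in> V" using nm_cj[OF V _ v] u1(1) UH sg_iv[OF H] by blast
      have "cj (iv (cj x u1)) (cj x v) = cj x (cj (iv u1) v)" by (simp add: cj_def mult.assoc)
      then have "cj (iv (cj x u1)) v = cj (iv u1) v" using cenD[OF xV v] cenD[OF xV w] by simp
      then have "cj (cj x u1) (cj (iv u1) v) = v" by (metis cj_iv_cj(2))
      then show "cj t v = v" by (simp add: t_def flip: cj_cj)
    qed
    have "nm (sp V ?U2) H" using sp_nm[OF V U2] .
    then have spU: "sp V ?U2 = U"
      by (rule chief_top[OF c, of _ t])
        (use tU tV tc sp_sub1[OF sg_one[OF nm_sg1[OF U2]], of V] sp_sub2[OF sg_one[OF sU(2)], of ?U2]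
          sp_least[OF sU(1) VU, of ?U2] in auto)
    \<comment> \<open>In \<open>u1 = v * u2\<close> the factor \<open>v\<close> is fixed by
      \<open>x\<close>, so \<open>u2\<close> has the same displacement as \<open>u1\<close>.\<close>
    obtain u where u: "u \<in> ?U2" "\<not> cg V u (cj x u)"
    proof -
      obtain v u2 where vu: "v \<in> V" "u2 \<in> ?U2" "u1 = v * u2" using u1(1) spU by (metis spE)
      have "iv u1 * cj x u1 = iv u2 * cj x u2" using cenD[OF xV vu(1)] by (simp add: vu(3) cj_mult mult.assoc)
      then show ?thesis using that[OF vu(2)] u1(2) by (simp add: cg_def)
    qed
    define z where "z = iv u * cj x u"
    have zV: "z \<notin> V" using u(2) by (simp add: z_def cg_def)
    have zU2: "z \<in> ?U2" unfolding z_def using nm_comm[OF U2 xH u(1)] .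
    have xu: "cj x u = u * z" by (simp add: z_def)
    have exp: "w ^ p \<in> V" if "w \<in> U" for w using chief_exponent[OF p P(1,2) c UP that] .
    have zpV: "z ^ p \<in> V" "u ^ p \<in> V" using exp zU2 u(1) by auto
    \<comment> \<open>\<open>x\<close> sends \<open>u\<close> to \<open>u * z\<close> and fixes
      \<open>u ^ p\<close>, which lies in \<open>V\<close>.\<close>
    have up: "(u * z) ^ p = u ^ p" using cenD[OF xV zpV(2)] by (simp add: cj_power xu)
    \<comment> \<open>Comparing \<open>(u * z) ^ p\<close> with \<open>u ^ p\<close> gives
      \<open>z ^ p = 1\<close> if \<open>u\<close> and \<open>z\<close> commute. For odd
      \<open>p\<close> the correction is a commutator in \<open>V\<close> with trivial p-th power,
      raised to \<open>p * (p - 1) div 2\<close>, a multiple of \<open>p\<close>.\<close>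
    have zord: "z ^ p = 1" if "odd p \<or> u * z = z * u"
      using that
    proof
      assume "u * z = z * u"
      then have "(u * z) ^ p = u ^ p * z ^ p"
        using power_mult_class2(2)[of z u 1 p] by simp
      then show ?thesis using up by (metis mult_left_cancel_iff mult_1_right)
    next
      assume odd: "odd p"
      define e where "e = iv (u * z) * (z * u)"
      have zu: "z * u = u * z * e" by (simp add: e_def mult.assoc)
      have "e \<in> V" using chief_abelian[OF p P(1,2) c UP, of u z] u zU2 by (simp add: e_def cg_def)
      then have eu: "e * u = u * e" "e * z = z * e" using cen_comm u(1) zU2 by fastforce+
      have "z ^ p * u = u * z ^ p" using cen_comm[of u V "z ^ p"] u(1) zpV by auto
      moreover have "z ^ p * u = u * z ^ p * e ^ p" using power_mult_class2(1)[OF zu eu] .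
      ultimately have ep: "e ^ p = 1" by (metis mult_left_cancel_iff mult_1_right)
      obtain i where i: "p - 1 = 2 * i" using odd by (auto elim: oddE)
      have "p * (p - 1) div 2 = p * i" unfolding i by simp
      then have "e ^ (p * (p - 1) div 2) = 1" using ep by (simp add: power_mult)
      then have "(u * z) ^ p = u ^ p * z ^ p" using power_mult_class2(2)[OF zu eu, of p] by simp
      then show ?thesis using up by (metis mult_left_cancel_iff mult_1_right)
    qed
    have zH: "z \<in> H" and zU: "z \<in> U" using zU2 UH by auto
    have d: "0 < d" using h by (simp add: cap_hyp_def)
    have zd: "z ^ (p ^ d) = 1" if "z ^ p = 1"
    proof -
      have "p ^ d = p * p ^ (d - 1)" using d by (metis Suc_diff_1 power_Suc)
      then show ?thesis using that by (simp add: power_mult)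
    qed
    \<comment> \<open>For \<open>p = 2\<close> and noncommuting elements, the third alternative of
      \<open>cap_hyp\<close> takes the place of \<open>z ^ p = 1\<close>.\<close>
    have alt: "z ^ (p ^ d) = 1 \<or> strong_cap p H (cyc z)"
    proof -
      consider "odd p" | "\<forall>Q. psg p Q \<and> Q \<subseteq> H \<longrightarrow> (\<forall>a\<in>Q. \<forall>b\<in>Q. a * b = b * a)"
        | "\<forall>y\<in>H. \<forall>k. y ^ (p ^ k) = 1 \<longrightarrow> y ^ (p ^ d) = 1 \<or> strong_cap p H (cyc y)"
        using h unfolding cap_hyp_def by blast
      then show ?thesis
      proof cases
        case 1
        then show ?thesis using zd zord by blast
      next
        case 2
        then have "u * z = z * u" using pU(1) UH u(1) zU by blast
        then show ?thesis using zd zord by blast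
      next
        case 3
        obtain k where "z ^ (p ^ k) = 1" using psg_pow[OF pU(1)] zU by metis
        then show ?thesis using 3 zH by blast
      qed
    qed
    have nVU: "nm V U" using nm_subgroup[OF V sU(1) VU UH] .
    \<comment> \<open>\<open>V'\<close> is \<open>V\<close> with \<open>z\<close> adjoined; the
      contradiction comes from \<open>cyc z\<close> itself or from a subgroup of order
      \<open>p ^ d\<close> between \<open>cyc z\<close> and \<open>V'\<close>.\<close>
    obtain V' where V': "sg V'" "nm V V'" "V' \<subseteq> U" "z \<in> V'" "card V' = p * card V"
      using adjoin[OF p nVU zU zV zpV(1)] .
    have VV': "V \<subseteq> V'" using nm_sub[OF V'(2)] .
    have cz: "sg (cyc z)" "cyc z \<subseteq> V'" using cyc_sg[OF V'(1,4)] cyc_sub[OF V'(1,4)] .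
    have fin: False if "cap_in p H A" "z \<in> A" "sg A" "A \<subseteq> V'" for A
      using cap_contra[OF p c pU(1) that(1,2) zU zV] ncov[OF that(3,4) V'(1) VV' V'(3,5)] by blast
    show False
      using alt
    proof
      assume "strong_cap p H (cyc z)"
      then show False using fin[OF _ cyc_self cz] scapD[OF _ H] cyc_sub[OF H zH] by blast
    next
      assume "z ^ (p ^ d) = 1"
      then have "card (cyc z) dvd p ^ d" using cyc_card[OF cz(1)] by blast
      then have "card (cyc z) \<le> p ^ d" using prime_gt_0_nat[OF p] by (simp add: dvd_imp_le)
      moreover have "p ^ d \<le> card V'" using dV V'(5) prime_gt_0_nat[OF p]
        by (metis One_nat_def Suc_leI le_trans mult.commute mult_le_mono2 nat_mult_1_right)
      moreover have pV': "psg p V'" using psg_sub[OF p pU(1) V'(1,3)] .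
      ultimately obtain A where A: "sg A" "cyc z \<subseteq> A" "A \<subseteq> V'" "card A = p ^ d"
        using pgroup_between[OF p pV' cz] by metis
      have "cap_in p H A" using cap[OF psg_sub[OF p pV' A(1,3)] _ A(4)] A(3) V'(3) UH by blast
      then show False using fin[OF _ _ A(1,3)] A(2) cyc_self[of z] by blast
    qed
  qed
qed

section \<open>Normalizers of p-subgroups\<close>

definition normalizer_in :: "'a::mult_group set \<Rightarrow> 'a set \<Rightarrow> 'a set" where
  "normalizer_in G Q = {g \<in> G. cj g ` Q = Q}"

lemma normalizer_in_sg: "sg G \<Longrightarrow> sg (normalizer_in G Q)"
  unfolding normalizer_in_def by (rule sg_normalizer)

lemma normalizer_in_sub: "normalizer_in G Q \<subseteq> G"
  by (auto simp: normalizer_in_def)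

lemma normalizer_in_nm: "sg Q \<Longrightarrow> sg G \<Longrightarrow> Q \<subseteq> G \<Longrightarrow> nm Q (normalizer_in G Q)"
  unfolding normalizer_in_def by (rule nm_normalizer)

lemma nrmD: "g \<in> normalizer_in G Q \<Longrightarrow> cj g ` Q = Q"
  by (simp add: normalizer_in_def)

definition loc_res_act_as_p :: "nat \<Rightarrow> 'a::mult_group set \<Rightarrow> bool" where
  "loc_res_act_as_p p G \<longleftrightarrow> (\<forall>Q. psg p Q \<and> Q \<subseteq> G \<longrightarrow> res_acts_as_p p (normalizer_in G Q) Q)"

text \<open>An element of \<open>L\<close> brings the conjugate of \<open>Y\<close> by
  \<open>g\<close> back to \<open>Y\<close>; this is the factorization of \<open>G\<close> in
  elementwise form.\<close>

lemma frattini: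
  fixes L :: "'a::mult_group set"
  assumes q: "prime q" and L: "nm L G" and Y: "is_sylow q Y L" and g: "g \<in> G"
  obtains l where "l \<in> L" "l * g \<in> normalizer_in G Y"
proof -
  have sgs: "sg L" "sg G" "L \<subseteq> G" "Y \<subseteq> L" "sg Y" "psg q Y" using L Y by (auto simp: nm_def is_sylow_def psg_def)
  have "cj g ` Y \<subseteq> L" using nm_cj[OF L g] sgs(4) by blast
  then obtain l where l: "l \<in> L" "cj l ` cj g ` Y \<subseteq> Y"
    using sylow_conj[OF q Y psg_cj[OF sgs(6)]] by metis
  then have "cj (l * g) ` Y \<subseteq> Y" by (simp add: cj_image_cj)
  then have "cj (l * g) ` Y = Y" using cj_subset_eq sg_finite[OF sgs(5)] by blast
  then have "l * g \<in> normalizer_in G Y" using l g sgs by (auto simp: normalizer_in_def sg_mult)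
  then show ?thesis using that l by blast
qed

lemma psg_coprime_Int:
  fixes A :: "'a::mult_group set"
  assumes "prime p" "prime q" "p \<noteq> q" "psg p A" "psg q B" "x \<in> A" "x \<in> B"
  shows "x = 1"
proof -
  obtain i where i: "x ^ (p ^ i) = 1" using psg_pow[OF assms(4)] assms(6) by metis
  obtain j where j: "x ^ (q ^ j) = 1" using psg_pow[OF assms(5)] assms(7) by metis
  show ?thesis using pow_coprime_one[OF i j] primes_coprime[OF assms(1,2,3)] by simp
qed

lemma cen_commute: "A \<subseteq> cen B \<longleftrightarrow> B \<subseteq> cen A" for A B :: "'a::mult_group set"
  unfolding cen_def by (auto simp: cj_eq_iff)

text \<open>The key step is applied with \<open>S = sp P T0\<close>, where \<open>T0\<close> is a
  Sylow p-subgroup of the normalizer of a Sylow q-subgroup \<open>Y0\<close> of \<open>L\<close>. It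
  yields a proper subgroup of \<open>P\<close> of order at least \<open>p ^ d\<close>, which is
  impossible.\<close>

lemma no_noncentral_q_element:
  fixes G :: "'a::mult_group set"
  assumes p: "prime p" and h: "cap_hyp p d G" and G: "sg G"
    and S0: "psg p S0" "S0 \<subseteq> G" "p ^ d < card S0"
    and L: "nm L G" and P: "is_sylow p P L" "nm P G" "card P \<le> p ^ d"
    and q: "prime q" "q \<noteq> p" and y: "y \<in> L" "y \<in> residual p G" "y ^ (q ^ m) = 1"
  shows "y \<in> cen P"
proof (rule ccontr)
  assume yP: "y \<notin> cen P"
  have sgs: "sg L" "L \<subseteq> G" "psg p P" "sg P" "P \<subseteq> L" "P \<subseteq> G"
    using L P by (auto simp: nm_def is_sylow_def psg_def)
  obtain Y0 where Y0: "is_sylow q Y0 L" "cyc y \<subseteq> Y0"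
    using is_sylow_contains[OF q(1) sgs(1) cyc_psg[OF q(1) sgs(1) y(1,3)] cyc_sub[OF sgs(1) y(1)]] .
  have Y0': "psg q Y0" "sg Y0" "Y0 \<subseteq> L" using Y0(1) by (auto simp: is_sylow_def psg_def)
  let ?N = "normalizer_in G Y0"
  have N: "sg ?N" "?N \<subseteq> G" using normalizer_in_sg[OF G] normalizer_in_sub .
  obtain T0 where T0: "is_sylow p T0 ?N" using is_sylow_exists[OF p N(1)] .
  have T0': "psg p T0" "sg T0" "T0 \<subseteq> ?N" "T0 \<subseteq> G" using T0 N by (auto simp: is_sylow_def psg_def)
  let ?S = "sp P T0"
  have S: "sg ?S" "?S \<subseteq> G" "P \<subseteq> ?S"
    using sp_nm_sg[OF P(2) T0'(2,4)] sp_least[OF G sgs(6) T0'(4)] sp_sub1[OF sg_one[OF T0'(2)]] .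
  have pS: "psg p ?S" using psg_sp[OF p sgs(3) T0'(1) S(1)] .
  have "G \<subseteq> sp L ?N"
  proof
    fix g assume g: "g \<in> G"
    obtain l where l: "l \<in> L" "l * g \<in> ?N" using frattini[OF q(1) L Y0(1) g] .
    have "iv l * (l * g) \<in> sp L ?N" using l sgs(1) by (intro spI) (auto intro: sg_iv)
    then show "g \<in> sp L ?N" by simp
  qed
  then have LN: "sp L ?N = G" using sp_least[OF G sgs(2) N(2)] by blast
  \<comment> \<open>By the Frattini factorization \<open>card G\<close> divides
    \<open>card ?S\<close> times a number prime to \<open>p\<close>, so no p-subgroup of
    \<open>G\<close> is larger than \<open>?S\<close>.\<close>
  have cardS: "card S0 \<le> card ?S"
  proof -
    have i: "sg (P \<inter> T0)" "sg (L \<inter> ?N)" using sg_Int sgs T0' N by blast+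
    have "P \<inter> T0 \<subseteq> L \<inter> ?N" using sgs T0' by blast
    then obtain a where a: "card (L \<inter> ?N) = card (P \<inter> T0) * a" using dvdE[OF sg_dvd[OF i(2,1)]] by blast
    obtain l where l: "card L = card P * l" using sg_dvd[OF sgs(1,4,5)] by auto
    obtain n where n: "card ?N = card T0 * n" using sg_dvd[OF N(1) T0'(2,3)] by auto
    have "\<not> p dvd l" using P(1) l sg_card_pos[OF sgs(4)] by (simp add: is_sylow_def)
    moreover have "\<not> p dvd n" using T0 n sg_card_pos[OF T0'(2)] by (simp add: is_sylow_def)
    ultimately have nd: "\<not> p dvd l * n" using p by (simp add: prime_dvd_mult_iff)
    have "card G * card (L \<inter> ?N) = card L * card ?N" using card_sp[OF sgs(1) N(1)] LN by simp
    then have "card G * a * card (P \<inter> T0) = (card P * card T0) * (l * n)" using a l n by (simp add: ac_simps)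
    also have "\<dots> = card ?S * (l * n) * card (P \<inter> T0)" using card_sp[OF sgs(4) T0'(2)] by (simp add: ac_simps)
    finally have "card G * a = card ?S * (l * n)" using sg_card_pos[OF i(1)] by simp
    then have dv: "card S0 dvd card ?S * (l * n)" using sg_dvd[OF G psg_sg[OF S0(1)] S0(2)] by (metis dvd_mult2)
    obtain s where s: "card S0 = p ^ s" using S0 by (auto simp: psg_def)
    have "coprime (card S0) (l * n)" using prime_imp_coprime[OF p nd] s by (metis coprime_power_left_iff)
    then have "card S0 dvd card ?S" using dv by (simp add: coprime_dvd_mult_left_iff)
    then show ?thesis using sg_card_pos[OF S(1)] by (simp add: dvd_imp_le)
  qed
  \<comment> \<open>Intersecting with the residual keeps \<open>y\<close> and the invariance under
    \<open>T0\<close>, and provides a q-group inside the residual for the key step.\<close>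
  let ?Y = "Y0 \<inter> residual p G"
  have R: "nm (residual p G) G" using residual_nm[OF G] .
  have Ys: "sg ?Y" using sg_Int[OF Y0'(2) nm_sg1[OF R]] .
  have pY: "psg q ?Y" using psg_sub[OF q(1) Y0'(1) Ys] by blast
  have yY: "y \<in> ?Y" using Y0(2) cyc_self[of y] y(2) by blast
  have nY: "cj t ` ?Y = ?Y" if "t \<in> T0" for t
  proof (rule cj_subset_eq[OF sg_finite[OF Ys]])
    have "cj t ` Y0 = Y0" using nrmD that T0'(3) by blast
    then show "cj t ` ?Y \<subseteq> ?Y" using nm_cj[OF R] that T0'(4) by blast
  qed
  \<comment> \<open>Commutators of \<open>P \<inter> T0\<close> with \<open>?Y\<close> lie in the
    normal subgroup \<open>P\<close> and in \<open>Y0\<close>, which \<open>T0\<close> normalizes; a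
    p-group and a q-group meet trivially.\<close>
  have PT: "P \<inter> T0 \<subseteq> cen ?Y"
  proof
    fix t assume t: "t \<in> P \<inter> T0"
    show "t \<in> cen ?Y"
    proof (rule cenI)
      fix y assume "y \<in> ?Y"
      then have yy: "y \<in> Y0" by simp
      have tY: "cj t y \<in> Y0" using yy nrmD[of t G Y0] t T0'(3) by blast
      have 1: "iv y * cj t y \<in> Y0" using tY yy Y0'(2) by (simp add: sg_mult sg_iv)
      have "cj (iv y) t \<in> P" using nm_cj[OF P(2)] t sg_iv[OF Y0'(2) yy] Y0'(3) sgs(2) by blast
      then have "cj (iv y) t * iv t \<in> P" using t sgs(4) by (simp add: sg_mult sg_iv)
      then have 2: "iv y * cj t y \<in> P" by (simp add: cj_def mult.assoc)
      have "iv y * cj t y = 1" using psg_coprime_Int[OF p q(1) _ sgs(3) Y0'(1) 2 1] q(2) by blast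
      then show "cj t y = y" by (metis iv_cancel_right mult_1_right)
    qed
  qed
  let ?W = "sp (P \<inter> cen ?Y) T0"
  have W: "sg ?W"
  proof (rule sp_sg[OF sg_cen[OF sgs(4)] T0'(2)])
    fix a b assume "a \<in> P \<inter> cen ?Y" "b \<in> T0"
    then show "cj b a \<in> P \<inter> cen ?Y"
      using cen_cj[OF nY[of b], of a] nm_cj[OF P(2), of b a] T0'(4) by auto
  qed
  have "?W \<subseteq> ?S" by (auto simp: sp_def)
  \<comment> \<open>Otherwise each element of \<open>P\<close> is a product of one centralizing
    \<open>?Y\<close> and one of \<open>P \<inter> T0\<close>, which centralizes it too, so
    \<open>y\<close> would centralize \<open>P\<close>.\<close>
  moreover have "?W \<noteq> ?S"
  proof
    assume eq: "?W = ?S"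
    have "P \<subseteq> cen ?Y"
    proof
      fix x assume x: "x \<in> P"
      then obtain a t where at: "a \<in> P \<inter> cen ?Y" "t \<in> T0" "x = a * t" using eq S(3) by (metis spE subsetD)
      have "t = iv a * x" using at by simp
      then have "t \<in> P" using x at(1) sgs(4) by (simp add: sg_mult sg_iv)
      then have "t \<in> cen ?Y" using PT at(2) by blast
      then show "x \<in> cen ?Y" using at cen_mult by blast
    qed
    then have "?Y \<subseteq> cen P" using cen_commute[of P ?Y] by simp
    then show False using yY yP by blast
  qed
  ultimately have "?W \<subset> ?S" by blast
  then obtain M where M: "nm M ?S" "?W \<subseteq> M" "card ?S = p * card M"
    using pgroup_maximal[OF p pS W] by metis
  have PM: "\<not> P \<subseteq> M"
  proof
    assume "P \<subseteq> M"
    moreover have "T0 \<subseteq> M" using M(2) sp_sub2[OF sg_one[OF sg_cen[OF sgs(4)]], of T0 ?Y] by blast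
    ultimately have "?S \<subseteq> M" using sp_least[OF nm_sg1[OF M(1)]] by blast
    then have "card ?S \<le> card M" using card_mono[OF sg_finite[OF nm_sg1[OF M(1)]]] by blast
    then show False using M(3) sg_card_pos[OF nm_sg1[OF M(1)]] prime_gt_1_nat[OF p] by simp
  qed
  have cY: "P \<inter> cen ?Y \<subseteq> M" using M(2) sp_sub1[OF sg_one[OF T0'(2)], of "P \<inter> cen ?Y"] by blast
  have big: "p ^ d < card ?S" using cardS S0(3) by simp
  have cap: "cap_in p G A" if "psg p A" "A \<subseteq> G" "card A = p ^ d" for A
    using h that scapD[OF _ G] unfolding cap_hyp_def by blast
  have "\<exists>V. V \<subset> P \<and> p ^ d \<le> card V"
    by (rule critical_chief_factor[OF p G cap sgs(3) P(2) pS S(3,2) big M(1,3) PM q pY _ cY])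
      (assumption | blast)+
  then obtain V where "V \<subset> P" "p ^ d \<le> card V" by blast
  then show False using psubset_card_mono[OF sg_finite[OF sgs(4)]] P(3) by (metis leD le_less_trans)
qed

section \<open>Passing between normalizers of p-subgroups\<close>

text \<open>With \<open>y = x ^ (p ^ k)\<close> trivial on \<open>B\<close>, write
  \<open>r ^ (p ^ k) = y * w\<close> with \<open>w\<close> in \<open>K\<close>. On \<open>B\<close>
  this acts like \<open>w\<close>, whose order there divides \<open>p ^ a\<close>.\<close>

lemma acts_as_p_cong:
  fixes K M :: "'a::mult_group set"
  assumes K: "nm K M" "\<And>x. x \<in> K \<Longrightarrow> x ^ (p ^ a) \<in> cen B" and B: "\<And>g. g \<in> M \<Longrightarrow> cj g ` B = B"
    and x: "x \<in> M" "acts_as_p p B x" and r: "r \<in> M" "cg K x r"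
  shows "acts_as_p p B r"
proof -
  obtain k where k: "x ^ (p ^ k) \<in> cen B" using x by (auto simp: acts_as_p_def)
  define y where "y = x ^ (p ^ k)"
  define w where "w = iv y * r ^ (p ^ k)"
  have w: "w \<in> K" using cg_power[OF K(1) x(1) r(1,2), of "p ^ k"] by (simp add: w_def y_def cg_def)
  have wB: "cj w b \<in> B" if "b \<in> B" for b using B[of w] w nm_sub[OF K(1)] that by blast
  have "\<forall>b\<in>B. cj ((y * w) ^ n) b = cj (w ^ n) b" for n
  proof (induction n)
    case (Suc n)
    show ?case
    proof
      fix b assume b: "b \<in> B"
      have "cj ((y * w) ^ Suc n) b = cj ((y * w) ^ n) (cj y (cj w b))"
        by (simp only: power_Suc2 cj_cj mult.assoc)
      also have "cj y (cj w b) = cj w b" using cenD[of y B] k wB[OF b] by (simp add: y_def)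
      also have "cj ((y * w) ^ n) (cj w b) = cj (w ^ n) (cj w b)" using Suc wB[OF b] by blast
      finally show "cj ((y * w) ^ Suc n) b = cj (w ^ Suc n) b" by (simp only: power_Suc2 cj_cj)
    qed
  qed simp
  then have "(y * w) ^ (p ^ a) \<in> cen B" using cenD[OF K(2)[OF w]] by (intro cenI) simp
  moreover have "y * w = r ^ (p ^ k)" by (simp add: w_def)
  ultimately have "r ^ (p ^ (k + a)) \<in> cen B" by (simp add: power_add power_mult)
  then show ?thesis unfolding acts_as_p_def by blast
qed

text \<open>Write \<open>j = u * c\<close> with \<open>u\<close> in \<open>P\<close> and
  \<open>c\<close> centralizing \<open>P\<close>; in the power \<open>card P\<close> the factor
  \<open>u\<close> disappears. Commutators of \<open>B\<close> with \<open>c\<close> lie in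
  \<open>B \<inter> J\<close>, hence in \<open>P\<close>, so \<open>c\<close> stabilizes the series
  formed by \<open>P\<close> and \<open>B\<close>.\<close>

lemma inner_acts_as_p_element:
  fixes J B :: "'a::mult_group set"
  assumes P: "psg p P" "P \<subseteq> J" and J: "nm J G" "J \<subseteq> sp P (cen P)"
    and B: "sg B" "P \<subseteq> B" "B \<subseteq> G" "B \<inter> J \<subseteq> P" and j: "j \<in> J" "cj j ` B = B"
  shows "j ^ card P \<in> cen B"
proof -
  obtain u c where uc: "u \<in> P" "c \<in> cen P" "j = u * c" using j(1) J(2) by (metis spE subsetD)
  have sJ: "sg J" "sg P" "sg G" using J P psg_sg nmD by blast+
  have "u ^ card P = 1" using sg_pow_card[OF sJ(2) uc(1)] .
  moreover have uc': "u * c = c * u" using cen_comm[OF uc(2,1)] by simp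
  have "(u * c) ^ n = u ^ n * c ^ n" for n
    using power_mult_class2(2)[of c u 1 n] uc' by simp
  ultimately have jc: "j ^ card P = c ^ card P" using uc(3) by simp
  have c: "c = iv u * j" using uc(3) by simp
  have cJ: "c \<in> J" unfolding c using uc(1) P(2) j(1) sJ(1) by (auto intro!: sg_mult sg_iv)
  have "c ^ card P \<in> cen B"
  proof (rule acts_as_p_ext[OF P(1) _ uc(2)])
    fix b assume b: "b \<in> B"
    have "cj j b \<in> B" using j(2) b by blast
    then have "cj c b \<in> B" using uc(1) B(1,2) sg_cj[OF B(1) sg_iv[OF B(1)], of u] by (auto simp: c simp flip: cj_cj)
    then have 1: "iv b * cj c b \<in> B" using b B(1) by (simp add: sg_mult sg_iv)
    have "cj (iv b) c \<in> J" using nm_cj[OF J(1) sg_iv[OF sJ(3)] cJ] b B(3) by blast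
    then have "cj (iv b) c * iv c \<in> J" using cJ sJ(1) by (simp add: sg_mult sg_iv)
    then have 2: "iv b * cj c b \<in> J" by (simp add: cj_def mult.assoc)
    show "cg P b (cj c b)" using 1 2 B(4) by (auto simp: cg_def)
  qed
  then show ?thesis using jc by simp
qed

text \<open>Two Frattini arguments, for \<open>T\<close> in \<open>sp J T\<close> and for
  \<open>B\<close> in a subgroup of the normalizer of \<open>T\<close>, factor the normalizer of
  \<open>B\<close> into its intersections with \<open>J\<close> and with the normalizer of
  \<open>T\<close>. The first acts on \<open>B\<close> by p-elements of bounded exponent; the
  residual of the second is given to act well.\<close>

lemma normalizer_controls_good:
  fixes G :: "'a::mult_group set"
  assumes p: "prime p" and G: "sg G"
    and J: "nm J G" "J \<subseteq> sp P (cen P)" and P: "is_sylow p P J" "nm P G"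
    and T: "sg T" "T \<subseteq> G" "nm (sp J T) G" "is_sylow p T (sp J T)"
    and B: "psg p B" "P \<subseteq> B" "B \<subseteq> normalizer_in G T"
    and gd: "res_acts_as_p p (normalizer_in (normalizer_in G T) B) B"
  shows "res_acts_as_p p (normalizer_in G B) B"
proof -
  let ?H = "normalizer_in G T" and ?M = "normalizer_in G B"
  let ?K = "J \<inter> ?M" and ?C = "normalizer_in ?H B"
  have sgs: "sg J" "J \<subseteq> G" "psg p P" "sg P" "P \<subseteq> J" "sg B" "B \<subseteq> G"
    using J P B by (auto simp: nm_def normalizer_in_def is_sylow_def psg_def)
  have H: "sg ?H" "?H \<subseteq> G" using normalizer_in_sg[OF G] normalizer_in_sub .
  have M: "sg ?M" "?M \<subseteq> G" using normalizer_in_sg[OF G] normalizer_in_sub .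
  have C: "sg ?C" "?C \<subseteq> ?M" using normalizer_in_sg[OF H(1)] H(2) by (auto simp: normalizer_in_def)
  have K: "nm ?K ?M" using nm_Int_subgroup[OF J(1) M] .
  have PJ: "nm P J" using nm_subgroup[OF P(2) sgs(1,5,2)] .
  have BJ: "B \<inter> J \<subseteq> P"
    using is_sylow_normal[OF p P(1) PJ psg_sub[OF p B(1) sg_Int[OF sgs(6,1)]]] by blast
  have MC: "?M \<subseteq> sp ?K ?C"
  proof
    fix g assume g: "g \<in> ?M"
    then have gG: "g \<in> G" using M by blast
    obtain l where l: "l \<in> sp J T" "l * g \<in> ?H" using frattini[OF p T(3,4) gG] .
    then obtain j t where jt: "j \<in> J" "t \<in> T" "l = j * t" by (metis spE)
    define j1 where "j1 = cj (iv t) (iv j)"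
    define h1 where "h1 = iv t * (l * g)"
    have tH: "t \<in> ?H" using nm_cj_eq[OF nm_refl[OF T(1)] jt(2)] jt(2) T(2) unfolding normalizer_in_def by blast
    have j1: "j1 \<in> J" unfolding j1_def
      using nm_cj[OF J(1) sg_iv[OF G] sg_iv[OF sgs(1)]] jt T(2) by blast
    have h1: "h1 \<in> ?H" unfolding h1_def using sg_mult[OF H(1) sg_iv[OF H(1) tH] l(2)] .
    have gj: "g = j1 * h1" by (simp add: j1_def h1_def jt(3) cj_def mult.assoc)
    \<comment> \<open>Since \<open>g\<close> normalizes \<open>B\<close>, the conjugate of
      \<open>B\<close> by \<open>h1\<close> is also its conjugate by \<open>iv j1\<close>, so it
      lies both in the normalizer of \<open>T\<close> and in \<open>J\<close> times
      \<open>B\<close>.\<close>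
    have e1: "cj h1 ` B = cj (iv j1) ` B"
    proof -
      have "cj (iv j1) ` cj g ` B = cj (iv j1) ` B" using nrmD[OF g] by simp
      then show ?thesis by (simp add: cj_image_cj gj)
    qed
    \<comment> \<open>\<open>B\<close> is a Sylow subgroup of \<open>?E\<close>, because it meets
      \<open>J \<inter> ?H\<close> in \<open>P\<close>, which is Sylow there.\<close>
    let ?E = "sp (J \<inter> ?H) B"
    have JH: "nm (J \<inter> ?H) ?H" using nm_Int_subgroup[OF J(1) H] .
    have E: "sg ?E" "B \<subseteq> ?E"
      using sp_nm_sg[OF JH sgs(6) B(3)] sp_sub2[OF sg_one[OF nm_sg1[OF JH]]] .
    have PH: "P \<subseteq> J \<inter> ?H" using sgs(5) B by blast
    have "B \<inter> (J \<inter> ?H) = P" using BJ PH B(2) by blast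
    then have cE: "card ?E * card P = card (J \<inter> ?H) * card B"
      using card_sp[OF nm_sg1[OF JH] sgs(6)] by (simp add: Int_commute)
    have "is_sylow p P (J \<inter> ?H)" using is_sylow_sub[OF P(1) nm_sg1[OF JH] PH] by blast
    then have nd: "\<not> p dvd card (J \<inter> ?H) div card P" by (simp add: is_sylow_def)
    obtain a where a: "card ?E = card B * a" using dvdE[OF sg_dvd[OF E(1) sgs(6) E(2)]] by blast
    then have "card (J \<inter> ?H) = a * card P" using cE sg_card_pos[OF sgs(6)] by (simp add: ac_simps)
    then have "\<not> p dvd a" using nd sg_card_pos[OF sgs(4)] by simp
    then have is_sylow: "is_sylow p B ?E" using a E B(1) sg_card_pos[OF sgs(6)] by (simp add: is_sylow_def)
    have hE: "cj h1 ` B \<subseteq> ?E"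
    proof
      fix w assume w: "w \<in> cj h1 ` B"
      then obtain b where b: "b \<in> B" "w = cj (iv j1) b" using e1 by auto
      have "cj h1 ` B \<subseteq> ?H" using B(3) h1 sg_cj[OF H(1)] by blast
      then have wH: "w \<in> ?H" using w by blast
      have "cj b j1 \<in> J" using nm_cj[OF J(1) _ j1] b(1) sgs(7) by blast
      then have "iv j1 * cj b j1 \<in> J" using j1 sgs(1) by (simp add: sg_mult sg_iv)
      then have 1: "w * iv b \<in> J" by (simp add: b(2) cj_def mult.assoc)
      have "w * iv b \<in> ?H" using wH b(1) B(3) H(1) by (intro sg_mult sg_iv) auto
      then have "(w * iv b) * b \<in> ?E" using 1 b(1) by (intro spI) auto
      then show "w \<in> ?E" by (simp add: mult.assoc)
    qed
    obtain k where k: "k \<in> ?E" "cj k ` cj h1 ` B \<subseteq> B" using sylow_conj[OF p is_sylow psg_cj[OF B(1)] hE] .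
    then obtain j2 b where jb: "j2 \<in> J \<inter> ?H" "b \<in> B" "k = j2 * b" by (metis spE)
    define j3 where "j3 = cj (iv b) j2"
    have j3: "j3 \<in> J \<inter> ?H" unfolding j3_def
      using nm_cj[OF JH sg_iv[OF H(1)] jb(1)] jb(2) B(3) by blast
    have kb: "iv b * k = j3" by (simp add: j3_def jb(3) cj_def mult.assoc)
    have "cj (iv b) ` cj k ` cj h1 ` B \<subseteq> cj (iv b) ` B" using k(2) by (rule image_mono)
    also have "cj (iv b) ` B = B" using nm_cj_eq[OF nm_refl[OF sgs(6)] sg_iv[OF sgs(6) jb(2)]] .
    finally have "cj (j3 * h1) ` B \<subseteq> B" by (simp add: cj_image_cj mult.assoc flip: kb)
    then have "cj (j3 * h1) ` B = B" using cj_subset_eq sg_finite[OF sgs(6)] by blast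
    then have h2: "j3 * h1 \<in> ?C" using j3 h1 H(1) by (simp add: normalizer_in_def[of ?H] sg_mult)
    have gj2: "g = (j1 * iv j3) * (j3 * h1)" by (simp add: gj mult.assoc)
    have "j1 * iv j3 \<in> J" using j1 j3 sgs(1) by (simp add: sg_mult sg_iv)
    moreover have "j1 * iv j3 \<in> ?M"
      using sg_mult_right_iff[OF M(1), of "j3 * h1" "j1 * iv j3"] g h2 C(2) by (metis gj2 subsetD)
    ultimately show "g \<in> sp ?K ?C" using spI[OF _ h2, of "j1 * iv j3" ?K] gj2 by simp
  qed
  obtain a where a: "card P = p ^ a" using sgs(3) by (auto simp: psg_def)
  have Kact: "x ^ (p ^ a) \<in> cen B" if x: "x \<in> ?K" for x
    using inner_acts_as_p_element[OF sgs(3,5) J sgs(6) B(2) sgs(7) BJ, of x] x a nrmD[of x G B] by auto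
  have RC: "residual p ?C \<subseteq> ?M" using residual_sub[OF C(1)] C(2) by blast
  show ?thesis
    unfolding res_acts_as_p_def
  proof
    fix r assume r: "r \<in> residual p ?M"
    have rM: "r \<in> ?M" using r residual_sub[OF M(1)] by blast
    have "r \<in> sp ?K (residual p ?C)" using residual_sp[OF K C MC] r by blast
    then obtain x where x: "x \<in> residual p ?C" "cg ?K r x" using sp_cg[OF K RC] by blast
    have pB: "acts_as_p p B x" using gd x(1) by (simp add: res_acts_as_p_def)
    have xM: "x \<in> ?M" using x(1) RC by blast
    show "acts_as_p p B r"
      by (rule acts_as_p_cong[OF K Kact _ xM pB rM cg_sym[OF nm_sg1[OF K] x(2)]]) (auto dest: nrmD)
  qed
qed

lemma sp_mono: "A \<subseteq> A' \<Longrightarrow> B \<subseteq> B' \<Longrightarrow> sp A B \<subseteq> sp A' B'" for A B :: "'a::mult_group set"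
  unfolding sp_def by blast

text \<open>The normalizer of \<open>Q\<close> also normalizes \<open>sp P Q\<close>, so the
  property restricts from the larger subgroup.\<close>

lemma res_acts_as_p_sp:
  fixes G :: "'a::mult_group set"
  assumes P: "nm P G" and Q: "sg Q" "Q \<subseteq> G" and g: "res_acts_as_p p (normalizer_in G (sp P Q)) (sp P Q)"
  shows "res_acts_as_p p (normalizer_in G Q) Q"
proof (rule res_acts_as_p_mono[OF g])
  have G: "sg G" using nm_sg2[OF P] .
  show "sg (normalizer_in G (sp P Q))" "sg (normalizer_in G Q)" using normalizer_in_sg[OF G] by auto
  show "Q \<subseteq> sp P Q" using sp_sub2[OF sg_one[OF nm_sg1[OF P]]] .
  show "normalizer_in G Q \<subseteq> normalizer_in G (sp P Q)"
  proof
    fix x assume x: "x \<in> normalizer_in G Q"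
    then have xG: "x \<in> G" using normalizer_in_sub by blast
    have sPQ: "sg (sp P Q)" using sp_nm_sg[OF P Q] .
    have "cj x ` sp P Q \<subseteq> sp P Q"
    proof
      fix w assume "w \<in> cj x ` sp P Q"
      then obtain a b where ab: "a \<in> P" "b \<in> Q" "w = cj x a * cj x b" by (auto simp: cj_mult elim!: spE)
      have "cj x b \<in> Q" using nrmD[OF x] ab(2) by blast
      then show "w \<in> sp P Q" using nm_cj[OF P xG ab(1)] ab(3) by (simp add: spI)
    qed
    then have "cj x ` sp P Q = sp P Q" using cj_subset_eq[OF sg_finite[OF sPQ]] by blast
    then show "x \<in> normalizer_in G (sp P Q)" using xG by (simp add: normalizer_in_def)
  qed
qed

text \<open>\<open>Q\<close> may be replaced by \<open>sp P Q\<close>; if this has more than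
  \<open>p ^ d\<close> elements, it is a large normal p-subgroup of its own normalizer.\<close>

lemma loc_res_act_as_p_of_large:
  fixes G :: "'a::mult_group set"
  assumes p: "prime p" and h: "cap_hyp p d G" and P: "psg p P" "nm P G"
    and g: "\<And>Q. psg p Q \<Longrightarrow> Q \<subseteq> G \<Longrightarrow> P \<subseteq> Q \<Longrightarrow> card Q \<le> p ^ d \<Longrightarrow> res_acts_as_p p (normalizer_in G Q) Q"
  shows "loc_res_act_as_p p G"
  unfolding loc_res_act_as_p_def
proof (intro allI impI, elim conjE)
  fix Q assume Q: "psg p Q" "Q \<subseteq> G"
  have G: "sg G" using nm_sg2[OF P(2)] .
  let ?B = "sp P Q"
  have sB: "sg ?B" "?B \<subseteq> G" "P \<subseteq> ?B"
    using sp_nm_sg[OF P(2) psg_sg[OF Q(1)] Q(2)] sp_least[OF G nm_sub[OF P(2)] Q(2)]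
      sp_sub1[OF sg_one[OF psg_sg[OF Q(1)]]] .
  have pB: "psg p ?B" using psg_sp[OF p P(1) Q(1) sB(1)] .
  have "res_acts_as_p p (normalizer_in G ?B) ?B"
  proof (cases "card ?B \<le> p ^ d")
    case True
    then show ?thesis using g[OF pB sB(2,3)] by blast
  next
    case False
    then show ?thesis
      using res_acts_as_p_of_large_normal[OF p cap_hyp_sub[OF h normalizer_in_sub] normalizer_in_sg[OF G] pB normalizer_in_nm[OF sB(1) G sB(2)]] by simp
  qed
  then show "res_acts_as_p p (normalizer_in G Q) Q" using res_acts_as_p_sp[OF P(2) psg_sg[OF Q(1)] Q(2)] by blast
qed

section \<open>The main induction on the group order\<close>

lemma is_sylow_trans:
  fixes P :: "'a::mult_group set"
  assumes p: "prime p" and P: "is_sylow p P J" and L: "sg L" "J \<subseteq> L"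
    and i: "\<not> p dvd card L div card J"
  shows "is_sylow p P L"
proof -
  have sgs: "sg J" "sg P" "P \<subseteq> J" using P by (auto simp: is_sylow_def psg_def)
  obtain a where a: "card J = card P * a" using dvdE[OF sg_dvd[OF sgs]] by blast
  obtain b where b: "card L = card J * b" using dvdE[OF sg_dvd[OF L(1) sgs(1) L(2)]] by blast
  have "\<not> p dvd a" using P a sg_card_pos[OF sgs(2)] by (simp add: is_sylow_def)
  moreover have "\<not> p dvd b" using i b sg_card_pos[OF sgs(1)] by simp
  ultimately have "\<not> p dvd a * b" using p by (simp add: prime_dvd_mult_iff)
  moreover have "card L div card P = a * b" using a b sg_card_pos[OF sgs(2)] by simp
  ultimately show ?thesis using P L sgs by (auto simp: is_sylow_def)
qed

text \<open>The last conjunct says that \<open>J\<close> acts on \<open>P\<close> by inner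
  automorphisms of \<open>P\<close>.\<close>

definition inner_normal :: "nat \<Rightarrow> 'a::mult_group set \<Rightarrow> 'a set \<Rightarrow> 'a set \<Rightarrow> bool" where
  "inner_normal p G P J \<longleftrightarrow> nm J G \<and> is_sylow p P J \<and> nm P G \<and> J \<subseteq> sp P (cen P)"

text \<open>Only a p-subgroup \<open>S0\<close> with more than \<open>p ^ d\<close> elements is
  required, so the statement passes to every subgroup containing a Sylow p-subgroup.\<close>

theorem loc_res_act_as_p_of_hyp:
  fixes G :: "'a::mult_group set"
  assumes p: "prime p" and "cap_hyp p d G" "sg G"
    and "psg p S0" "S0 \<subseteq> G" "p ^ d < card S0"
  shows "loc_res_act_as_p p G"
  using assms(2-)
proof (induction "card G" arbitrary: G S0 rule: less_induct)
  case less
  note h = less.prems(1) and G = less.prems(2) and S0 = less.prems(3-5)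
  have cap: "cap_in p G A" if "psg p A" "A \<subseteq> G" "card A = p ^ d" for A
    using h that scapD[OF _ G] unfolding cap_hyp_def by blast
  have "is_sylow p {1} {1::'a}" using p not_prime_unit psg_triv sg_triv by (auto simp: is_sylow_def)
  then have a1: "inner_normal p G {1} {1}" using nm_triv[OF G] spI[of 1 "{1}" 1 "cen {1::'a}"]
    by (auto simp: inner_normal_def cen_def)
  have "\<exists>J. (\<exists>P. inner_normal p G P J) \<and> (\<forall>K. (\<exists>P. inner_normal p G P K) \<longrightarrow> J \<subseteq> K \<longrightarrow> K = J)"
  proof (rule nm_maximal[of G "\<lambda>J. \<exists>P. inner_normal p G P J" "{1}", OF sg_finite[OF G]])
    show "\<exists>P. inner_normal p G P {1}" using a1 ..
  next
    fix N assume "\<exists>P. inner_normal p G P N"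
    then show "N \<subseteq> G" by (auto simp: inner_normal_def dest: nm_sub)
  next
    fix M assume "\<exists>P. inner_normal p G P M" "\<And>K. \<exists>P. inner_normal p G P K \<Longrightarrow> M \<subseteq> K \<Longrightarrow> K = M"
    then show ?thesis by blast
  qed
  then obtain J P where J: "inner_normal p G P J" and Jm: "\<And>K P'. inner_normal p G P' K \<Longrightarrow> J \<subseteq> K \<Longrightarrow> K = J" by blast
  have nJ: "nm J G" and sP: "is_sylow p P J" and nP: "nm P G" and JP: "J \<subseteq> sp P (cen P)"
    using J by (auto simp: inner_normal_def)
  have sgs: "sg J" "J \<subseteq> G" "psg p P" "sg P" "P \<subseteq> J" "P \<subseteq> G"
    using nJ nP sP by (auto simp: nm_def is_sylow_def)
  show ?case
  proof (cases "p ^ d < card P")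
    case True
    \<comment> \<open>No overgroup of \<open>P\<close> is small, so the remaining case of
      \<open>loc_res_act_as_p_of_large\<close> is vacuous.\<close>
    have False if "P \<subseteq> Q" "psg p Q" "card Q \<le> p ^ d" for Q
      using True card_mono[OF sg_finite[OF psg_sg[OF that(2)]] that(1)] that(3) by simp
    then show ?thesis using loc_res_act_as_p_of_large[OF p h sgs(3) nP] by blast
  next
    case False
    then have cP: "card P \<le> p ^ d" by simp
    have j1: "\<not> p dvd card J div card J" using sg_card_pos[OF sgs(1)] p not_prime_unit by auto
    have "\<exists>L. (nm L G \<and> J \<subseteq> L \<and> \<not> p dvd card L div card J) \<and>
        (\<forall>K. (nm K G \<and> J \<subseteq> K \<and> \<not> p dvd card K div card J) \<longrightarrow> L \<subseteq> K \<longrightarrow> K = L)"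
    proof (rule nm_maximal[of G "\<lambda>L. nm L G \<and> J \<subseteq> L \<and> \<not> p dvd card L div card J" J, OF sg_finite[OF G]])
      show "nm J G \<and> J \<subseteq> J \<and> \<not> p dvd card J div card J" using nJ j1 by simp
    next
      fix N assume "nm N G \<and> J \<subseteq> N \<and> \<not> p dvd card N div card J"
      then show "N \<subseteq> G" using nm_sub by blast
    next
      fix M assume "nm M G \<and> J \<subseteq> M \<and> \<not> p dvd card M div card J"
        "\<And>K. nm K G \<and> J \<subseteq> K \<and> \<not> p dvd card K div card J \<Longrightarrow> M \<subseteq> K \<Longrightarrow> K = M"
      then show ?thesis by (intro exI[of _ M]) simp
    qed
    then obtain L where L: "nm L G" "J \<subseteq> L" "\<not> p dvd card L div card J"
      and Lm0: "\<forall>K. (nm K G \<and> J \<subseteq> K \<and> \<not> p dvd card K div card J) \<longrightarrow> L \<subseteq> K \<longrightarrow> K = L"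
      by (elim exE conjE)
    have Lm: "K = L" if "nm K G" "J \<subseteq> K" "\<not> p dvd card K div card J" "L \<subseteq> K" for K
      using Lm0 that by simp
    have sL: "sg L" "L \<subseteq> G" using L nmD by blast+
    have sPL: "is_sylow p P L" using is_sylow_trans[OF p sP sL(1) L(2,3)] .
    have PL: "P \<subseteq> L" using sgs L by blast
    have pactL: "acts_as_p p P r" if r: "r \<in> L" "r \<in> residual p G" for r
    proof (rule ccontr)
      assume np: "\<not> acts_as_p p P r"
      have rG: "r \<in> G" using r sL by blast
      obtain q j m where q: "prime q" "q \<noteq> p" "(r ^ j) ^ (q ^ m) = 1" "r ^ j \<notin> cen P"
        using not_pact_q_element[OF p G rG np] .
      have "r ^ j \<in> L" "r ^ j \<in> residual p G"
        using sg_power[OF sL(1) r(1)] sg_power[OF nm_sg1[OF residual_nm[OF G]] r(2)] by auto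
      then show False
        using no_noncentral_q_element[OF p h G S0 L(1) sPL nP cP q(1,2) _ _ q(3)] q(4) by blast
    qed
    \<comment> \<open>\<open>P\<close> times its centralizer in \<open>L\<close> is again a
      candidate in the choice of \<open>J\<close>.\<close>
    have JP': "J = sp P (L \<inter> cen P)"
    proof (rule Jm[symmetric])
      let ?K = "sp P (L \<inter> cen P)"
      have K: "nm ?K G" using sp_nm[OF nP nm_cen[OF nP L(1)]] .
      have PK: "P \<subseteq> ?K" using sp_sub1[OF sg_one[OF sg_cen[OF sL(1)]]] .
      have KL: "?K \<subseteq> L" using sp_least[OF sL(1) PL] by blast
      have "is_sylow p P ?K" using is_sylow_sub[OF sPL nm_sg1[OF K] PK KL] .
      moreover have "?K \<subseteq> sp P (cen P)" by (auto simp: sp_def)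
      ultimately show "inner_normal p G P ?K" using K nP by (simp add: inner_normal_def)
      show "J \<subseteq> ?K"
      proof
        fix j assume j: "j \<in> J"
        then obtain u c where uc: "u \<in> P" "c \<in> cen P" "j = u * c" using JP by (metis spE subsetD)
        have "u * c \<in> L" using j uc(3) L(2) by blast
        then have "c \<in> L" using sg_mult_left_iff[OF sL(1), of u c] uc(1) PL by blast
        then show "j \<in> ?K" using uc by (auto intro: spI)
      qed
    qed
    have cenJ: "x \<in> J" if "x \<in> L" "x \<in> cen P" for x
      using that JP' sp_sub2[OF sg_one[OF sgs(4)], of "L \<inter> cen P"] by blast
    have nJL: "nm J L" using nm_subgroup[OF nJ sL(1) L(2) sL(2)] .
    \<comment> \<open>A p-power of \<open>r\<close> centralizes \<open>P\<close>, hence lies in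
      \<open>J\<close>, and so does a power prime to \<open>p\<close>. As the residual contains all
      commutators, \<open>L\<close> is thereby central in \<open>G\<close> modulo
      \<open>J\<close>.\<close>
    have LR: "r \<in> J" if r: "r \<in> L" "r \<in> residual p G" for r
    proof -
      obtain k where "r ^ (p ^ k) \<in> cen P" using pactL[OF r] by (auto simp: acts_as_p_def)
      then have 1: "r ^ (p ^ k) \<in> J" using cenJ sg_power[OF sL(1) r(1)] by blast
      have 2: "r ^ (card L div card J) \<in> J" using nm_index_pow[OF nJL r(1)] .
      have "coprime (p ^ k) (card L div card J)" using prime_imp_coprime[OF p L(3)] by simp
      then show ?thesis using pow_coprime_mem[OF sgs(1) 1 2] by blast
    qed
    have "L \<noteq> G"
    proof
      assume "L = G"
      then have "card S0 \<le> card P" using is_sylow_card_le[OF p sPL S0(1)] S0(2) by blast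
      then show False using S0(3) cP by simp
    qed
    then have "L \<subset> G" using sL by blast
    then obtain M where c: "chief G M L" using chief_above[OF L(1) nm_refl[OF G]] by metis
    note M = chief_nm1[OF c] and LM = chief_sub[OF c]
    have sM: "sg M" "M \<subseteq> G" using M nmD by blast+
    obtain a where a: "card M = card L * a" using dvdE[OF sg_dvd[OF sM(1) sL(1) LM]] by blast
    \<comment> \<open>Otherwise \<open>M\<close> would contradict the maximal choice of
      \<open>L\<close>.\<close>
    have pa: "p dvd a"
    proof (rule ccontr)
      assume na: "\<not> p dvd a"
      obtain l where l: "card L = card J * l" using dvdE[OF sg_dvd[OF sL(1) sgs(1) L(2)]] by blast
      have "\<not> p dvd l" using L(3) l sg_card_pos[OF sgs(1)] by simp
      then have "\<not> p dvd l * a" using na p by (simp add: prime_dvd_mult_iff)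
      moreover have "card M div card J = l * a" using a l sg_card_pos[OF sgs(1)] by simp
      ultimately have "M = L" using Lm[OF M] L(2) LM by auto
      then show False using chief_ne[OF c] by simp
    qed
    have pML: "p dvd card M div card L" using a pa sg_card_pos[OF sL(1)] by simp
    have not_in_L: "\<not> T \<subseteq> L" if T: "is_sylow p T M" for T
    proof
      assume TL: "T \<subseteq> L"
      have sT: "sg T" using T by (simp add: is_sylow_def psg_def)
      obtain t where t: "card L = card T * t" using dvdE[OF sg_dvd[OF sL(1) sT TL]] by blast
      have "card M div card T = t * a" using a t sg_card_pos[OF sT] by simp
      then show False using T pa by (simp add: is_sylow_def)
    qed
    show ?thesis
    proof (cases "\<exists>A. psg p A \<and> A \<subseteq> G \<and> card A = p ^ d \<and> \<not> M \<inter> A \<subseteq> L")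
      \<comment> \<open>Here every subgroup of order \<open>p ^ d\<close> avoids the factor of
        \<open>M\<close> by \<open>L\<close>.\<close>
      case False
      have av: "A \<subseteq> P" if A: "psg p A" "A \<subseteq> M" "card A = p ^ d" for A
      proof -
        have "A \<subseteq> G" using A(2) sM(2) by blast
        then have "A \<subseteq> L" using False A by blast
        then show ?thesis using is_sylow_normal[OF p sPL nm_subgroup[OF nP sL(1) PL sL(2)] A(1)] by blast
      qed
      obtain T where T: "is_sylow p T M" "P \<subseteq> T"
        using is_sylow_contains[OF p sM(1) sgs(3)] PL LM by (metis subset_trans)
      have sT: "psg p T" "sg T" "T \<subseteq> M" using T(1) by (auto simp: is_sylow_def psg_def)
      have "P \<subset> T" using T(2) not_in_L[OF T(1)] PL by blast
      then obtain P' where P': "sg P'" "P \<subset> P'" "P' \<subseteq> T" "card P' = p * card P"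
        using pgroup_step[OF p sT(1) sgs(4)] by metis
      have pP': "psg p P'" using psg_sub[OF p sT(1) P'(1,3)] .
      \<comment> \<open>If \<open>P\<close> were smaller, some subgroup of order
        \<open>p ^ d\<close> would contain \<open>P'\<close> and thus meet \<open>M\<close> outside
        \<open>L\<close>.\<close>
      have "card P = p ^ d"
      proof (rule ccontr)
        assume "card P \<noteq> p ^ d"
        then have lt: "card P < p ^ d" using cP by simp
        obtain i where i: "card P = p ^ i" using sgs(3) by (auto simp: psg_def)
        have "i < d" using lt i prime_gt_1_nat[OF p] power_less_imp_less_exp by metis
        then have "p ^ Suc i \<le> p ^ d" using prime_gt_1_nat[OF p] by (intro power_increasing) auto
        then have le: "card P' \<le> p ^ d" using P'(4) i by simp
        have P'G: "P' \<subseteq> G" using P'(3) sT(3) sM(2) by blast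
        obtain B where B: "is_sylow p B G" "P' \<subseteq> B" using is_sylow_contains[OF p G pP' P'G] .
        have "p ^ d \<le> card B" using is_sylow_card_le[OF p B(1) S0(1,2)] S0(3) by simp
        then obtain A where A: "sg A" "P' \<subseteq> A" "A \<subseteq> B" "card A = p ^ d"
          using pgroup_between[OF p is_sylow_psg[OF B(1)] P'(1) B(2) le] by metis
        have "psg p A" "A \<subseteq> G" using psg_sub[OF p is_sylow_psg[OF B(1)] A(1,3)] A(3) is_sylow_subset[OF B(1)] by auto
        then have "M \<inter> A \<subseteq> L" using False A(4) by blast
        then have "P' \<subseteq> L" using A(2) P'(3) sT(3) by blast
        then have "P' \<subseteq> P" using is_sylow_normal[OF p sPL nm_subgroup[OF nP sL(1) PL sL(2)] pP'] by blast
        then show False using P'(2) by blast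
      qed
      note cPd = this
      \<comment> \<open>\<open>P\<close> is the only subgroup of order \<open>p ^ d\<close> in
        \<open>P'\<close>, hence cyclic; by its order it is also its only small overgroup.\<close>
      have uniq: "A = P" if A: "sg A" "A \<subseteq> P'" "card A = p ^ d" for A
      proof -
        have "A \<subseteq> M" using A(2) P'(3) sT(3) by blast
        then have "A \<subseteq> P" using av[OF psg_sub[OF p pP' A(1,2)] _ A(3)] by blast
        then show ?thesis using card_subset_eq[OF sg_finite[OF sgs(4)]] A(3) cPd by simp
      qed
      have "card P' = p ^ Suc d" "P \<subseteq> P'" using P'(2,4) cPd by auto
      then obtain v where v: "P = cyc v"
        using unique_maximal_cyclic[OF p pP' _ sgs(4) _ uniq cPd] by blast
      have "res_acts_as_p p (normalizer_in G Q) Q" if Q: "psg p Q" "Q \<subseteq> G" "P \<subseteq> Q" "card Q \<le> p ^ d" for Q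
      proof -
        have "Q = P" using card_seteq[OF sg_finite[OF psg_sg[OF Q(1)]] Q(3)] Q(4) cPd by simp
        then show ?thesis using res_acts_as_p_cyclic[OF p normalizer_in_nm[OF sgs(4) G sgs(6)] v cPd] by simp
      qed
      then show ?thesis using loc_res_act_as_p_of_large[OF p h sgs(3) nP] by blast
    next
      case True
      then obtain A where A: "psg p A" "A \<subseteq> G" "card A = p ^ d" "\<not> M \<inter> A \<subseteq> L" by blast
      have MLA: "M \<subseteq> sp L A" using cap[OF A(1-3)] c pML A(4) unfolding cap_in_def by blast
      \<comment> \<open>\<open>A \<inter> M\<close> can be moved into any Sylow subgroup
        \<open>T\<close> of \<open>M\<close> by an element of \<open>M\<close>, so \<open>T\<close>
        covers the factor as well.\<close>
      have MLT: "M \<subseteq> sp L T" if T: "is_sylow p T M" for T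
      proof
        fix x assume x: "x \<in> M"
        have sA: "psg p (A \<inter> M)" using psg_sub[OF p A(1) sg_Int[OF psg_sg[OF A(1)] sM(1)]] by blast
        obtain k where k: "k \<in> M" "cj k ` (A \<inter> M) \<subseteq> T" using sylow_conj[OF p T sA] by blast
        have "cj (iv k) x \<in> M" using sg_cj[OF sM(1) sg_iv[OF sM(1) k(1)] x] .
        then obtain l b where lb: "l \<in> L" "b \<in> A" "cj (iv k) x = l * b" using MLA by (metis spE subsetD)
        have "b \<in> M" using \<open>cj (iv k) x \<in> M\<close> lb LM sg_mult_left_iff[OF sM(1), of l b] by auto
        then have "cj k b \<in> T" using k(2) lb(2) by blast
        moreover have "cj k l \<in> L" using nm_cj[OF L(1) _ lb(1)] k(1) sM(2) by blast
        moreover have "x = cj k l * cj k b" using arg_cong[OF lb(3), of "cj k"] by (simp add: cj_mult)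
        ultimately show "x \<in> sp L T" by (simp add: spI)
      qed
      have JT: "nm (sp J T) G" "is_sylow p T (sp J T)" if T: "is_sylow p T M" for T
      proof -
        have sT: "psg p T" "sg T" "T \<subseteq> M" "T \<subseteq> G" using T sM(2) by (auto simp: is_sylow_def psg_def)
        have s: "sg (sp J T)" "sp J T \<subseteq> G" "T \<subseteq> sp J T" "sp J T \<subseteq> M"
          using sp_nm_sg[OF nJ sT(2,4)] sp_least[OF G sgs(2) sT(4)] sp_sub2[OF sg_one[OF sgs(1)]]
            sp_least[OF sM(1) _ sT(3)] L(2) LM by auto
        show "is_sylow p T (sp J T)" using is_sylow_sub[OF T s(1,3,4)] .
        show "nm (sp J T) G"
          unfolding nm_def
        proof (intro conjI ballI s G)
          fix g x assume g: "g \<in> G" and x: "x \<in> sp J T"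
          then obtain j t where jt: "j \<in> J" "t \<in> T" "x = j * t" by (metis spE)
          have "cj g ` T \<subseteq> M" using nm_cj[OF M g] sT(3) by blast
          then obtain k where k: "k \<in> M" "cj k ` cj g ` T \<subseteq> T" using sylow_conj[OF p T psg_cj[OF sT(1)]] by metis
          obtain l t0 where lt: "l \<in> L" "t0 \<in> T" "iv k = l * t0" using MLT[OF T] sg_iv[OF sM(1) k(1)] by (metis spE subsetD)
          \<comment> \<open>The conjugate of \<open>t\<close> by \<open>g\<close> is the conjugate
            of \<open>t1\<close> by an element \<open>l\<close> of \<open>L\<close>; as
            \<open>L\<close> is central modulo \<open>J\<close>, it differs from \<open>t1\<close>
            by an element of \<open>J\<close>.\<close>
          define t1 where "t1 = cj t0 (cj k (cj g t))"
          have t1: "t1 \<in> T" unfolding t1_def using k(2) jt(2) sg_cj[OF sT(2) lt(2)] by blast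
          have "cj l t1 = cj (iv k) (cj k (cj g t))" by (simp add: t1_def lt(3) cj_cj mult.assoc)
          then have e: "cj g t = cj l t1" by simp
          have "l * t1 * iv l * iv t1 \<in> residual p G" using residual_comm lt(1) t1 sL(2) sT(4) by blast
          moreover have "l * t1 * iv l * iv t1 \<in> L"
          proof -
            have "cj t1 (iv l) \<in> L" using nm_cj[OF L(1)] t1 sT(4) sg_iv[OF sL(1) lt(1)] by blast
            then have "l * cj t1 (iv l) \<in> L" using sg_mult[OF sL(1) lt(1)] by blast
            then show ?thesis by (simp add: cj_def mult.assoc)
          qed
          ultimately have "l * t1 * iv l * iv t1 \<in> J" using LR by blast
          then have "cj g j * (l * t1 * iv l * iv t1) \<in> J" using nm_cj[OF nJ g jt(1)] sg_mult[OF sgs(1)] by blast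
          moreover have "cj g x = (cj g j * (l * t1 * iv l * iv t1)) * t1"
            by (simp add: jt(3) cj_mult e cj_def[of l] mult.assoc)
          ultimately show "cj g x \<in> sp J T" using t1 by (simp add: spI)
        qed
      qed
      \<comment> \<open>If \<open>T\<close> were normal in \<open>G\<close>, then
        \<open>sp J T\<close> would act on \<open>T\<close> by inner automorphisms, against the
        maximality of \<open>J\<close>.\<close>
      have nT: "\<not> nm T G" if T: "is_sylow p T M" "P \<subseteq> T" for T
      proof
        assume nT: "nm T G"
        note JT' = JT[OF T(1)]
        have sT: "psg p T" "sg T" "T \<subseteq> M" "T \<subseteq> G" using T sM(2) by (auto simp: is_sylow_def psg_def)
        let ?K = "sp J T"
        let ?N = "sp T (?K \<inter> cen T)"
        have sK: "sg ?K" "?K \<subseteq> G" "J \<subseteq> ?K" "T \<subseteq> ?K"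
          using nm_sg1[OF JT'(1)] nm_sub[OF JT'(1)] sp_sub1[OF sg_one[OF sT(2)]] sp_sub2[OF sg_one[OF sgs(1)]] .
        have N: "nm ?N G" using sp_nm[OF nT nm_cen[OF nT JT'(1)]] .
        have TN: "T \<subseteq> ?N" using sp_sub1[OF sg_one[OF sg_cen[OF sK(1)]]] .
        have NK: "?N \<subseteq> ?K" using sp_least[OF sK(1,4)] by blast
        have cN: "?K \<inter> cen T \<subseteq> ?N" using sp_sub2[OF sg_one[OF sT(2)]] .
        have TJ: "T \<inter> J \<subseteq> P"
          using is_sylow_normal[OF p sP nm_subgroup[OF nP sgs(1,5,2)] psg_sub[OF p sT(1) sg_Int[OF sT(2) sgs(1)]]] by blast
        have nd: "\<not> p dvd card ?K div card ?N"
        proof -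
          obtain b where b: "card ?K = card ?N * b" using dvdE[OF sg_dvd[OF sK(1) nm_sg1[OF N] NK]] by blast
          obtain e where e: "card ?N = card T * e" using dvdE[OF sg_dvd[OF nm_sg1[OF N] sT(2) TN]] by blast
          have "card ?K div card T = e * b" using b e sg_card_pos[OF sT(2)] by simp
          then have "\<not> p dvd b" using JT'(2) by (auto simp: is_sylow_def)
          then show ?thesis using b sg_card_pos[OF nm_sg1[OF N]] by simp
        qed
        obtain i where i: "card P = p ^ i" using sgs(3) by (auto simp: psg_def)
        \<comment> \<open>The power \<open>card P\<close> of \<open>j\<close> centralizes
          \<open>T\<close>, and the index of \<open>?N\<close> in \<open>?K\<close> is prime to
          \<open>p\<close>.\<close>
        have "J \<subseteq> ?N"
        proof
          fix j assume j: "j \<in> J"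
          have jK: "j \<in> ?K" "j \<in> G" using j sK sgs(2) by auto
          have "j ^ card P \<in> cen T"
            using inner_acts_as_p_element[OF sgs(3,5) nJ JP sT(2) T(2) sT(4) TJ j nm_cj_eq[OF nT jK(2)]] .
          then have 1: "j ^ (p ^ i) \<in> ?N" using cN sg_power[OF sK(1) jK(1)] i by auto
          have 2: "j ^ (card ?K div card ?N) \<in> ?N"
            using nm_index_pow[OF nm_subgroup[OF N sK(1) NK sK(2)] jK(1)] .
          have "coprime (p ^ i) (card ?K div card ?N)" using prime_imp_coprime[OF p nd] by simp
          then show "j \<in> ?N" using pow_coprime_mem[OF nm_sg1[OF N] 1 2] by blast
        qed
        then have "?K \<subseteq> ?N" using sp_least[OF nm_sg1[OF N] _ TN] by blast
        also have "?N \<subseteq> sp T (cen T)" by (rule sp_mono) auto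
        finally have "?K \<subseteq> sp T (cen T)" .
        then have "inner_normal p G T ?K" using JT' nT by (simp add: inner_normal_def)
        then have "?K = J" using Jm sK(3) by blast
        then have "T \<subseteq> L" using sK(4) L(2) by blast
        then show False using not_in_L[OF T(1)] by blast
      qed
      \<comment> \<open>With \<open>Q\<close> in a Sylow subgroup \<open>S\<close>, the normalizer
        of \<open>T = S \<inter> M\<close> is proper and contains \<open>S\<close>; the induction
        hypothesis for it is carried back by \<open>normalizer_controls_good\<close>.\<close>
      have "res_acts_as_p p (normalizer_in G Q) Q" if Q: "psg p Q" "Q \<subseteq> G" "P \<subseteq> Q" for Q
      proof -
        obtain S where S: "is_sylow p S G" "Q \<subseteq> S" using is_sylow_contains[OF p G Q(1,2)] .
        have sS: "psg p S" "sg S" "S \<subseteq> G" using S(1) by (auto simp: is_sylow_def psg_def)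
        define T where "T = S \<inter> M"
        have T: "is_sylow p T M" unfolding T_def using is_sylow_Int[OF p S(1) M] by blast
        have sT: "sg T" "T \<subseteq> G" "P \<subseteq> T"
          using T sM(2) S(2) Q(3) PL LM by (auto simp: is_sylow_def psg_def T_def)
        note JT' = JT[OF T]
        have nTG: "\<not> nm T G" using nT[OF T sT(3)] .
        have "normalizer_in G T \<noteq> G" using nTG normalizer_in_nm[OF sT(1) G sT(2)] by auto
        then have "card (normalizer_in G T) < card G"
          using psubset_card_mono[OF sg_finite[OF G]] normalizer_in_sub by (metis psubsetI)
        moreover have SN: "S \<subseteq> normalizer_in G T"
        proof
          fix s assume s: "s \<in> S"
          have "cj s ` T \<subseteq> T" unfolding T_def
            using sg_cj[OF sS(2) s] nm_cj[OF M] s sS(3) by auto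
          then have "cj s ` T = T" using cj_subset_eq[OF sg_finite[OF sT(1)]] by blast
          then show "s \<in> normalizer_in G T" using s sS(3) by (auto simp: normalizer_in_def)
        qed
        moreover have "p ^ d < card S" using is_sylow_card_le[OF p S(1) S0(1,2)] S0(3) by simp
        ultimately have "loc_res_act_as_p p (normalizer_in G T)"
          using less.hyps[OF _ cap_hyp_sub[OF h normalizer_in_sub] normalizer_in_sg[OF G] sS(1)] by blast
        then have gd: "res_acts_as_p p (normalizer_in (normalizer_in G T) Q) Q" using Q(1) S(2) SN unfolding loc_res_act_as_p_def by blast
        have QN: "Q \<subseteq> normalizer_in G T" using S(2) SN by blast
        show ?thesis
          using normalizer_controls_good[OF p G nJ JP sP nP sT(1,2) JT' Q(1,3) QN gd] .
      qed
      then show ?thesis using loc_res_act_as_p_of_large[OF p h sgs(3) nP] by blast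
    qed
  qed
qed

section \<open>Control of fusion\<close>

lemma normalizer_in_cj:
  fixes G :: "'a::mult_group set"
  assumes G: "sg G" and h: "h \<in> G"
  shows "normalizer_in G (cj h ` Q) = cj h ` normalizer_in G Q"
proof
  have hG: "cj h ` G = G" using nm_cj_eq[OF nm_refl[OF G] h] .
  show "cj h ` normalizer_in G Q \<subseteq> normalizer_in G (cj h ` Q)"
  proof
    fix x assume "x \<in> cj h ` normalizer_in G Q"
    then obtain g where g: "g \<in> G" "cj g ` Q = Q" "x = cj h g" by (auto simp: normalizer_in_def)
    have "cj x ` cj h ` Q = cj h ` cj g ` Q" by (simp add: g(3) cj_image_cj) (simp add: cj_def mult.assoc)
    then show "x \<in> normalizer_in G (cj h ` Q)" using g hG by (auto simp: normalizer_in_def)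
  qed
  show "normalizer_in G (cj h ` Q) \<subseteq> cj h ` normalizer_in G Q"
  proof
    fix x assume "x \<in> normalizer_in G (cj h ` Q)"
    then have x: "x \<in> G" "cj x ` cj h ` Q = cj h ` Q" by (auto simp: normalizer_in_def)
    have "cj (cj (iv h) x) ` Q = cj (iv h) ` cj x ` cj h ` Q"
      by (simp add: cj_image_cj) (simp add: cj_def mult.assoc)
    also have "\<dots> = Q" using x(2) by (simp add: cj_image_iv)
    finally have "cj (iv h) x \<in> normalizer_in G Q" using sg_cj[OF G sg_iv[OF G h] x(1)] by (simp add: normalizer_in_def)
    then show "x \<in> cj h ` normalizer_in G Q" by (metis cj_iv_cj(2) image_eqI)
  qed
qed

lemma cen_cj_image: "a \<in> cen Z \<Longrightarrow> cj m a \<in> cen (cj m ` Z)" for a :: "'a::mult_group"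
proof (rule cenI)
  fix x assume a: "a \<in> cen Z" and "x \<in> cj m ` Z"
  then obtain z where z: "z \<in> Z" "x = cj m z" by auto
  have "cj (cj m a) (cj m z) = cj m (cj a z)" by (simp add: cj_def mult.assoc)
  then show "cj (cj m a) x = x" using z cenD[OF a] by simp
qed

text \<open>For a prime \<open>q\<close> dividing the index of \<open>M\<close>, elements of a Sylow
  q-subgroup of \<open>R\<close> have a p-power in \<open>K\<close>, so they lie in
  \<open>K\<close>. That Sylow subgroup is then inside \<open>M\<close>, leaving the factor
  \<open>q\<close> in its own index.\<close>

lemma p_power_index:
  fixes R :: "'a::mult_group set"
  assumes p: "prime p" and K: "nm K R" and r: "\<And>r. r \<in> R \<Longrightarrow> \<exists>i. r ^ (p ^ i) \<in> K"
    and M: "sg M" "K \<subseteq> M" "M \<subseteq> R" "\<not> p dvd card R div card M"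
  shows "M = R"
proof -
  have sgs: "sg K" "sg R" "K \<subseteq> R" using K nmD by blast+
  obtain c where c: "card R = card M * c" using dvdE[OF sg_dvd[OF sgs(2) M(1,3)]] by blast
  have "c = 1"
  proof (rule ccontr)
    assume "c \<noteq> 1"
    then obtain q where q: "prime q" "q dvd c" using prime_factor_nat by blast
    have "q \<noteq> p" using M(4) c q(2) sg_card_pos[OF M(1)] by auto
    obtain Q where Q: "is_sylow q Q R" using is_sylow_exists[OF q(1) sgs(2)] .
    have sQ: "psg q Q" "sg Q" "Q \<subseteq> R" using Q by (auto simp: is_sylow_def psg_def)
    have "Q \<subseteq> M"
    proof
      fix x assume x: "x \<in> Q"
      obtain i where i: "x ^ (p ^ i) \<in> K" using r sQ(3) x by blast
      obtain j where "x ^ (q ^ j) = 1" using psg_pow[OF sQ(1)] x by metis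
      then have j: "x ^ (q ^ j) \<in> K" using sg_one[OF sgs(1)] by simp
      have "coprime (p ^ i) (q ^ j)" using primes_coprime[OF p q(1)] \<open>q \<noteq> p\<close> by simp
      then show "x \<in> M" using pow_coprime_mem[OF sgs(1) i j] M(2) by blast
    qed
    then obtain b where b: "card M = card Q * b" using dvdE[OF sg_dvd[OF M(1) sQ(2)]] by blast
    have "card R div card Q = b * c" using b c sg_card_pos[OF sQ(2)] by simp
    then show False using Q q(2) by (simp add: is_sylow_def)
  qed
  then show ?thesis using card_subset_eq[OF sg_finite[OF sgs(2)] M(3)] c by simp
qed

lemma is_sylow_cj_both: "is_sylow p P H \<Longrightarrow> is_sylow p (cj g ` P) (cj g ` H)" for P :: "'a::mult_group set"
  by (auto simp: is_sylow_def psg_cj sg_cj_image)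

text \<open>The power \<open>p - 1\<close> of \<open>t\<close> lies in the residual, and the order
  of \<open>t\<close> is coprime to \<open>p - 1\<close>.\<close>

lemma p_element_in_RR:
  fixes t :: "'a::mult_group"
  assumes p: "prime p" and H: "sg H" and t: "t \<in> H" "t ^ (p ^ i) = 1"
  shows "t \<in> residual p H"
proof (rule pow_coprime_mem[OF nm_sg1[OF residual_nm[OF H]]])
  show "t ^ (p ^ i) \<in> residual p H" using t sg_one[OF nm_sg1[OF residual_nm[OF H]]] by simp
  show "t ^ (p - 1) \<in> residual p H" using residual_pow[OF t(1)] .
  have "\<not> p dvd p - 1" using prime_gt_1_nat[OF p] by (simp add: nat_dvd_not_less)
  then show "coprime (p ^ i) (p - 1)" using prime_imp_coprime[OF p] by simp
qed

text \<open>Downward induction on \<open>card A\<close>: \<open>A\<close> is moved to a conjugate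
  \<open>Z\<close> whose normalizer has a Sylow p-subgroup inside \<open>S\<close>, and conjugations
  onto \<open>Z\<close> are extended, up to elements centralizing \<open>Z\<close>, to larger
  subgroups of \<open>S\<close>.\<close>

theorem fusion_control:
  fixes G :: "'a::mult_group set"
  assumes p: "prime p" and E: "loc_res_act_as_p p G" and G: "sg G" and S: "is_sylow p S G"
    and A: "sg A" "A \<subseteq> S" and g: "g \<in> G" "cj g ` A \<subseteq> S"
  shows "\<exists>n\<in>normalizer_in G S. \<exists>c\<in>G \<inter> cen A. g = n * c"
  using A g
proof (induction "card S - card A" arbitrary: A g rule: less_induct)
  case less
  note A = less.prems(1,2) and g = less.prems(3,4)
  have sS: "psg p S" "sg S" "S \<subseteq> G" using S by (auto simp: is_sylow_def psg_def)
  have N: "sg (normalizer_in G S)" "normalizer_in G S \<subseteq> G" using normalizer_in_sg[OF G] normalizer_in_sub .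
  show ?case
  proof (cases "A = S")
    case True
    have "cj g ` S = S" using cj_subset_eq[OF sg_finite[OF sS(2)]] g(2) True by blast
    then have "g \<in> normalizer_in G S" using g(1) by (simp add: normalizer_in_def)
    moreover have "1 \<in> G \<inter> cen A" using sg_one[OF sg_cen[OF G]] .
    ultimately show ?thesis by (metis mult_1_right)
  next
    case False
    then have AS: "A \<subset> S" using A by blast
    have AG: "A \<subseteq> G" using A sS by blast
    have pA: "psg p A" using psg_sub[OF p sS(1) A] .
    have NA: "sg (normalizer_in G A)" "normalizer_in G A \<subseteq> G" "nm A (normalizer_in G A)" using normalizer_in_sg[OF G] normalizer_in_sub normalizer_in_nm[OF A(1) G AG] .
    obtain T where T: "is_sylow p T (normalizer_in G A)" using is_sylow_exists[OF p NA(1)] .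
    have sT: "psg p T" "T \<subseteq> normalizer_in G A" "T \<subseteq> G" using T NA(2) by (auto simp: is_sylow_def)
    have AT: "A \<subseteq> T"
    proof -
      obtain x where x: "x \<in> normalizer_in G A" "cj x ` A \<subseteq> T" using sylow_conj[OF p T pA nm_sub[OF NA(3)]] .
      then show ?thesis using nm_cj_eq[OF NA(3) x(1)] by simp
    qed
    obtain h where h: "h \<in> G" "cj h ` T \<subseteq> S" using sylow_conj[OF p S sT(1,3)] .
    \<comment> \<open>\<open>h\<close> moves a whole Sylow p-subgroup of the normalizer of
      \<open>A\<close> into \<open>S\<close>, so the normalizer of \<open>Z\<close> meets
      \<open>S\<close> in one of its Sylow subgroups.\<close>
    define Z where "Z = cj h ` A"
    have Z: "sg Z" "Z \<subseteq> S" "psg p Z" "Z \<subseteq> G" "card Z = card A"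
    proof -
      show "Z \<subseteq> S" unfolding Z_def using image_mono[OF AT, of "cj h"] h(2) by blast
      then show "Z \<subseteq> G" using sS(3) by blast
    qed (use A(1) sg_cj_image psg_cj[OF pA] in \<open>simp_all add: Z_def\<close>)
    let ?M = "normalizer_in G Z"
    have M: "sg ?M" "?M \<subseteq> G" "nm Z ?M" using normalizer_in_sg[OF G] normalizer_in_sub normalizer_in_nm[OF Z(1) G Z(4)] .
    have Ms: "?M = cj h ` normalizer_in G A" unfolding Z_def using normalizer_in_cj[OF G h(1)] .
    let ?D = "S \<inter> ?M"
    have pD: "psg p ?D" using psg_sub[OF p sS(1) sg_Int[OF sS(2) M(1)]] by blast
    have is_sylowD: "is_sylow p ?D ?M"
    proof (rule is_sylow_max[OF p _ pD])
      show "is_sylow p (cj h ` T) ?M" using is_sylow_cj_both[OF T, of h] Ms by simp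
      have "cj h ` T \<subseteq> ?D" using h(2) sT(2) Ms by blast
      then show "card (cj h ` T) \<le> card ?D" using card_mono[OF sg_finite[OF psg_sg[OF pD]]] by blast
    qed blast
    let ?R = "residual p ?M"
    have R: "nm ?R ?M" using residual_nm[OF M(1)] .
    have sR: "sg ?R" "?R \<subseteq> ?M" using nm_sg1[OF R] nm_sub[OF R] .
    have pR: "Q \<subseteq> ?R" if Q: "psg p Q" "Q \<subseteq> ?M" for Q
    proof
      fix t assume t: "t \<in> Q"
      obtain i where "t ^ (p ^ i) = 1" using psg_pow[OF Q(1)] t by metis
      then show "t \<in> ?R" using p_element_in_RR[OF p M(1)] t Q(2) by blast
    qed
    have DR: "?D \<subseteq> ?R" using pR[OF pD] by blast
    have is_sylowDR: "is_sylow p ?D ?R" using is_sylow_sub[OF is_sylowD sR(1) DR sR(2)] .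
    let ?K = "?R \<inter> cen Z"
    have K: "nm ?K ?R" using nm_subgroup[OF nm_cen[OF M(3) R] sR(1) _ sR(2)] by blast
    have gZ: "res_acts_as_p p ?M Z" using E Z(3,4) by (simp add: loc_res_act_as_p_def)
    \<comment> \<open>The residual of \<open>?M\<close> acts on \<open>Z\<close> as a p-group, so
      the centralizer of \<open>Z\<close> in it together with its Sylow subgroup \<open>?D\<close>
      fills it.\<close>
    have RKD: "sp ?K ?D = ?R"
    proof (rule p_power_index[OF p K])
      fix r assume r: "r \<in> ?R"
      then obtain i where "r ^ (p ^ i) \<in> cen Z" using gZ by (auto simp: res_acts_as_p_def acts_as_p_def)
      then show "\<exists>i. r ^ (p ^ i) \<in> ?K" using sg_power[OF sR(1) r] by blast
    next
      show s: "sg (sp ?K ?D)" using sp_nm_sg[OF K psg_sg[OF pD] DR] .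
      show "?K \<subseteq> sp ?K ?D" using sp_sub1[OF sg_one[OF psg_sg[OF pD]]] .
      show sub: "sp ?K ?D \<subseteq> ?R" using sp_least[OF sR(1) _ DR] by blast
      have Ds: "?D \<subseteq> sp ?K ?D" using sp_sub2[OF sg_one[OF nm_sg1[OF K]]] .
      obtain b where b: "card (sp ?K ?D) = card ?D * b" using dvdE[OF sg_dvd[OF s psg_sg[OF pD] Ds]] by blast
      obtain e where e: "card ?R = card (sp ?K ?D) * e" using dvdE[OF sg_dvd[OF sR(1) s sub]] by blast
      have "card ?R div card ?D = b * e" using b e sg_card_pos[OF psg_sg[OF pD]] by simp
      then have "\<not> p dvd e" using is_sylowDR by (auto simp: is_sylow_def)
      then show "\<not> p dvd card ?R div card (sp ?K ?D)" using e sg_card_pos[OF s] by simp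
    qed
    \<comment> \<open>\<open>k\<close> carries a larger \<open>B'\<close> normalizing
      \<open>B\<close> into the residual of \<open>?M\<close>. Sylow conjugation there, corrected by
      an element of \<open>?D\<close>, gives \<open>y\<close> centralizing \<open>Z\<close> with
      \<open>y * k\<close> mapping \<open>B'\<close> into \<open>S\<close>, where induction
      applies.\<close>
    have claim: "\<exists>n\<in>normalizer_in G S. \<exists>c\<in>G \<inter> cen B. k = n * c"
      if B: "sg B" "B \<subseteq> S" and k: "k \<in> G" "cj k ` B = Z" for B k
    proof -
      have cB: "card B = card A" using k(2) Z(5) by (metis card_cj)
      have BG: "B \<subseteq> G" using B sS by blast
      have "card A < card S" using psubset_card_mono[OF sg_finite[OF sS(2)] AS] .
      then have "B \<subset> S" using B(2) cB by auto
      then obtain B' where B': "sg B'" "nm B B'" "B \<subset> B'" "B' \<subseteq> S"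
        using pgroup_step[OF p sS(1) B(1)] by metis
      have pB': "psg p B'" using psg_sub[OF p sS(1) B'(1,4)] .
      have B'G: "B' \<subseteq> G" using B'(4) sS(3) by blast
      have "cj k ` B' \<subseteq> ?M"
      proof
        fix x assume "x \<in> cj k ` B'"
        then obtain b where b: "b \<in> B'" "x = cj k b" by auto
        have "b \<in> normalizer_in G B" using nm_cj_eq[OF B'(2) b(1)] b(1) B'G by (auto simp: normalizer_in_def)
        then show "x \<in> ?M" using normalizer_in_cj[OF G k(1), of B] k(2) b(2) by auto
      qed
      then have "cj k ` B' \<subseteq> ?R" using pR[OF psg_cj[OF pB']] by blast
      then obtain r where r: "r \<in> ?R" "cj r ` cj k ` B' \<subseteq> ?D" using sylow_conj[OF p is_sylowDR psg_cj[OF pB']] by metis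
      then obtain x s where xs: "x \<in> ?K" "s \<in> ?D" "r = x * s" using RKD by (metis spE)
      define y where "y = cj (iv s) x"
      have sR': "s \<in> ?R" using xs(2) DR by blast
      have y: "y \<in> ?K" unfolding y_def using nm_cj[OF K sg_iv[OF sR(1) sR'] xs(1)] .
      have "iv s * r = y" by (simp add: y_def xs(3) cj_def mult.assoc)
      then have "iv s * (r * k) = y * k" by (metis mult.assoc)
      moreover have "cj (iv s) ` cj r ` cj k ` B' \<subseteq> cj (iv s) ` ?D" using r(2) by (rule image_mono)
      moreover have "cj (iv s) ` ?D = ?D"
        using nm_cj_eq[OF nm_refl[OF psg_sg[OF pD]] sg_iv[OF psg_sg[OF pD] xs(2)]] .
      ultimately have yk: "cj (y * k) ` B' \<subseteq> S" by (simp add: cj_image_cj mult.assoc)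
      have yG: "y \<in> G" using y sR M by blast
      have "card A < card B'" using psubset_card_mono[OF sg_finite[OF B'(1)] B'(3)] cB by simp
      moreover have "card B' \<le> card S" using card_mono[OF sg_finite[OF sS(2)] B'(4)] .
      ultimately have "card S - card B' < card S - card A" by simp
      then obtain n c where nc: "n \<in> normalizer_in G S" "c \<in> G \<inter> cen B'" "y * k = n * c"
        using less.hyps[OF _ B'(1,4) sg_mult[OF G yG k(1)] yk] by metis
      have nG: "n \<in> G" using nc(1) N(2) by blast
      have cB: "c \<in> cen B" using nc(2) cen_anti[of B B'] B'(3) by blast
      have "cj n ` B = Z"
      proof -
        have "cj c ` B = B" using cenD[OF cB] by force
        then have "cj n ` B = cj (y * k) ` B" unfolding nc(3) by (simp flip: cj_image_cj)
        also have "\<dots> = cj y ` Z" using k(2) by (simp flip: cj_image_cj)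
        also have "\<dots> = Z" using cenD[of y Z] y by force
        finally show ?thesis .
      qed
      then have nZ: "cj (iv n) ` Z = B" using cj_image_iv(1)[of n B] by simp
      have "cj (iv n) (iv y) \<in> cen B" using cen_cj_image[OF cen_iv, of y Z "iv n"] y nZ by simp
      then have "cj (iv n) (iv y) * c \<in> cen B" using cB cen_mult by blast
      moreover have "cj (iv n) (iv y) * c \<in> G" using nG yG nc(2) G by (simp add: sg_mult sg_cj sg_iv)
      moreover have "k = n * (cj (iv n) (iv y) * c)"
      proof -
        have "n * (cj (iv n) (iv y) * c) = iv y * (n * c)" by (simp add: cj_def mult.assoc)
        also have "\<dots> = k" by (simp flip: nc(3))
        finally show ?thesis by simp
      qed
      ultimately show ?thesis using nc(1) by blast
    qed
    \<comment> \<open>The claim is used for \<open>h\<close> from \<open>A\<close> to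
      \<open>Z\<close> and for \<open>h * iv g\<close> from the conjugate of \<open>A\<close> by
      \<open>g\<close> to \<open>Z\<close>; \<open>g\<close> is recovered as a quotient.\<close>
    obtain n1 c1 where 1: "n1 \<in> normalizer_in G S" "c1 \<in> G \<inter> cen A" "h = n1 * c1"
      using claim[OF A h(1)] Z_def by blast
    have "cj (h * iv g) ` cj g ` A = Z" unfolding Z_def cj_image_cj by (simp add: mult.assoc)
    then obtain n2 c2 where 2: "n2 \<in> normalizer_in G S" "c2 \<in> G \<inter> cen (cj g ` A)" "h * iv g = n2 * c2"
      using claim[OF sg_cj_image[OF A(1)] g(2) sg_mult[OF G h(1) sg_iv[OF G g(1)]]] by blast
    define n where "n = iv n2 * n1"
    have nN: "n \<in> normalizer_in G S" unfolding n_def using 1(1) 2(1) N(1) by (intro sg_mult sg_iv)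
    have nG: "n \<in> G" using nN N(2) by blast
    have "g = iv (h * iv g) * h" by (simp add: mult.assoc)
    then have gn: "g = iv c2 * n * c1" unfolding 2(3) by (simp add: n_def 1(3) mult.assoc)
    have "cj n ` A = cj g ` A"
    proof -
      have "cj c1 ` A = A" using cenD[of c1 A] 1(2) by force
      then have "cj n ` A = cj (n * c1) ` A" by (simp flip: cj_image_cj)
      also have "n * c1 = c2 * g" unfolding gn by (simp add: mult.assoc)
      also have "cj (c2 * g) ` A = cj c2 ` cj g ` A" by (simp add: cj_image_cj)
      also have "\<dots> = cj g ` A" using cenD[of c2 "cj g ` A"] 2(2) by force
      finally show ?thesis .
    qed
    then have "cj (iv n) ` cj g ` A = A" using cj_image_iv(1)[of n A] by simp
    then have "cj (iv n) (iv c2) \<in> cen A" using cen_cj_image[OF cen_iv, of c2 "cj g ` A" "iv n"] 2(2) by simp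
    then have "cj (iv n) (iv c2) * c1 \<in> cen A" using 1(2) cen_mult by blast
    moreover have "cj (iv n) (iv c2) * c1 \<in> G" using nG 1(2) 2(2) G by (simp add: sg_mult sg_cj sg_iv)
    moreover have "g = n * (cj (iv n) (iv c2) * c1)" by (subst gn) (simp add: cj_def mult.assoc)
    ultimately show ?thesis using nN by blast
  qed
qed

section \<open>Eigenvectors and chief factors below a normal Sylow subgroup\<close>

text \<open>Multiplication by a primitive root \<open>g\<close> permutes the residues, so the sum is
  congruent to \<open>g ^ j\<close> times itself, while \<open>g ^ j\<close> is not congruent to
  1.\<close>

lemma power_sum_dvd:
  assumes p: "prime p" and j: "0 < j" "j < p - 1"
  shows "p dvd (\<Sum>c<p. c ^ j :: nat)"
proof -
  have "p > 1" using prime_gt_1_nat[OF p] .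
  obtain g where g: "residue_primroot p g" using prime_primitive_root_exists[of p] p \<open>p > 1\<close> by blast
  then have cg: "coprime p g" and og: "ord p g = totient p" by (auto simp: residue_primroot_def)
  have "\<not> [g ^ j = 1] (mod p)"
  proof
    assume "[g ^ j = 1] (mod p)"
    then have "p - 1 dvd j" using og by (metis ord_divides totient_prime[OF p])
    then show False using j by (simp add: nat_dvd_not_less)
  qed
  have inj: "inj_on (\<lambda>c. g * c mod p) {..<p}"
  proof (rule inj_onI)
    fix x y assume xy: "x \<in> {..<p}" "y \<in> {..<p}" "g * x mod p = g * y mod p"
    then have "[g * x = g * y] (mod p)" by (simp add: cong_def)
    then have "[x = y] (mod p)" using cg by (simp add: cong_mult_lcancel_nat coprime_commute)
    then show "x = y" using xy by (simp add: cong_def)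
  qed
  moreover have "(\<lambda>c. g * c mod p) ` {..<p} \<subseteq> {..<p}" using \<open>p > 1\<close> by auto
  ultimately have "(\<lambda>c. g * c mod p) ` {..<p} = {..<p}" by (simp add: endo_inj_surj)
  then have "(\<Sum>c<p. c ^ j) = (\<Sum>c<p. (g * c mod p) ^ j)"
    using sum.reindex[OF inj, of "\<lambda>c. c ^ j"] by simp
  also have "[(\<Sum>c<p. (g * c mod p) ^ j) = (\<Sum>c<p. (g * c) ^ j)] (mod p)"
    by (intro cong_sum cong_pow) (simp add: cong_def)
  also have "(\<Sum>c<p. (g * c) ^ j) = g ^ j * (\<Sum>c<p. c ^ j)" by (simp add: power_mult_distrib sum_distrib_left)
  finally have c: "[(\<Sum>c<p. c ^ j) = g ^ j * (\<Sum>c<p. c ^ j)] (mod p)" .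
  show ?thesis
  proof (rule ccontr)
    assume "\<not> p dvd (\<Sum>c<p. c ^ j)"
    then have "coprime (\<Sum>c<p. c ^ j) p" using prime_imp_coprime[OF p] coprime_commute by blast
    moreover have "[1 * (\<Sum>c<p. c ^ j) = g ^ j * (\<Sum>c<p. c ^ j)] (mod p)" using c by simp
    ultimately have "[1 = g ^ j] (mod p)" by (simp only: cong_mult_rcancel_nat)
    then show False using \<open>\<not> [g ^ j = 1] (mod p)\<close> by (simp add: cong_sym_eq)
  qed
qed

text \<open>By Fermat each nonzero \<open>c\<close> contributes 1, so the sum is congruent to
  \<open>p - 1\<close>.\<close>

lemma power_sum_not_dvd:
  assumes p: "prime p"
  shows "\<not> p dvd (\<Sum>c<p. c ^ (p - 1) :: nat)"
proof -
  have p1: "p > 1" using prime_gt_1_nat[OF p] .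
  have "[c ^ (p - 1) = (if c = 0 then 0 else 1)] (mod p)" if "c < p" for c
  proof (cases "c = 0")
    case True
    then show ?thesis using p1 by (simp add: zero_power)
  next
    case False
    then show ?thesis using fermat_theorem[OF p, of c] that by (simp add: nat_dvd_not_less)
  qed
  then have "[(\<Sum>c<p. c ^ (p - 1)) = (\<Sum>c<p. if c = 0 then 0 else 1)] (mod p)"
    by (intro cong_sum) auto
  moreover have "(\<Sum>c<p. if c = 0 then 0 else 1 :: nat) = p - 1"
  proof -
    have "(\<Sum>c<p. if c = 0 then 0 else 1 :: nat) = (\<Sum>c\<in>{..<p} - {0}. 1)"
      by (rule sum.mono_neutral_cong_right) auto
    then show ?thesis using p1 by simp
  qed
  ultimately have "p dvd (\<Sum>c<p. c ^ (p - 1)) \<longleftrightarrow> p dvd p - 1" by (simp add: cong_dvd_iff)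
  then show ?thesis using p1 by (simp add: nat_dvd_not_less)
qed

text \<open>For \<open>a\<close> acting on the elementary abelian group \<open>U/V\<close> with \<open>a\<^bsup>p-1\<^esup>\<close> trivial, the element \<open>e c (p - 1)\<close> is
  (up to a scalar) the projection of \<open>u\<close> to the eigenspace for \<open>c\<close>; since power sums vanish modulo \<open>p\<close>,
  the projections for \<open>c = 1, \<dots>, p - 1\<close> sum to \<open>-u\<close>.\<close>

lemma eigenvector:
  fixes U V :: "'a::mult_group set"
  assumes p: "prime p" and V: "nm V U" "V \<noteq> U"
    and ab: "\<And>x y. x \<in> U \<Longrightarrow> y \<in> U \<Longrightarrow> cg V (x * y) (y * x)" and ex: "\<And>x. x \<in> U \<Longrightarrow> x ^ p \<in> V"
    and a: "\<And>x. x \<in> U \<Longrightarrow> cj a x \<in> U" "\<And>x. x \<in> V \<Longrightarrow> cj a x \<in> V"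
    and ap: "\<And>x. x \<in> U \<Longrightarrow> cg V x (cj (a ^ (p - 1)) x)"
  obtains u c where "u \<in> U" "u \<notin> V" "cg V (cj a u) (u ^ c)"
proof -
  have sgs: "sg U" "sg V" "V \<subseteq> U" using V nmD by blast+
  obtain u where u: "u \<in> U" "u \<notin> V" using V(2) sgs(3) by blast
  define n where "n = p - 1"
  have n0: "0 < n" using prime_gt_1_nat[OF p] by (simp add: n_def)
  have pn: "p = Suc n" using prime_gt_1_nat[OF p] by (simp add: n_def)
  define t where "t i = cj (a ^ i) u" for i
  have tS: "t (Suc i) = cj a (t i)" for i by (simp add: t_def cj_cj)
  have t: "t i \<in> U" for i by (induction i) (simp_all add: tS a(1), simp add: t_def u)
  \<comment> \<open>\<open>e c k\<close> is the product of \<open>t i ^ (c ^ (n - i))\<close> over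
    \<open>i < k\<close>.\<close>
  define e where "e c = rec_nat 1 (\<lambda>k w. w * t k ^ (c ^ (n - k)))" for c :: nat
  have e0: "e c 0 = 1" and eS: "e c (Suc k) = e c k * t k ^ (c ^ (n - k))" for c k
    by (simp_all add: e_def)
  have e: "e c k \<in> U" for c k
    by (induction k) (simp_all add: e0 eS sg_one[OF sgs(1)] sg_mult[OF sgs(1)] sg_power[OF sgs(1)] t)
  note cl = sg_mult[OF sgs(1)] sg_power[OF sgs(1)] t e a(1) u(1)
  note rf = cg_refl[OF sgs(2)]
  note tr = cg_trans[OF sgs(2)]
  note sy = cg_sym[OF sgs(2)]
  note mu = cg_mult[OF V(1)]
  have swap: "cg V (x * y * z) (x * z * y)" if "x \<in> U" "y \<in> U" "z \<in> U" for x y z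
    using mu[OF that(1) that(1) cl(1)[OF that(2,3)] cl(1)[OF that(3,2)] rf ab[OF that(2,3)]] by (simp add: mult.assoc)
  have cja: "cg V (cj a x) (cj a y)" if "cg V x y" for x y
    using a(2)[of "iv x * y"] that by (simp add: cg_def cj_mult cj_iv)
  \<comment> \<open>Applying \<open>a\<close> shifts the index, taking the \<open>c\<close>-th power
    shifts the exponent; the two products differ only in the end terms with \<open>t 0\<close> and
    \<open>t k\<close>.\<close>
  have eig: "k \<le> n \<Longrightarrow> cg V (e c k ^ c * t k ^ (c ^ Suc (n - k))) (cj a (e c k) * t 0 ^ (c ^ Suc n))" for c k
  proof (induction k)
    case 0
    show ?case by (simp add: e0 rf)
  next
    case (Suc k)
    then have IH: "cg V (e c k ^ c * t k ^ (c ^ Suc (n - k))) (cj a (e c k) * t 0 ^ (c ^ Suc n))" by simp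
    let ?x = "t k ^ (c ^ (n - k))" and ?y = "t (Suc k) ^ (c ^ (n - k))"
    have ns: "Suc (n - Suc k) = n - k" using Suc.prems by simp
    have x: "?x ^ c = t k ^ (c ^ Suc (n - k))" by (simp add: mult.commute flip: power_mult)
    have "cg V (e c (Suc k) ^ c) (e c k ^ c * ?x ^ c)"
      unfolding eS by (rule cg_power_mult[OF V(1) ab]) (assumption | intro cl)+
    then have "cg V (e c (Suc k) ^ c) (cj a (e c k) * t 0 ^ (c ^ Suc n))" using tr IH unfolding x by blast
    then have "cg V (e c (Suc k) ^ c * ?y) (cj a (e c k) * t 0 ^ (c ^ Suc n) * ?y)"
      by (rule mu[rotated 4]) (intro cl rf)+
    moreover have "cg V (cj a (e c k) * t 0 ^ (c ^ Suc n) * ?y) (cj a (e c k) * ?y * t 0 ^ (c ^ Suc n))"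
      by (rule swap) (intro cl)+
    moreover have "cj a (e c k) * ?y = cj a (e c (Suc k))" by (simp add: eS cj_mult cj_power tS)
    ultimately show ?case using tr unfolding ns by metis
  qed
  have eigen: "cg V (cj a (e c n)) (e c n ^ c)" for c
  proof -
    have 1: "cg V (e c n ^ c * t n ^ c) (cj a (e c n) * t 0 ^ (c ^ p))" using eig[of n c] by (simp add: pn)
    have "cg V (t 0) (t n)" using ap[OF u(1)] by (simp add: t_def n_def)
    then have 2: "cg V (t 0 ^ c) (t n ^ c)" by (rule cg_power[OF V(1) t t])
    have 3: "cg V (t 0 ^ c) (t 0 ^ (c ^ p))"
    proof -
      \<comment> \<open>Fermat in a form without subtraction; since \<open>t n\<close> is congruent
        to \<open>t 0\<close>, it makes the end terms cancel.\<close>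
      have "\<exists>m. c ^ p = c + p * m"
      proof (cases "p dvd c")
        case True
        then obtain m where "c = p * m" by auto
        show ?thesis
        proof (cases "c = 0")
          case True
          then have "c ^ p = c + p * 0" by (simp add: pn)
          then show ?thesis by blast
        next
          case False
          then obtain x where "c ^ n = Suc x" by (metis not0_implies_Suc power_not_zero)
          then have "c ^ p = c + c * x" by (simp add: pn)
          then have "c ^ p = c + p * (m * x)" using \<open>c = p * m\<close> by (simp add: mult.assoc)
          then show ?thesis by blast
        qed
      next
        case False
        then have "[c ^ n = 1] (mod p)" using fermat_theorem[OF p] by (simp add: n_def)
        moreover have ge: "1 \<le> c ^ n" using False by (cases "c = 0") auto
        ultimately have "p dvd c ^ n - 1" using cong_altdef_nat by blast
        then obtain m where "c ^ n - 1 = p * m" by auto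
        then have "c ^ n = 1 + p * m" using ge by linarith
        then have "c ^ p = c + p * (c * m)" by (simp add: pn algebra_simps)
        then show ?thesis by blast
      qed
      then obtain m where m: "c ^ p = c + p * m" by blast
      have "iv (t 0 ^ c) * t 0 ^ (c ^ p) = (t 0 ^ p) ^ m" unfolding m by (simp add: power_add power_mult)
      then show ?thesis using sg_power[OF sgs(2) ex[OF t]] by (simp add: cg_def)
    qed
    have "cg V (e c n ^ c * t 0 ^ c) (e c n ^ c * t n ^ c)" by (rule mu[OF _ _ _ _ rf 2]) (intro cl)+
    moreover have "cg V (cj a (e c n) * t 0 ^ c) (cj a (e c n) * t 0 ^ (c ^ p))" by (rule mu[OF _ _ _ _ rf 3]) (intro cl)+
    ultimately have "cg V (cj a (e c n) * t 0 ^ c) (e c n ^ c * t 0 ^ c)" using 1 tr sy by blast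
    then have "cg V ((cj a (e c n) * t 0 ^ c) * iv (t 0 ^ c)) ((e c n ^ c * t 0 ^ c) * iv (t 0 ^ c))"
      by (rule mu[rotated 4]) (intro cl rf sg_iv[OF sgs(1)])+
    then show ?thesis by (simp add: mult.assoc)
  qed
  \<comment> \<open>\<open>D m k\<close> is the product of \<open>e c k\<close> over
    \<open>c < m\<close>. For \<open>m = p\<close> the step from \<open>k\<close> to
    \<open>Suc k\<close> adds the exponent \<open>\<Sum>c<p. c ^ (n - k)\<close>, which for
    \<open>k < n\<close> vanishes modulo \<open>p\<close> unless \<open>k = 0\<close>.\<close>
  define D where "D m k = rec_nat 1 (\<lambda>c w. w * e c k) m" for m k
  have D0: "D 0 k = 1" and DS: "D (Suc m) k = D m k * e m k" for m k by (simp_all add: D_def)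
  have D: "D m k \<in> U" for m k
    by (induction m) (simp_all add: D0 DS sg_one[OF sgs(1)] cl)
  have Dk: "cg V (D m (Suc k)) (D m k * t k ^ (\<Sum>c<m. c ^ (n - k)))" for m k
  proof (induction m)
    case 0
    show ?case by (simp add: D0 rf)
  next
    case (Suc m)
    let ?s = "\<Sum>c<m. c ^ (n - k)" and ?r = "m ^ (n - k)"
    have c1: "cg V (D (Suc m) (Suc k)) (D m k * t k ^ ?s * (e m k * t k ^ ?r))"
      unfolding DS eS by (rule mu[OF _ _ _ _ Suc rf]) (intro cl D)+
    have c2: "cg V (D m k * t k ^ ?s * e m k * t k ^ ?r) (D m k * e m k * t k ^ ?s * t k ^ ?r)"
      by (rule mu[OF _ _ _ _ swap rf]) (intro cl D)+
    have "cg V (D (Suc m) (Suc k)) (D m k * e m k * (t k ^ ?s * t k ^ ?r))"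
      using tr[OF c1[unfolded mult.assoc] c2[unfolded mult.assoc]] by (simp only: mult.assoc)
    then show ?case by (simp add: DS power_add)
  qed
  have D1: "D m 0 = 1" for m by (induction m) (simp_all add: D0 DS e0)
  let ?N = "\<Sum>c<p. c ^ n"
  have Dn: "Suc k \<le> n \<Longrightarrow> cg V (D p (Suc k)) (u ^ ?N)" for k
  proof (induction k)
    case 0
    show ?case using Dk[of p 0] by (simp add: D1 t_def)
  next
    case (Suc k)
    have "p dvd (\<Sum>c<p. c ^ (n - Suc k))" using Suc.prems by (intro power_sum_dvd[OF p]) (auto simp: n_def)
    then obtain m where m: "(\<Sum>c<p. c ^ (n - Suc k)) = p * m" by auto
    have "t (Suc k) ^ (p * m) \<in> V" using sg_power[OF sgs(2) ex[OF t]] by (simp add: power_mult)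
    then have "cg V (D p (Suc k)) (D p (Suc k) * t (Suc k) ^ (p * m))" by (simp add: cg_def)
    then have "cg V (D p (Suc (Suc k))) (D p (Suc k))" using Dk[of p "Suc k"] tr sy unfolding m by blast
    then show ?case using Suc tr by (metis Suc_leD)
  qed
  have "\<exists>c. e c n \<notin> V"
  proof (rule ccontr)
    assume "\<not> ?thesis"
    then have "e c n \<in> V" for c by blast
    then have "D m n \<in> V" for m
      by (induction m) (simp_all add: D0 DS sg_one[OF sgs(2)] sg_mult[OF sgs(2)])
    moreover have "cg V (D p n) (u ^ ?N)" using Dn[of "n - 1"] n0 by simp
    ultimately have "u ^ ?N \<in> V" using cg_mem[OF sgs(2)] by blast
    moreover have "coprime ?N p"
      using prime_imp_coprime[OF p power_sum_not_dvd[OF p]] by (simp add: n_def coprime_commute)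
    ultimately show False using pow_coprime_mem[OF sgs(2) _ ex[OF u(1)]] u(2) by blast
  qed
  then obtain c where "e c n \<notin> V" by blast
  then show ?thesis using that[OF e _ eigen] by blast
qed

text \<open>The residual is trivial on the factor, so \<open>H\<close> acts through an abelian group
  of exponent dividing \<open>p - 1\<close>. Each element has an eigenvector, its eigenspace is
  invariant under \<open>H\<close>, hence everything; all elements act as power maps, so any
  intermediate subgroup is normal.\<close>

lemma chief_order_p:
  fixes S :: "'a::mult_group set"
  assumes p: "prime p" and S: "is_sylow p S H" "nm S H" and gd: "res_acts_as_p p H S"
    and c: "chief H U V" and US: "U \<subseteq> S"
  shows "card U = p * card V"
proof -
  note U = chief_nm1[OF c] and V = chief_nm2[OF c] and VU = chief_sub[OF c]
  have pS: "psg p S" using S(1) by (simp add: is_sylow_def)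
  have sgs: "sg U" "sg V" "sg H" "U \<subseteq> H" using U V nmD by blast+
  have pU: "psg p U" using psg_sub[OF p pS sgs(1) US] .
  have VU': "nm V U" using nm_subgroup[OF V sgs(1) VU sgs(4)] .
  note ab = chief_abelian[OF p pS S(2) c US] and ex = chief_exponent[OF p pS S(2) c US]
  let ?N = "{r \<in> H. \<forall>u\<in>U. cg V u (cj r u)}"
  have N: "nm ?N H" using nm_kernel[OF U V] .
  have SN: "S \<subseteq> ?N" using chief_central[OF p pS S(2) c US] nm_sub[OF S(2)] by blast
  \<comment> \<open>A p-power of \<open>r\<close> centralizes \<open>S\<close>, and a power prime to
    \<open>p\<close> lies in \<open>S\<close>, which acts trivially on the factor.\<close>
  have tr: "cg V u (cj r u)" if r: "r \<in> residual p H" and u: "u \<in> U" for r u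
  proof -
    have rH: "r \<in> H" using r residual_sub[OF sgs(3)] by blast
    obtain k where k: "r ^ (p ^ k) \<in> cen S" using gd r by (auto simp: res_acts_as_p_def acts_as_p_def)
    have "cj (r ^ (p ^ k)) u = u" if "u \<in> U" for u using cenD[OF k] that US by blast
    then have 1: "r ^ (p ^ k) \<in> ?N" using sg_power[OF sgs(3) rH] by (simp add: cg_refl[OF sgs(2)])
    have 2: "r ^ (card H div card S) \<in> ?N" using nm_index_pow[OF S(2) rH] SN by blast
    have "\<not> p dvd card H div card S" using S(1) by (simp add: is_sylow_def)
    then have "coprime (p ^ k) (card H div card S)" using prime_imp_coprime[OF p] by simp
    then have "r \<in> ?N" using pow_coprime_mem[OF nm_sg1[OF N] 1 2] by blast
    then show ?thesis using u by blast
  qed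
  have scalar: "\<exists>c. \<forall>u\<in>U. cg V (cj a u) (u ^ c)" if a: "a \<in> H" for a
  proof -
    obtain u c' where u: "u \<in> U" "u \<notin> V" "cg V (cj a u) (u ^ c')"
    proof (rule eigenvector[OF p VU' _ ab ex nm_cj[OF U a] nm_cj[OF V a] tr[OF residual_pow[OF a]]])
      show "V \<noteq> U" using chief_ne[OF c] by simp
    qed auto
    let ?M = "{u \<in> U. cg V (cj a u) (u ^ c')}"
    have "nm ?M H"
      unfolding nm_def
    proof (intro conjI ballI sgs sg_finite_closed)
      show "finite ?M" using sg_finite[OF sgs(1)] by simp
      show "1 \<in> ?M" using sg_one[OF sgs(1)] cg_refl[OF sgs(2)] by simp
      show "?M \<subseteq> H" using sgs(4) by blast
      fix x y assume xy: "x \<in> ?M" "y \<in> ?M"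
      then have xyU: "x \<in> U" "y \<in> U" by auto
      have "cg V (cj a x * cj a y) (x ^ c' * y ^ c')"
        using xy nm_cj[OF U a] sg_power[OF sgs(1)] by (intro cg_mult[OF VU']) auto
      moreover have "cg V ((x * y) ^ c') (x ^ c' * y ^ c')" by (rule cg_power_mult[OF VU' ab xyU])
      ultimately have "cg V (cj a (x * y)) ((x * y) ^ c')"
        using cg_trans[OF sgs(2)] cg_sym[OF sgs(2)] by (metis cj_mult)
      then show "x * y \<in> ?M" using sg_mult[OF sgs(1) xyU] by simp
    next
      fix h x assume h: "h \<in> H" and x: "x \<in> ?M"
      then have xU: "x \<in> U" by simp
      \<comment> \<open>\<open>w\<close> is the commutator by which \<open>h\<close> and
        \<open>a\<close> fail to commute; it lies in the residual, so it is trivial on the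
        factor.\<close>
      define w where "w = iv a * iv h * iv (iv a) * iv (iv h)"
      have w: "w \<in> residual p H" unfolding w_def using residual_comm[OF sg_iv[OF sgs(3) a] sg_iv[OF sgs(3) h]] .
      have "cg V (cj a x) (cj a (cj w x))" using cg_cj[OF V a tr[OF w xU]] .
      then have "cg V (cj h (cj a (cj w x))) (cj h (x ^ c'))"
        using x cg_cj[OF V h] cg_trans[OF sgs(2)] cg_sym[OF sgs(2)] by blast
      moreover have "cj h (cj a (cj w x)) = cj a (cj h x)" by (simp add: w_def cj_def mult.assoc)
      ultimately show "cj h x \<in> ?M" using nm_cj[OF U h xU] by (simp add: cj_power)
    qed
    moreover have "V \<subseteq> ?M"
    proof
      fix v assume v: "v \<in> V"
      have "iv (cj a v) * v ^ c' \<in> V" using nm_cj[OF V a v] v sgs(2) by (simp add: sg_mult sg_iv sg_power)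
      then show "v \<in> ?M" using v VU by (auto simp: cg_def)
    qed
    ultimately have "?M = U" by (rule chief_top[OF c, of _ u]) (use u in auto)
    then show ?thesis by blast
  qed
  have "V \<subset> U" using VU chief_ne[OF c] by blast
  then obtain V' where V': "sg V'" "V \<subset> V'" "V' \<subseteq> U" "card V' = p * card V"
    using pgroup_step[OF p pU sgs(2)] by metis
  have "nm V' H"
    unfolding nm_def
  proof (intro conjI ballI V'(1) sgs)
    show "V' \<subseteq> H" using V'(3) sgs(4) by blast
    fix h v assume h: "h \<in> H" and v: "v \<in> V'"
    obtain c' where "cg V (cj h v) (v ^ c')" using scalar[OF h] v V'(3) by blast
    then have "iv (cj h v) * v ^ c' \<in> V'" using V'(2) by (auto simp: cg_def)
    then have "iv (cj h v) \<in> V'" using sg_mult_right_iff[OF V'(1)] sg_power[OF V'(1) v] by blast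
    then show "cj h v \<in> V'" using sg_iv[OF V'(1), of "iv (cj h v)"] by simp
  qed
  then show ?thesis using chief_between[OF c, of V'] V'(2,3,4) by auto
qed

text \<open>A chief series of the normalizer of \<open>S\<close> below \<open>S\<close> has factors
  of order \<open>p\<close>; by \<open>fusion_control\<close> conjugations between subgroups of
  \<open>S\<close> agree with conjugations by elements of that normalizer, which preserve each
  term.\<close>

theorem supersolvable_chain:
  fixes G :: "'a::mult_group set"
  assumes p: "prime p" and E: "loc_res_act_as_p p G" and G: "sg G" and S: "is_sylow p S G"
  shows "\<exists>(n::nat) T. T 0 = {1} \<and> T n = S \<and>
    (\<forall>i\<le>n. sg (T i) \<and> T i \<subseteq> S \<and>
      (\<forall>A g. sg A \<and> A \<subseteq> T i \<and> g \<in> G \<and> cj g ` A \<subseteq> S \<longrightarrow> cj g ` A \<subseteq> T i)) \<and>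
    (\<forall>i<n. T i \<subseteq> T (Suc i) \<and> card (T (Suc i)) = p * card (T i))"
proof -
  let ?H = "normalizer_in G S"
  have sS: "psg p S" "sg S" "S \<subseteq> G" using S by (auto simp: is_sylow_def psg_def)
  have H: "sg ?H" "?H \<subseteq> G" "nm S ?H" using normalizer_in_sg[OF G] normalizer_in_sub normalizer_in_nm[OF sS(2) G sS(3)] .
  have SH: "is_sylow p S ?H" using is_sylow_sub[OF S H(1) nm_sub[OF H(3)] H(2)] .
  have gd: "res_acts_as_p p ?H S" using E sS by (simp add: loc_res_act_as_p_def)
  have "\<exists>(n::nat) T. T 0 = {1} \<and> T n = S \<and> (\<forall>i\<le>n. nm (T i) ?H \<and> T i \<subseteq> S) \<and>
      (\<forall>i<n. T i \<subseteq> T (Suc i) \<and> card (T (Suc i)) = p * card (T i))"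
  proof -
    have "\<exists>(n::nat) T. T 0 = N \<and> T n = S \<and> (\<forall>i\<le>n. nm (T i) ?H \<and> T i \<subseteq> S) \<and>
        (\<forall>i<n. T i \<subseteq> T (Suc i) \<and> card (T (Suc i)) = p * card (T i))"
      if "nm N ?H" "N \<subseteq> S" for N
      using that
    proof (induction "card S - card N" arbitrary: N rule: less_induct)
      case less
      show ?case
      proof (cases "N = S")
        case True
        then show ?thesis using less.prems by (intro exI[of _ "0::nat"] exI[of _ "\<lambda>_. N"]) auto
      next
        case False
        then have "N \<subset> S" using less.prems by blast
        then obtain U where U: "chief ?H U N" "U \<subseteq> S" using chief_above[OF less.prems(1) H(3)] by metis
        have cU: "card U = p * card N" using chief_order_p[OF p SH H(3) gd U] .
        have "card N < card U" using cU sg_card_pos[OF nm_sg1[OF less.prems(1)]] prime_gt_1_nat[OF p] by simp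
        moreover have "card U \<le> card S" using card_mono[OF sg_finite[OF sS(2)] U(2)] .
        ultimately have "card S - card U < card S - card N" by simp
        then obtain n T where T: "T 0 = U" "T n = S" "\<forall>i\<le>n. nm (T i) ?H \<and> T i \<subseteq> S"
          "\<forall>i<n. T i \<subseteq> T (Suc i) \<and> card (T (Suc i)) = p * card (T i)"
          using less.hyps[OF _ chief_nm1[OF U(1)] U(2)] by metis
        define T' where "T' i = (case i of 0 \<Rightarrow> N | Suc j \<Rightarrow> T j)" for i
        have "T' 0 = N" "T' (Suc n) = S" using T by (simp_all add: T'_def)
        moreover have "nm (T' i) ?H \<and> T' i \<subseteq> S" if "i \<le> Suc n" for i
          using that T(3) less.prems by (cases i) (simp_all add: T'_def)
        moreover have "T' i \<subseteq> T' (Suc i) \<and> card (T' (Suc i)) = p * card (T' i)" if "i < Suc n" for i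
          using that T(1,4) cU chief_sub[OF U(1)] by (cases i) (simp_all add: T'_def)
        ultimately show ?thesis by blast
      qed
    qed
    then show ?thesis using nm_triv[OF H(1)] sg_one[OF sS(2)] by simp
  qed
  then obtain n T where T: "T 0 = {1}" "T n = S" "\<forall>i\<le>n. nm (T i) ?H \<and> T i \<subseteq> S"
      "\<forall>i<n. T i \<subseteq> T (Suc i) \<and> card (T (Suc i)) = p * card (T i)" by blast
  have ext: "cj g ` A \<subseteq> T i" if asm: "i \<le> n" "sg A" "A \<subseteq> T i" "g \<in> G" "cj g ` A \<subseteq> S" for i A g
  proof -
    have Ti: "nm (T i) ?H" "T i \<subseteq> S" using T(3) asm(1) by auto
    obtain m c where mc: "m \<in> ?H" "c \<in> cen A" "g = m * c"
      using fusion_control[OF p E G S asm(2) _ asm(4,5)] asm(3) Ti(2) by blast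
    have "cj g a = cj m a" if "a \<in> A" for a using cenD[OF mc(2) that] mc(3) by (simp flip: cj_cj)
    then show ?thesis using nm_cj[OF Ti(1) mc(1)] asm(3) by auto
  qed
  have "\<forall>i\<le>n. sg (T i) \<and> T i \<subseteq> S \<and>
      (\<forall>A g. sg A \<and> A \<subseteq> T i \<and> g \<in> G \<and> cj g ` A \<subseteq> S \<longrightarrow> cj g ` A \<subseteq> T i)"
  proof (intro allI impI conjI)
    fix i assume i: "i \<le> n"
    show "sg (T i)" "T i \<subseteq> S" using T(3) i nm_sg1[of "T i"] by auto
    fix A g assume "sg A \<and> A \<subseteq> T i \<and> g \<in> G \<and> cj g ` A \<subseteq> S"
    then show "cj g ` A \<subseteq> T i" using ext[OF i] by blast
  qed
  then show ?thesis using T(1,2,4) by blast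
qed

section \<open>Transfer to arbitrary finite groups\<close>

typedef 'a bijection = "{f :: 'a \<Rightarrow> 'a. bij f}"
  morphisms ap Bij
proof
  show "id \<in> {f :: 'a \<Rightarrow> 'a. bij f}" by simp
qed

instantiation bijection :: (type) mult_group
begin

definition "1 = Bij id"
definition "f * g = Bij (ap f \<circ> ap g)"
definition "iv f = Bij (inv_into UNIV (ap f))"

lemma bij_ap: "bij (ap f)"
  using ap[of f] by simp

lemma ap_simps: "ap 1 = id" "ap (f * g) = ap f \<circ> ap g" "ap (iv f) = inv_into UNIV (ap f)"
  unfolding one_bijection_def times_bijection_def iv_bijection_def
  by (simp_all add: Bij_inverse bij_ap bij_comp bij_imp_bij_inv)

instance
proof
  fix a b c :: "'a bijection"
  show "a * b * c = a * (b * c)" by (simp add: comp_assoc ap_simps flip: ap_inject)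
  show "1 * a = a" "a * 1 = a" by (simp_all add: ap_simps flip: ap_inject)
  show "iv a * a = 1" by (simp add: ap_simps bij_is_inj[OF bij_ap] flip: ap_inject)
qed

end

locale finite_group = group G for G (structure) +
  assumes finite_carrier: "finite (carrier G)"
begin

text \<open>The regular representation, continued by the identity outside the carrier to give a
  bijection of the whole type.\<close>

definition emb :: "'a \<Rightarrow> 'a bijection" where
  "emb g = Bij (\<lambda>x. if x \<in> carrier G then g \<otimes> x else x)"

lemma ap_emb:
  assumes g: "g \<in> carrier G" shows "ap (emb g) = (\<lambda>x. if x \<in> carrier G then g \<otimes> x else x)"
proof -
  have "bij (\<lambda>x. if x \<in> carrier G then g \<otimes> x else x)"
  proof (rule o_bij)
    show "(\<lambda>x. if x \<in> carrier G then inv g \<otimes> x else x) \<circ> (\<lambda>x. if x \<in> carrier G then g \<otimes> x else x) = id"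
      "(\<lambda>x. if x \<in> carrier G then g \<otimes> x else x) \<circ> (\<lambda>x. if x \<in> carrier G then inv g \<otimes> x else x) = id"
      using g by (auto simp: fun_eq_iff simp flip: m_assoc)
  qed
  then show ?thesis unfolding emb_def by (simp add: Bij_inverse)
qed

lemma emb_mult: "g \<in> carrier G \<Longrightarrow> h \<in> carrier G \<Longrightarrow> emb (g \<otimes> h) = emb g * emb h"
  by (auto simp: ap_simps ap_emb m_assoc fun_eq_iff simp flip: ap_inject)

lemma emb_one: "emb \<one> = 1"
  by (auto simp: ap_simps ap_emb fun_eq_iff simp flip: ap_inject)

lemma emb_inv: "g \<in> carrier G \<Longrightarrow> emb (inv g) = iv (emb g)"
proof -
  assume g: "g \<in> carrier G"
  have "emb g * emb (inv g) = 1" using g by (simp add: emb_one flip: emb_mult)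
  then show ?thesis using iv_unique by metis
qed

lemma emb_inj: "inj_on emb (carrier G)"
proof (rule inj_onI)
  fix x y assume xy: "x \<in> carrier G" "y \<in> carrier G" "emb x = emb y"
  then have "ap (emb x) \<one> = ap (emb y) \<one>" by simp
  then show "x = y" using xy(1,2) by (simp add: ap_emb)
qed

lemma emb_eq_iff: "x \<in> carrier G \<Longrightarrow> y \<in> carrier G \<Longrightarrow> emb x = emb y \<longleftrightarrow> x = y"
  using emb_inj by (auto dest: inj_onD)

lemma emb_cj: "g \<in> carrier G \<Longrightarrow> x \<in> carrier G \<Longrightarrow> cj (emb g) (emb x) = emb (g \<otimes> x \<otimes> inv g)"
  by (simp add: cj_def emb_mult emb_inv)

lemma emb_pow: "g \<in> carrier G \<Longrightarrow> emb (g [^] (n::nat)) = emb g ^ n"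
  by (induction n) (simp_all add: emb_one emb_mult power_commutes)

lemma card_emb: "A \<subseteq> carrier G \<Longrightarrow> card (emb ` A) = card A"
  by (rule card_image) (rule inj_on_subset[OF emb_inj])

lemma emb_mem_iff: "A \<subseteq> carrier G \<Longrightarrow> x \<in> carrier G \<Longrightarrow> emb x \<in> emb ` A \<longleftrightarrow> x \<in> A"
  using emb_eq_iff by (auto simp: subset_iff)

lemma emb_subset_iff: "A \<subseteq> carrier G \<Longrightarrow> B \<subseteq> carrier G \<Longrightarrow> emb ` A \<subseteq> emb ` B \<longleftrightarrow> A \<subseteq> B"
proof
  assume AB: "A \<subseteq> carrier G" "B \<subseteq> carrier G" "emb ` A \<subseteq> emb ` B"
  show "A \<subseteq> B"
  proof
    fix x assume "x \<in> A"
    then show "x \<in> B" using AB emb_mem_iff[OF AB(2), of x] by blast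
  qed
qed (rule image_mono)

lemma emb_image_eq_iff: "A \<subseteq> carrier G \<Longrightarrow> B \<subseteq> carrier G \<Longrightarrow> emb ` A = emb ` B \<longleftrightarrow> A = B"
  by (rule inj_on_image_eq_iff[OF emb_inj])

lemma emb_sp: "A \<subseteq> carrier G \<Longrightarrow> B \<subseteq> carrier G \<Longrightarrow> emb ` (A <#> B) = sp (emb ` A) (emb ` B)"
proof
  assume AB: "A \<subseteq> carrier G" "B \<subseteq> carrier G"
  show "emb ` (A <#> B) \<subseteq> sp (emb ` A) (emb ` B)"
  proof
    fix x assume "x \<in> emb ` (A <#> B)"
    then obtain a b where ab: "a \<in> A" "b \<in> B" "x = emb (a \<otimes> b)" by (auto simp: set_mult_def)
    then have "x = emb a * emb b" using AB emb_mult by blast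
    then show "x \<in> sp (emb ` A) (emb ` B)" using ab by (simp add: spI)
  qed
  show "sp (emb ` A) (emb ` B) \<subseteq> emb ` (A <#> B)"
  proof
    fix x assume "x \<in> sp (emb ` A) (emb ` B)"
    then obtain a b where ab: "a \<in> A" "b \<in> B" "x = emb a * emb b" by (auto elim!: spE)
    then have "x = emb (a \<otimes> b)" using emb_mult[OF subsetD[OF AB(1) ab(1)] subsetD[OF AB(2) ab(2)]] by simp
    then show "x \<in> emb ` (A <#> B)" using ab by (auto simp: set_mult_def)
  qed
qed

lemma emb_sg: "subgroup H G \<Longrightarrow> sg (emb ` H)"
proof (rule sg_finite_closed)
  assume H: "subgroup H G"
  have HG: "H \<subseteq> carrier G" using subgroup.subset[OF H] .
  show "finite (emb ` H)" using HG finite_carrier finite_subset by blast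
  show "1 \<in> emb ` H" using subgroup.one_closed[OF H] emb_one by (metis image_eqI)
  fix a b assume "a \<in> emb ` H" "b \<in> emb ` H"
  then obtain x y where xy: "x \<in> H" "y \<in> H" "a = emb x" "b = emb y" by blast
  then have "x \<otimes> y \<in> H" "a * b = emb (x \<otimes> y)"
    using subgroup.m_closed[OF H] emb_mult[OF subsetD[OF HG xy(1)] subsetD[OF HG xy(2)]] by simp_all
  then show "a * b \<in> emb ` H" by simp
qed

lemma sg_emb:
  assumes K: "sg K" "K \<subseteq> emb ` carrier G"
  obtains H where "subgroup H G" "K = emb ` H"
proof -
  let ?H = "{h \<in> carrier G. emb h \<in> K}"
  have "subgroup ?H G"
    by (rule subgroupI) (use K sg_one[OF K(1)] emb_one in
      \<open>auto simp: emb_inv emb_mult sg_iv sg_mult intro: exI[of _ "\<one>"]\<close>)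
  moreover have "K = emb ` ?H" using K(2) by auto
  ultimately show ?thesis using that by blast
qed

text \<open>The inclusion on the left keeps \<open>N\<close> in the carrier, where
  \<open>emb\<close> is known to be injective.\<close>

lemma emb_nm_iff:
  assumes H: "subgroup H G"
  shows "nm (emb ` N) (emb ` H) \<and> N \<subseteq> carrier G \<longleftrightarrow> N \<lhd> G\<lparr>carrier := H\<rparr>"
proof
  have HG: "H \<subseteq> carrier G" using subgroup.subset[OF H] .
  interpret H: group "G\<lparr>carrier := H\<rparr>" by (rule subgroup_imp_group[OF H])
  {
    assume N: "nm (emb ` N) (emb ` H) \<and> N \<subseteq> carrier G"
    then have NH: "N \<subseteq> H"
      using nm_sub[of "emb ` N" "emb ` H"] emb_subset_iff[of N H] HG by simp
    have "emb ` N \<subseteq> emb ` carrier G" using N by blast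
    then obtain N' where N': "subgroup N' G" "emb ` N = emb ` N'" using sg_emb nm_sg1 N by metis
    then have "N = N'" using emb_image_eq_iff N subgroup.subset by blast
    then have sN: "subgroup N G" using N' by simp
    have "x \<otimes> h \<otimes> inv x \<in> N" if x: "x \<in> H" and h: "h \<in> N" for x h
    proof -
      have xh: "x \<in> carrier G" "h \<in> carrier G" using x h HG N by auto
      have "cj (emb x) (emb h) \<in> emb ` N" using nm_cj[of "emb ` N" "emb ` H"] N x h by blast
      then show ?thesis using emb_cj[OF xh] emb_mem_iff[of N] N xh by simp
    qed
    then show "N \<lhd> G\<lparr>carrier := H\<rparr>"
      unfolding H.normal_inv_iff using subgroup_incl[OF sN H NH] m_inv_consistent[OF H] by simp
  }
  {
    assume N: "N \<lhd> G\<lparr>carrier := H\<rparr>"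
    then have sN: "subgroup N (G\<lparr>carrier := H\<rparr>)"
      and cN: "\<And>x h. x \<in> H \<Longrightarrow> h \<in> N \<Longrightarrow> x \<otimes> h \<otimes> inv x \<in> N"
      unfolding H.normal_inv_iff using m_inv_consistent[OF H] by simp_all
    have sG: "subgroup N G" using incl_subgroup[OF H sN] .
    have NH: "N \<subseteq> H" using subgroup.subset[OF sN] by simp
    have "cj a b \<in> emb ` N" if a: "a \<in> emb ` H" and b: "b \<in> emb ` N" for a b
    proof -
      obtain x h where xh: "x \<in> H" "h \<in> N" "a = emb x" "b = emb h" using a b by auto
      then show ?thesis using emb_cj[of x h] cN[OF xh(1,2)] HG NH by auto
    qed
    then show "nm (emb ` N) (emb ` H) \<and> N \<subseteq> carrier G"
      unfolding nm_def using emb_sg[OF sG] emb_sg[OF H] NH HG by auto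
  }
qed

lemma order_Mod:
  assumes H: "subgroup H G" and K: "K \<lhd> G\<lparr>carrier := H\<rparr>"
  shows "order (G\<lparr>carrier := H\<rparr> Mod K) = card H div card K"
proof -
  interpret H: group "G\<lparr>carrier := H\<rparr>" by (rule subgroup_imp_group[OF H])
  have sK: "subgroup K (G\<lparr>carrier := H\<rparr>)" using normal_imp_subgroup[OF K] .
  have "K \<subseteq> H" using subgroup.subset[OF sK] by simp
  then have "finite K" using finite_carrier subgroup.subset[OF H] finite_subset by (metis subset_trans)
  then have "0 < card K" using subgroup.one_closed[OF sK] card_gt_0_iff by blast
  moreover have "card (rcosets\<^bsub>G\<lparr>carrier := H\<rparr>\<^esub> K) * card K = card H"
    using H.lagrange[OF sK] by (simp add: order_def)
  moreover have "order (G\<lparr>carrier := H\<rparr> Mod K) = card (rcosets\<^bsub>G\<lparr>carrier := H\<rparr>\<^esub> K)"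
    by (simp add: order_def FactGroup_def)
  ultimately show ?thesis by (metis nonzero_mult_div_cancel_right less_numeral_extra(3))
qed

text \<open>By \<open>sg_emb\<close> all subgroups of the image are images, so chief factors of the
  intermediate subgroups pull back to chief factors in \<open>G\<close>.\<close>

lemma strong_CAP_scap:
  assumes A: "strong_p_CAP_subgroup G p A"
  shows "strong_cap p (emb ` carrier G) (emb ` A)"
  unfolding strong_cap_def cap_in_def
proof (intro allI impI, elim conjE)
  fix H U V assume H: "sg H" "emb ` A \<subseteq> H" "H \<subseteq> emb ` carrier G" and c: "chief H U V"
    and d: "p dvd card U div card V"
  have sA: "subgroup A G" using A by (simp add: strong_p_CAP_subgroup_def)
  have AG: "A \<subseteq> carrier G" using subgroup.subset[OF sA] .
  obtain H0 where H0: "subgroup H0 G" "H = emb ` H0" using sg_emb[OF H(1,3)] .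
  have H0G: "H0 \<subseteq> carrier G" using subgroup.subset[OF H0(1)] .
  have AH: "A \<subseteq> H0" using H(2) H0(2) emb_subset_iff[OF AG H0G] by simp
  have cap: "p_CAP_subgroup (G\<lparr>carrier := H0\<rparr>) p A"
    using A H0(1) AH by (simp add: strong_p_CAP_subgroup_def)
  have ex: "\<exists>N0. N0 \<lhd> G\<lparr>carrier := H0\<rparr> \<and> N = emb ` N0" if N: "nm N H" for N
  proof -
    have "N \<subseteq> emb ` carrier G" using nm_sub[OF N] H(3) by blast
    then obtain N0 where "subgroup N0 G" "N = emb ` N0" using sg_emb[OF nm_sg1[OF N]] by blast
    then show ?thesis using emb_nm_iff[OF H0(1), of N0] N H0(2) subgroup.subset by blast
  qed
  obtain U0 V0 where U0: "U0 \<lhd> G\<lparr>carrier := H0\<rparr>" "U = emb ` U0"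
    and V0: "V0 \<lhd> G\<lparr>carrier := H0\<rparr>" "V = emb ` V0"
    using ex[OF chief_nm1[OF c]] ex[OF chief_nm2[OF c]] by blast
  have sub: "U0 \<subseteq> carrier G" "V0 \<subseteq> carrier G" using U0 V0 emb_nm_iff[OF H0(1)] by blast+
  have sU0: "subgroup U0 G" using incl_subgroup[OF H0(1) normal_imp_subgroup[OF U0(1)]] .
  have VU: "V0 \<subset> U0" using chief_sub[OF c] chief_ne[OF c] U0(2) V0(2) emb_subset_iff[OF sub(2,1)] by blast
  have cf: "chief_factor (G\<lparr>carrier := H0\<rparr>) U0 V0"
    unfolding chief_factor_def
  proof (intro conjI U0 V0 VU notI)
    assume "\<exists>N. N \<lhd> G\<lparr>carrier := H0\<rparr> \<and> V0 \<subset> N \<and> N \<subset> U0"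
    then obtain N where N: "N \<lhd> G\<lparr>carrier := H0\<rparr>" "V0 \<subset> N" "N \<subset> U0" by blast
    have "nm (emb ` N) H" using emb_nm_iff[OF H0(1), of N] N(1) H0(2) by blast
    moreover have "V \<subseteq> emb ` N" "emb ` N \<subseteq> U" using N U0(2) V0(2) by auto
    ultimately have "emb ` N = V \<or> emb ` N = U" using chief_between[OF c] by blast
    moreover have "N \<subseteq> carrier G" using N(3) sub by blast
    ultimately have "N = V0 \<or> N = U0" using emb_image_eq_iff sub U0(2) V0(2) by metis
    then show False using N by blast
  qed
  have "order ((G\<lparr>carrier := H0\<rparr>)\<lparr>carrier := U0\<rparr> Mod V0) = card U div card V"
  proof -
    have sU: "subgroup U0 (G\<lparr>carrier := H0\<rparr>)" using normal_imp_subgroup[OF U0(1)] .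
    have "V0 \<lhd> (G\<lparr>carrier := H0\<rparr>)\<lparr>carrier := U0\<rparr>"
      using group.normal_restrict_supergroup[OF subgroup_imp_group[OF H0(1)] sU V0(1)] VU by blast
    then show ?thesis using order_Mod[OF sU0, of V0] card_emb sub U0(2) V0(2) by simp
  qed
  then have "covers (G\<lparr>carrier := H0\<rparr>) A U0 V0 \<or> avoids A U0 V0"
    using cap cf d unfolding p_CAP_subgroup_def by simp
  then show "U \<subseteq> sp V (emb ` A) \<or> U \<inter> emb ` A \<subseteq> V"
  proof
    assume "covers (G\<lparr>carrier := H0\<rparr>) A U0 V0"
    then have "U0 <#> A = V0 <#> A" by (simp add: covers_def)
    then have "sp U (emb ` A) = sp V (emb ` A)" using emb_sp[OF _ AG] sub U0(2) V0(2) by metis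
    then show ?thesis using sp_sub1[OF sg_one[OF emb_sg[OF sA]], of U] by simp
  next
    assume "avoids A U0 V0"
    then have "emb ` (U0 \<inter> A) = emb ` (V0 \<inter> A)" by (simp add: avoids_def)
    then have "U \<inter> emb ` A = V \<inter> emb ` A"
      using inj_on_image_Int[OF emb_inj _ AG] sub U0(2) V0(2) by metis
    then show ?thesis by blast
  qed
qed

end

section \<open>Conjugation invariance and the passage from \<open>S\<close> to all
  p-subgroups\<close>

lemma nm_cj_image: "nm N H \<Longrightarrow> nm (cj h ` N) (cj h ` H)" for N :: "'a::mult_group set"
  unfolding nm_def
proof (intro conjI ballI; (elim conjE)?)
  fix x y assume n: "\<forall>h\<in>H. \<forall>n\<in>N. cj h n \<in> N" and "x \<in> cj h ` H" "y \<in> cj h ` N"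
  then obtain a b where ab: "a \<in> H" "b \<in> N" "x = cj h a" "y = cj h b" by auto
  have "cj x y = cj h (cj a b)" by (simp add: ab cj_def mult.assoc)
  then show "cj x y \<in> cj h ` N" using n ab by blast
qed (auto intro: sg_cj_image)

lemma chief_cj_image:
  fixes U :: "'a::mult_group set"
  assumes c: "chief H U V" shows "chief (cj h ` H) (cj h ` U) (cj h ` V)"
  unfolding chief_def
proof (intro conjI allI impI nm_cj_image chief_nm1[OF c] chief_nm2[OF c])
  show "cj h ` V \<subset> cj h ` U" using chief_sub[OF c] chief_ne[OF c] cj_image_iv(1) by (metis image_mono psubsetI)
  fix N assume N: "nm N (cj h ` H) \<and> cj h ` V \<subseteq> N \<and> N \<subseteq> cj h ` U"
  have "nm (cj (iv h) ` N) H" using nm_cj_image[of N "cj h ` H" "iv h"] N by (simp add: cj_image_iv)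
  moreover have "V \<subseteq> cj (iv h) ` N"
    using N image_mono[of "cj h ` V" N "cj (iv h)"] by (simp add: cj_image_iv)
  moreover have "cj (iv h) ` N \<subseteq> U"
    using N image_mono[of N "cj h ` U" "cj (iv h)"] by (simp add: cj_image_iv)
  ultimately have "cj (iv h) ` N = V \<or> cj (iv h) ` N = U" using chief_between[OF c] by blast
  then show "N = cj h ` V \<or> N = cj h ` U" by (metis cj_image_iv(2))
qed

lemma cj_image_sp: "cj h ` sp A B = sp (cj h ` A) (cj h ` B)" for A :: "'a::mult_group set"
proof
  show "cj h ` sp A B \<subseteq> sp (cj h ` A) (cj h ` B)" by (auto simp: cj_mult elim!: spE intro!: spI)
  show "sp (cj h ` A) (cj h ` B) \<subseteq> cj h ` sp A B"
  proof
    fix x assume "x \<in> sp (cj h ` A) (cj h ` B)"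
    then obtain a b where "a \<in> A" "b \<in> B" "x = cj h (a * b)" by (auto simp: cj_mult elim!: spE)
    then show "x \<in> cj h ` sp A B" by (simp add: spI)
  qed
qed

text \<open>Conjugation by \<open>h\<close> permutes the subgroups of \<open>G\<close> together with
  their chief factors.\<close>

lemma strong_cap_cj:
  fixes A :: "'a::mult_group set"
  assumes A: "strong_cap p G (cj h ` A)" and G: "sg G" and h: "h \<in> G"
  shows "strong_cap p G A"
  unfolding strong_cap_def cap_in_def
proof (intro allI impI, elim conjE)
  fix H U V assume H: "sg H" "A \<subseteq> H" "H \<subseteq> G" and c: "chief H U V" and d: "p dvd card U div card V"
  have "cj h ` H \<subseteq> G" using H(3) sg_cj[OF G h] by blast
  then have "cap_in p (cj h ` H) (cj h ` A)"
    using A sg_cj_image[OF H(1)] H(2) unfolding strong_cap_def by blast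
  then have "cj h ` U \<subseteq> sp (cj h ` V) (cj h ` A) \<or> cj h ` U \<inter> cj h ` A \<subseteq> cj h ` V"
    using chief_cj_image[OF c] d unfolding cap_in_def by simp
  then have "cj h ` U \<subseteq> cj h ` sp V A \<or> cj h ` (U \<inter> A) \<subseteq> cj h ` V"
    by (simp add: cj_image_sp image_Int[OF inj_cj])
  then show "U \<subseteq> sp V A \<or> U \<inter> A \<subseteq> V" by (simp add: inj_image_subset_iff[OF inj_cj])
qed

lemma group_prime_order_cyclic:
  assumes p: "prime p" and M: "group M" and o: "order M = p"
  shows "cyclic_group M"
proof -
  interpret M: group M by (rule M)
  have fin: "finite (carrier M)" using o prime_gt_0_nat[OF p] M.order_gt_0_iff_finite by simp
  have "carrier M \<noteq> {\<one>\<^bsub>M\<^esub>}" using o p M.order_one_triv_iff by auto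
  then obtain x where x: "x \<in> carrier M" "x \<noteq> \<one>\<^bsub>M\<^esub>" using M.one_closed by blast
  have "M.ord x dvd p" using M.ord_dvd_group_order[OF x(1)] o by simp
  then have "M.ord x = p" using p M.ord_eq_1[OF x(1)] x(2) by (auto simp: prime_nat_iff)
  then have "card (carrier (subgroup_generated M {x})) = card (carrier M)"
    using M.cyclic_order_is_ord[OF x(1)] o by (simp add: order_def)
  moreover have "carrier (subgroup_generated M {x}) \<subseteq> carrier M"
    by (rule M.carrier_subgroup_generated_subset)
  ultimately have "carrier (subgroup_generated M {x}) = carrier M" using fin card_subset_eq by blast
  then show ?thesis using M.carrier_subgroup_generated_by_singleton[OF x(1)] M.cyclic_group x(1) by auto
qed

text \<open>The elements \<open>1\<close>, \<open>a\<close>, \<open>b\<close>, \<open>a * b\<close>,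
  \<open>b * a\<close> are distinct.\<close>

lemma noncommuting_card:
  fixes S :: "'a::mult_group set"
  assumes S: "sg S" and ab: "a \<in> S" "b \<in> S" "a * b \<noteq> b * a"
  shows "4 < card S"
proof -
  have ne: "a \<noteq> 1" "b \<noteq> 1" "a \<noteq> b" "a * b \<noteq> a" "a * b \<noteq> b" "b * a \<noteq> a" "b * a \<noteq> b" "a * b \<noteq> 1" "b * a \<noteq> 1"
  proof -
    show "a \<noteq> 1" "b \<noteq> 1" "a \<noteq> b" using ab(3) by auto
    then show "a * b \<noteq> a" "a * b \<noteq> b" "b * a \<noteq> a" "b * a \<noteq> b"
      by (metis mult_left_cancel_iff mult_right_cancel_iff mult_1_left mult_1_right)+
    show "a * b \<noteq> 1" "b * a \<noteq> 1" using ab(3) iv_unique[of a b] iv_unique[of b a] by auto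
  qed
  have "card {1, a, b, a * b, b * a} = 5" using ne ab(3) by auto
  moreover have "{1, a, b, a * b, b * a} \<subseteq> S" using S ab by (auto simp: sg_one sg_mult)
  then have "card {1, a, b, a * b, b * a} \<le> card S" using card_mono[OF sg_finite[OF S]] by blast
  ultimately show ?thesis by simp
qed

context finite_group
begin

lemma emb_syl:
  assumes p: "prime p" and S: "sylow_subgroup G p S"
  shows "is_sylow p (emb ` S) (emb ` carrier G)"
proof -
  have sS: "subgroup S G" and cS: "card S = p ^ multiplicity p (order G)" using S by (auto simp: sylow_subgroup_def)
  have SG: "S \<subseteq> carrier G" using subgroup.subset[OF sS] .
  have o: "order G \<noteq> 0" using finite_carrier order_gt_0_iff_finite by simp
  obtain m where m: "order G = p ^ multiplicity p (order G) * m" "\<not> p dvd m"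
    using multiplicity_decompose'[of "order G" p] o p not_prime_unit by metis
  have "card (emb ` carrier G) div card (emb ` S) = m"
    using m(1) cS card_emb[OF SG] card_emb[OF subset_refl] prime_gt_0_nat[OF p]
    by (metis nonzero_mult_div_cancel_left order_def power_not_zero less_numeral_extra(3))
  then show ?thesis
    using m(2) emb_sg[OF sS] emb_sg[OF subgroup_self] SG cS card_emb[OF SG]
    by (auto simp: is_sylow_def psg_def)
qed

text \<open>The hypotheses concern subgroups of \<open>S\<close> only; every p-subgroup is conjugate
  into \<open>S\<close>, and cover-avoidance is invariant under conjugation.\<close>

lemma strong_cap_all:
  assumes p: "prime p" and S: "sylow_subgroup G p S"
    and A: "psg p A" "A \<subseteq> emb ` carrier G"
    and h: "\<And>B h. subgroup B G \<Longrightarrow> B \<subseteq> S \<Longrightarrow> h \<in> emb ` carrier G \<Longrightarrow> emb ` B = cj h ` A \<Longrightarrow> strong_p_CAP_subgroup G p B"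
  shows "strong_cap p (emb ` carrier G) A"
proof -
  have sS: "subgroup S G" using S by (simp add: sylow_subgroup_def)
  have SG: "S \<subseteq> carrier G" using subgroup.subset[OF sS] .
  obtain k where k: "k \<in> emb ` carrier G" "cj k ` A \<subseteq> emb ` S" using sylow_conj[OF p emb_syl[OF p S] A] .
  have "cj k ` A \<subseteq> emb ` carrier G" using k(2) SG by blast
  then obtain B where B: "subgroup B G" "cj k ` A = emb ` B" using sg_emb[OF sg_cj_image[OF psg_sg[OF A(1)]]] by metis
  have "B \<subseteq> S" using emb_subset_iff[OF subgroup.subset[OF B(1)] SG] B(2) k(2) by simp
  then have "strong_p_CAP_subgroup G p B" using h[OF B(1) _ k(1)] B(2) by simp
  then have "strong_cap p (emb ` carrier G) (cj k ` A)" using strong_CAP_scap B(2) by simp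
  then show ?thesis using strong_cap_cj[OF _ emb_sg[OF subgroup_self] k(1)] by blast
qed

end

theorem theorem1p8:
  fixes G :: "('a, 'b) monoid_scheme" and p :: nat and S :: "'a set"
  assumes "group G" and "finite (carrier G)"
    and "Factorial_Ring.prime p" and "p dvd order G"
    and "sylow_subgroup G p S"
    and "\<exists>D. subgroup D (G\<lparr>carrier := S\<rparr>) \<and> 1 < card D \<and> card D < card S \<and>
          ((odd p \<and>
            (\<forall>A. subgroup A (G\<lparr>carrier := S\<rparr>) \<and> card A = card D \<longrightarrow> strong_p_CAP_subgroup G p A))
           \<or>
           (p = 2 \<and>
            (\<forall>A. subgroup A (G\<lparr>carrier := S\<rparr>) \<and> card A = card D \<longrightarrow> strong_p_CAP_subgroup G 2 A) \<and>
            group_exponent (G\<lparr>carrier := S\<rparr>) dvd 2 ^ 2 \<and>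
            (\<not> comm_group (G\<lparr>carrier := S\<rparr>) \<and> real (card S) / 2 > real (card D) \<and> card D = 2 \<longrightarrow>
              (\<forall>C. subgroup C (G\<lparr>carrier := S\<rparr>) \<and> cyclic_group (G\<lparr>carrier := C\<rparr>) \<and> card C = 4
                 \<longrightarrow> strong_p_CAP_subgroup G 2 C))))"
  shows "supersolvable_fusion (G\<lparr>carrier := S\<rparr>) (group_fusion_system G S)"
proof -
  interpret finite_group G using assms(1,2) by (simp add: finite_group_def finite_group_axioms_def)
  note p = assms(3) and is_sylow = assms(5)
  obtain D where D: "subgroup D (G\<lparr>carrier := S\<rparr>)" "1 < card D" "card D < card S"
    and cases: "(odd p \<and>
            (\<forall>A. subgroup A (G\<lparr>carrier := S\<rparr>) \<and> card A = card D \<longrightarrow> strong_p_CAP_subgroup G p A))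
           \<or>
           (p = 2 \<and>
            (\<forall>A. subgroup A (G\<lparr>carrier := S\<rparr>) \<and> card A = card D \<longrightarrow> strong_p_CAP_subgroup G 2 A) \<and>
            group_exponent (G\<lparr>carrier := S\<rparr>) dvd 2 ^ 2 \<and>
            (\<not> comm_group (G\<lparr>carrier := S\<rparr>) \<and> real (card S) / 2 > real (card D) \<and> card D = 2 \<longrightarrow>
              (\<forall>C. subgroup C (G\<lparr>carrier := S\<rparr>) \<and> cyclic_group (G\<lparr>carrier := C\<rparr>) \<and> card C = 4
                 \<longrightarrow> strong_p_CAP_subgroup G 2 C)))"
    using assms(6) by blast
  have sS: "subgroup S G" using is_sylow by (simp add: sylow_subgroup_def)
  have SG: "S \<subseteq> carrier G" using subgroup.subset[OF sS] .
  interpret SS: group "G\<lparr>carrier := S\<rparr>" by (rule subgroup_imp_group[OF sS])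
  have sub_S: "subgroup B (G\<lparr>carrier := S\<rparr>)" if "subgroup B G" "B \<subseteq> S" for B
    using subgroup_incl[OF that(1) sS that(2)] .
  let ?e = "emb ` carrier G" and ?S = "emb ` S"
  have E: "sg ?e" using emb_sg[OF subgroup_self] .
  have sylE: "is_sylow p ?S ?e" using emb_syl[OF p is_sylow] .
  have pS: "psg p ?S" "?S \<subseteq> ?e" using sylE by (auto simp: is_sylow_def)
  have cS: "card ?S = card S" using card_emb[OF SG] .
  have sD: "subgroup D G" "D \<subseteq> S" using incl_subgroup[OF sS D(1)] subgroup.subset[OF D(1)] by auto
  have "psg p (emb ` D)" using psg_sub[OF p pS(1) emb_sg[OF sD(1)]] sD(2) by blast
  then obtain d where d: "card D = p ^ d" using card_emb[OF subgroup.subset[OF sD(1)]] by (auto simp: psg_def)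
  have d0: "0 < d" using d D(2) by (cases d) auto
  have strongD: "strong_p_CAP_subgroup G p A" if "subgroup A G" "A \<subseteq> S" "card A = p ^ d" for A
    using cases sub_S[OF that(1,2)] that(3) d by auto
  have capD: "strong_cap p ?e A" if A: "psg p A" "A \<subseteq> ?e" "card A = p ^ d" for A
    using strong_cap_all[OF p is_sylow A(1,2)] strongD card_emb A(3) subgroup.subset by (metis card_cj)
  have extra: "odd p \<or> (\<forall>Q. psg p Q \<and> Q \<subseteq> ?e \<longrightarrow> (\<forall>a\<in>Q. \<forall>b\<in>Q. a * b = b * a)) \<or>
     (\<forall>y\<in>?e. \<forall>k. y ^ (p ^ k) = 1 \<longrightarrow> y ^ (p ^ d) = 1 \<or> strong_cap p ?e (cyc y))"
  proof (cases "odd p \<or> comm_group (G\<lparr>carrier := S\<rparr>)")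
    case True
    then show ?thesis
    proof
      assume c: "comm_group (G\<lparr>carrier := S\<rparr>)"
      have cc: "x * y = y * x" if xy: "x \<in> ?S" "y \<in> ?S" for x y
      proof -
        obtain a b where ab: "a \<in> S" "b \<in> S" "x = emb a" "y = emb b" using xy by blast
        have "a \<otimes>\<^bsub>G\<^esub> b = b \<otimes>\<^bsub>G\<^esub> a" using comm_monoid.m_comm[OF comm_group.axioms(1)[OF c], of a b] ab(1,2) by simp
        then show ?thesis using ab SG by (metis emb_mult subsetD)
      qed
      have "a * b = b * a" if Q: "psg p Q" "Q \<subseteq> ?e" "a \<in> Q" "b \<in> Q" for Q a b
      proof -
        obtain h where h: "cj h ` Q \<subseteq> ?S" using sylow_conj[OF p sylE Q(1,2)] by blast
        then have "cj h a * cj h b = cj h b * cj h a" using cc Q(3,4) by blast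
        then show ?thesis by (simp flip: cj_mult)
      qed
      then show ?thesis by blast
    qed blast
  next
    case False
    then have p2: "p = 2" and nc: "\<not> comm_group (G\<lparr>carrier := S\<rparr>)" and ev: "\<not> odd p" using cases by auto
    have ex: "group_exponent (G\<lparr>carrier := S\<rparr>) dvd 4"
      and C4: "real (card S) / 2 > real (card D) \<Longrightarrow> card D = 2 \<Longrightarrow>
         subgroup C (G\<lparr>carrier := S\<rparr>) \<Longrightarrow> cyclic_group (G\<lparr>carrier := C\<rparr>) \<Longrightarrow> card C = 4 \<Longrightarrow> strong_p_CAP_subgroup G 2 C" for C
      using cases ev nc by auto
    have exS: "x ^ 4 = 1" if x: "x \<in> ?S" for x
    proof -
      obtain a where a: "a \<in> S" "x = emb a" using x by auto
      have "SS.ord a dvd group_exponent (G\<lparr>carrier := S\<rparr>)"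
        unfolding group_exponent_def using a(1) by (intro dvd_Lcm) simp
      then have "SS.ord a dvd 4" using ex dvd_trans by blast
      then have "a [^]\<^bsub>G\<lparr>carrier := S\<rparr>\<^esub> (4::nat) = \<one>\<^bsub>G\<^esub>" using SS.pow_eq_id[of a 4] a(1) by simp
      then have "a [^]\<^bsub>G\<^esub> (4::nat) = \<one>\<^bsub>G\<^esub>" using nat_pow_consistent[of a 4 S] by simp
      then show ?thesis using emb_pow[of a 4] a SG emb_one by auto
    qed
    have "y ^ (p ^ d) = 1 \<or> strong_cap p ?e (cyc y)" if y: "y \<in> ?e" "y ^ (p ^ k) = 1" for y k
    proof -
      have cy: "psg p (cyc y)" "cyc y \<subseteq> ?e" using cyc_psg[OF p E y] cyc_sub[OF E y(1)] .
      obtain h where h: "cj h ` cyc y \<subseteq> ?S" using sylow_conj[OF p sylE cy] by blast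
      have "cj h y \<in> ?S" using h cyc_self[of y] by blast
      then have "cj h (y ^ 4) = cj h 1" using exS by (simp add: cj_power)
      then have y4: "y ^ 4 = 1" by (simp only: cj_inject)
      \<comment> \<open>Exponent 4 settles \<open>2 \<le> d\<close>, and \<open>y ^ 2 = 1\<close>
        suffices for every positive \<open>d\<close>; only elements of order 4 with
        \<open>d = 1\<close> need the condition on cyclic subgroups.\<close>
      consider "2 \<le> d" | "y ^ 2 = 1" | "d = 1" "y ^ 2 \<noteq> 1" using d0 by linarith
      then show ?thesis
      proof cases
        case 1
        then have "(4::nat) dvd 2 ^ d" using le_imp_power_dvd[of 2 d "2::nat"] by simp
        then obtain m where "(2::nat) ^ d = 4 * m" by auto
        then show ?thesis using y4 p2 by (simp add: power_mult)
      next
        case 2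
        have "p ^ d = 2 * 2 ^ (d - 1)" using d0 p2 by (metis Suc_diff_1 power_Suc)
        then show ?thesis using 2 by (simp add: power_mult)
      next
        case 3
        have sc: "sg (cyc y)" using psg_sg[OF cy(1)] .
        have "card (cyc y) dvd 4" "\<not> card (cyc y) dvd 2" using cyc_card[OF sc] y4 3(2) by auto
        then have c4: "card (cyc y) = 4"
        proof -
          have "card (cyc y) \<le> 4" using \<open>card (cyc y) dvd 4\<close> by (simp add: dvd_imp_le)
          moreover have "card (cyc y) \<noteq> 0" "card (cyc y) \<noteq> 1" "card (cyc y) \<noteq> 2" "card (cyc y) \<noteq> 3"
            using \<open>card (cyc y) dvd 4\<close> \<open>\<not> card (cyc y) dvd 2\<close> sg_card_pos[OF sc] by auto
          ultimately show ?thesis by linarith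
        qed
        \<comment> \<open>A nonabelian \<open>S\<close> has more than 4 elements, which supplies the
          numerical condition on \<open>card S\<close> and \<open>card D = 2\<close>.\<close>
        have "\<exists>a\<in>S. \<exists>b\<in>S. a \<otimes>\<^bsub>G\<^esub> b \<noteq> b \<otimes>\<^bsub>G\<^esub> a"
          using nc SS.group_comm_groupI by fastforce
        then obtain a b where ab: "a \<in> S" "b \<in> S" "a \<otimes>\<^bsub>G\<^esub> b \<noteq> b \<otimes>\<^bsub>G\<^esub> a" by blast
        have "emb a * emb b \<noteq> emb b * emb a"
          using ab SG emb_eq_iff[of "a \<otimes>\<^bsub>G\<^esub> b" "b \<otimes>\<^bsub>G\<^esub> a"] by (auto simp: subset_iff simp flip: emb_mult)
        then have "4 < card S" using noncommuting_card[OF psg_sg[OF pS(1)], of "emb a" "emb b"] ab cS by auto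
        moreover have D2: "card D = 2" using d 3(1) p2 by simp
        ultimately have big: "real (card S) / 2 > real (card D)" by simp
        have "strong_cap p ?e (cyc y)"
        proof (rule strong_cap_all[OF p is_sylow cy])
          fix B h assume B: "subgroup B G" "B \<subseteq> S" "emb ` B = cj h ` cyc y"
          have BG: "B \<subseteq> carrier G" using subgroup.subset[OF B(1)] .
          have "card B = 4" using card_emb[OF BG] B(3) c4 by simp
          moreover have "cyclic_group (G\<lparr>carrier := B\<rparr>)"
          proof -
            interpret B: group "G\<lparr>carrier := B\<rparr>" by (rule subgroup_imp_group[OF B(1)])
            have "cj h y \<in> emb ` B" using B(3) cyc_self[of y] by blast
            then obtain x where x: "x \<in> B" "emb x = cj h y" by auto
            have "B \<subseteq> range (\<lambda>n::int. x [^]\<^bsub>G\<lparr>carrier := B\<rparr>\<^esub> n)"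
            proof
              fix b assume b: "b \<in> B"
              then have "emb b \<in> cj h ` cyc y" using B(3) by blast
              then obtain n where "emb b = cj h (y ^ n)" by (auto simp: cyc_def)
              then have "emb b = emb (x [^]\<^bsub>G\<^esub> n)" using emb_pow[of x n] x BG by (auto simp: cj_power)
              then have "b = x [^]\<^bsub>G\<^esub> n" using emb_eq_iff b x(1) BG by (metis nat_pow_closed subsetD)
              then have "b = x [^]\<^bsub>G\<lparr>carrier := B\<rparr>\<^esub> (int n)" by (simp add: int_pow_int flip: nat_pow_consistent)
              then show "b \<in> range (\<lambda>n::int. x [^]\<^bsub>G\<lparr>carrier := B\<rparr>\<^esub> n)" by blast
            qed
            moreover have "range (\<lambda>n::int. x [^]\<^bsub>G\<lparr>carrier := B\<rparr>\<^esub> n) \<subseteq> B"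
              using B.int_pow_closed[of x] x(1) by auto
            ultimately show ?thesis unfolding B.cyclic_group using x(1) by auto
          qed
          ultimately show "strong_p_CAP_subgroup G p B" using C4[OF big D2 sub_S[OF B(1,2)]] p2 by simp
        qed
        then show ?thesis ..
      qed
    qed
    then show ?thesis by blast
  qed
  have cap_hyp: "cap_hyp p d ?e" unfolding cap_hyp_def using d0 capD extra by blast
  have "p ^ d < card ?S" using D(3) d cS by simp
  then have "loc_res_act_as_p p ?e" using loc_res_act_as_p_of_hyp[OF p cap_hyp E pS] by blast
  from supersolvable_chain[OF p this E sylE]
  obtain n :: nat and T where T: "T 0 = {1}" "T n = ?S"
    and Tm: "\<forall>i\<le>n. sg (T i) \<and> T i \<subseteq> ?S \<and>
      (\<forall>A g. sg A \<and> A \<subseteq> T i \<and> g \<in> ?e \<and> cj g ` A \<subseteq> ?S \<longrightarrow> cj g ` A \<subseteq> T i)"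
    and Ts: "\<forall>i<n. T i \<subseteq> T (Suc i) \<and> card (T (Suc i)) = p * card (T i)"
    by (elim exE conjE)
  have Ti: "sg (T i) \<and> T i \<subseteq> ?S" if "i \<le> n" for i
    using Tm that by blast
  have Tc: "cj g ` A \<subseteq> T i" if "i \<le> n" "sg A" "A \<subseteq> T i" "g \<in> ?e" "cj g ` A \<subseteq> ?S" for i A g
    using Tm that by blast
  \<comment> \<open>The chain found in the image is pulled back to subgroups of
    \<open>S\<close>.\<close>
  define B where "B i = {x \<in> S. emb x \<in> T i}" for i
  have BS: "B i \<subseteq> S" "B i \<subseteq> carrier G" for i using SG by (auto simp: B_def)
  have eB: "emb ` B i = T i" if "i \<le> n" for i using Ti[OF that] by (auto simp: B_def)
  have sB: "subgroup (B i) G" if i: "i \<le> n" for i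
  proof -
    have "T i \<subseteq> ?e" using Ti[OF i] pS(2) by blast
    then obtain H where H: "subgroup H G" "T i = emb ` H" using sg_emb Ti[OF i] by metis
    then have "B i = H" using eB[OF i] emb_image_eq_iff[OF BS(2) subgroup.subset[OF H(1)]] by simp
    then show ?thesis using H by simp
  qed
  have closed: "strongly_closed (G\<lparr>carrier := S\<rparr>) (group_fusion_system G S) (B i)" if i: "i \<le> n" for i
    unfolding strongly_closed_def
  proof (intro conjI allI impI sub_S sB i BS, elim conjE)
    fix R \<phi> assume R: "subgroup R (G\<lparr>carrier := S, carrier := B i\<rparr>)"
      and \<phi>: "\<phi> \<in> group_fusion_system G S R (carrier (G\<lparr>carrier := S\<rparr>))"
    obtain g where g: "g \<in> carrier G" "\<phi> = restrict (conj_by G g) R" "conj_by G g ` R \<subseteq> S"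
      using \<phi> unfolding group_fusion_system_def by auto
    have R': "subgroup R G" "R \<subseteq> B i"
      using incl_subgroup[OF sB[OF i], of R] R subgroup.subset[OF R] by simp_all
    have RG: "R \<subseteq> carrier G" using subgroup.subset[OF R'(1)] .
    \<comment> \<open>\<open>conj_by\<close> uses the opposite convention, so it corresponds to
      \<open>cj\<close> with the inverse element.\<close>
    have ec: "emb (conj_by G g x) = cj (iv (emb g)) (emb x)" if "x \<in> R" for x
      using that RG g(1) by (auto simp: conj_by_def cj_def emb_mult emb_inv)
    have "cj (iv (emb g)) ` emb ` R = emb ` conj_by G g ` R" using ec by (force simp: image_image)
    moreover have "emb ` R \<subseteq> T i" using R'(2) eB[OF i] by blast
    moreover have "iv (emb g) \<in> ?e" using emb_inv[OF g(1)] g(1) by (metis image_eqI inv_closed)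
    ultimately have "emb ` conj_by G g ` R \<subseteq> T i"
      using Tc[OF i emb_sg[OF R'(1)], of "iv (emb g)"] g(3) by (simp add: image_mono)
    then have "conj_by G g ` R \<subseteq> B i" using g(3) by (auto simp: B_def)
    then show "\<phi> ` R \<subseteq> B i" using g(2) by auto
  qed
  have norm: "B i \<lhd> (G\<lparr>carrier := S\<rparr>)\<lparr>carrier := B (Suc i)\<rparr>" if i: "i < n" for i
  proof (rule SS.normal_restrict_supergroup)
    show "subgroup (B (Suc i)) (G\<lparr>carrier := S\<rparr>)" using sub_S[OF sB BS(1)] i by simp
    show "B i \<lhd> G\<lparr>carrier := S\<rparr>" using strongly_closed_imp_normal[OF assms(1) sS closed] i by simp
    show "B i \<subseteq> B (Suc i)" using Ts i by (auto simp: B_def)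
  qed
  have cyc: "cyclic_group ((G\<lparr>carrier := S\<rparr>)\<lparr>carrier := B (Suc i)\<rparr> Mod B i)" if i: "i < n" for i
  proof (rule group_prime_order_cyclic[OF p])
    show "group ((G\<lparr>carrier := S\<rparr>)\<lparr>carrier := B (Suc i)\<rparr> Mod B i)"
      using normal.factorgroup_is_group[OF norm[OF i]] .
    have nB: "B i \<lhd> G\<lparr>carrier := B (Suc i)\<rparr>" using norm[OF i] by simp
    have "card (B (Suc i)) = p * card (B i)" using Ts i eB[of i] eB[of "Suc i"] card_emb[OF BS(2)] i
      by (metis Suc_leI less_imp_le)
    moreover have "card (B i) \<noteq> 0" using sg_card_pos[of "T i"] Ti[of i] eB[of i] card_emb[OF BS(2), of i] i by simp
    ultimately have "card (B (Suc i)) div card (B i) = p" by simp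
    then show "order ((G\<lparr>carrier := S\<rparr>)\<lparr>carrier := B (Suc i)\<rparr> Mod B i) = p"
      using order_Mod[OF sB nB] i by simp
  qed
  have "B 0 = {\<one>\<^bsub>G\<^esub>}"
    using eB[of 0] T(1) emb_one emb_image_eq_iff[OF BS(2)[of 0], of "{\<one>\<^bsub>G\<^esub>}"] by simp
  moreover have "B n = S" using eB[of n] T(2) emb_image_eq_iff[OF BS(2) SG] by simp
  ultimately show ?thesis
    unfolding supersolvable_fusion_def using closed norm cyc
    by (intro exI[of _ n] exI[of _ B]) simp
qed

end
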